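(* Let $k,d$ be positive integers. There is a constant $C_d>2$ depending only on $d$ and a constant $C_{d,k}>2$ depending only on $d$ and $k$ such that the following holds. Let $f_1,\dots,f_k\in\mathbb{R}[X]$ be polynomials of degree at most $d$ such that $f_1(0)=\dots=f_k(0)=0$. Let $\epsilon_1,\dots,\epsilon_k\in(0,1/100]$, and put $\Delta=\prod_{i=1}^k\epsilon_i$. If $x$ is a real number with $\Delta^{-1}\le x^{1/C_d}$ and $x>C_{d,k}$, then there is a positive integer $n<x$ such that \[ \|f_i(n)\|_{\mathbb{R}/\mathbb{Z}}\le \epsilon_i\qquad\text{for all } i\in\{1,\dots,k\}. \]
   Context: For $t\in\mathbb{R}$, $\|t\|_{\mathbb{R}/\mathbb{Z}}$ denotes the distance from $t$ to the nearest integer. *)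

theory Defs
  imports "HOL-Analysis.Analysis" "HOL-Computational_Algebra.Polynomial"
begin

definition dist_nearest_int :: "real \<Rightarrow> real" where
  "dist_nearest_int t = infdist t \<int>"

end

(*
Let n_i be of the order of epsilon_i^(-2), and for an integer vector a with |a_i| <= 4 n_i let S(a) be
the normalised exponential sum of the polynomial sum_i a_i f_i over the multiples of q up to about
x / Z.  If no such multiple is a solution, then, by a second moment computation, the sum of |S(a)| over
those a that are not approximate rational relations of level (q, Z) is at least a constant times the
number L of approximate relations of level (q, Z).

By Weyl's inequality, |S(a)| >= 1/W forces the coefficients of sum_i a_i f_i to be close to
rationals with denominators q h, where h is at most Q, a fixed power of W (the level of a).  So it
suffices to show that no small levels occur and that there are at most Q^(c1) L frequencies of level Q,
for a small exponent c1.  The pair (q, Z) is chosen to nearly maximise the number of approximate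
relations divided by (q Z)^c, at a scale t where this maximum is stable.  Then levels up to a power of t
are empty: a frequency of such a level would produce many disjoint translates of the set of relations
inside the set of relations of a nearby pair.  For larger Q, if there were many frequencies of level Q,
then their s-fold sums would be too numerous to fit in a box: by the divisor bound, an s-fold sum of
frequencies whose denominators have essentially no common factors nearly determines its summands.

All auxiliary pairs (q, Z) are bounded by fixed powers of the product of the n_i, and the number of
functions k only enters the multiplicative constants, which is why the exponent depends only on d.
*)
theory Submission
  imports Defs "HOL-Computational_Algebra.Primes" "HOL-Library.Function_Algebras"
begin

section \<open>Exponential sums\<close>

text \<open>The obstacle is that the exponent must not depend on k. The scale t is taken of the
  order of vol^(1/k), where \<open>vol\<close> is the product of the side lengths 4 n_i. This gives
  vol <= t^k, yet \<open>box t\<close> has at most a constant times vol^2 elements, so (q Z)^c, and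
  hence q Z, stays below a fixed power of \<open>vol\<close>. The number s of summands may grow with
  k, but it is chosen least possible for the given Q, which bounds Q^s by Q vol^(8/c1) without k in
  the exponent. With C the exponent in Weyl's inequality, c1 is 1/(2C): the frequencies with |S(a)|
  about 1/W have level about W^C, so at most about W^(1/2) L of them exist, and their total is small
  once summed over large dyadic W. Denominators and precisions are homogeneous: the coefficient of
  index j is compared with fractions of denominator q^j up to (Z/X)^j. This suits evaluation at
  multiples of q; moreover two such fractions with denominators q^j and r^j must agree, hence have
  denominator gcd(q, r)^j, once X exceeds a fixed multiple of Z q r.\<close>

definition ee :: "real \<Rightarrow> complex" where
  "ee t = cis (2 * pi * t)"

definition near :: "real \<Rightarrow> real \<Rightarrow> bool" where
  "near t \<epsilon> \<longleftrightarrow> (\<exists>b::int. \<bar>t - b\<bar> \<le> \<epsilon>)"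

lemma ee_add: "ee (s + t) = ee s * ee t"
  by (simp add: ee_def distrib_left cis_mult)

lemma ee_0 [simp]: "ee 0 = 1"
  by (simp add: ee_def)

lemma norm_ee [simp]: "norm (ee t) = 1"
  by (simp add: ee_def)

lemma ee_of_int [simp]: "ee (of_int n) = 1"
  by (metis ee_def cis_multiple_2pi Ints_of_int)

lemma cnj_ee: "cnj (ee t) = ee (- t)"
  by (simp add: ee_def cis_cnj)

lemma ee_diff: "ee (s - t) = ee s * cnj (ee t)"
  by (simp add: cnj_ee flip: ee_add)

lemma norm_ee_minus_one: "norm (ee t - 1) = 2 * \<bar>sin (pi * t)\<bar>"
  using dist_exp_i_1[of "2 * pi * t"]
  by (simp add: ee_def cis_conv_exp mult.commute mult.assoc)

text \<open>The integer b is free because \<open>ee\<close> has period 1; 8 bounds 2 pi through pi <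
  4.\<close>

lemma norm_ee_diff_le: "norm (ee s - ee t) \<le> 8 * \<bar>s - t - of_int b\<bar>"
proof -
  have "ee s - ee t = ee t * (ee (s - t - of_int b) - 1)"
    using ee_add[of "s - t - of_int b" "of_int b"] ee_add[of t "s - t"] by (simp add: algebra_simps)
  then have "norm (ee s - ee t) = 2 * \<bar>sin (pi * (s - t - of_int b))\<bar>"
    by (simp add: norm_mult norm_ee_minus_one)
  also have "\<dots> \<le> 2 * \<bar>pi * (s - t - of_int b)\<bar>"
    by (intro mult_left_mono abs_sin_x_le_abs_x) auto
  also have "\<dots> = 2 * pi * \<bar>s - t - of_int b\<bar>"
    by (simp add: abs_mult)
  also have "\<dots> \<le> 8 * \<bar>s - t - of_int b\<bar>"
    using pi_less_4 by (intro mult_right_mono) auto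
  finally show ?thesis .
qed

text \<open>Jordan's inequality: sine is concave on [0, pi], so up to pi/2 it lies above the chord
  from 0 to pi/2.\<close>

lemma sin_ge_two_mult:
  fixes t :: real
  assumes "0 \<le> t" "t \<le> 1/2"
  shows "2 * t \<le> sin (pi * t)"
proof -
  have "concave_on {0..pi} sin"
  proof (rule f''_le0_imp_concave)
    show "convex {0..pi}" by simp
  next
    fix x :: real assume "x \<in> {0..pi}"
    show "(sin has_real_derivative cos x) (at x)" by (rule DERIV_sin)
    show "(cos has_real_derivative - sin x) (at x)" by (rule DERIV_cos)
    show "- sin x \<le> 0" using \<open>x \<in> {0..pi}\<close> sin_ge_zero by simp
  qed
  then have "sin ((1 - 2*t) *\<^sub>R 0 + (2*t) *\<^sub>R (pi/2)) \<ge> (1 - 2*t) * sin 0 + (2*t) * sin (pi/2)"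
    using assms by (intro concave_onD) auto
  then show ?thesis by (simp add: mult.commute)
qed

lemma norm_ee_minus_one_ge:
  assumes "\<bar>t - of_int b\<bar> \<le> 1/2"
  shows "4 * \<bar>t - of_int b\<bar> \<le> norm (ee t - 1)"
proof -
  have "ee t = ee (t - of_int b)"
    using ee_add[of "t - of_int b" "of_int b"] by simp
  then have "norm (ee t - 1) = 2 * \<bar>sin (pi * (t - of_int b))\<bar>"
    by (simp add: norm_ee_minus_one)
  also have "\<bar>sin (pi * (t - of_int b))\<bar> = sin (pi * \<bar>t - of_int b\<bar>)"
  proof -
    have "sin (pi * \<bar>t - of_int b\<bar>) \<ge> 0"
      using sin_ge_two_mult[of "\<bar>t - of_int b\<bar>"] assms
      by (meson abs_ge_zero mult_nonneg_nonneg order_trans zero_le_numeral)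
    moreover have "sin (pi * \<bar>t - of_int b\<bar>) = sin (pi * (t - of_int b)) \<or>
        sin (pi * \<bar>t - of_int b\<bar>) = - sin (pi * (t - of_int b))"
      by (metis (no_types, opaque_lifting) abs_if mult_minus_right sin_minus)
    ultimately show ?thesis by auto
  qed
  also have "2 * \<dots> \<ge> 2 * (2 * \<bar>t - of_int b\<bar>)"
    using sin_ge_two_mult[of "\<bar>t - of_int b\<bar>"] assms by simp
  finally show ?thesis by simp
qed

lemma near_half: "near t (1/2)"
  unfolding near_def
  by (intro exI[of _ "round t"]) (metis abs_minus_commute of_int_round_abs_le)

text \<open>The sum telescopes after multiplication by \<open>ee t - 1\<close>. The product form
  also covers integral t, where that factor vanishes.\<close>

lemma norm_geometric_ee_le:
  "norm (\<Sum>m\<in>{1..M::nat}. ee (real m * t)) * norm (ee t - 1) \<le> 2"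
proof -
  have "(\<Sum>m\<in>{1..M}. ee (real m * t)) * (ee t - 1) = ee (real (Suc M) * t) - ee t"
  proof (induction M)
    case (Suc M)
    have "ee (real (Suc (Suc M)) * t) = ee (real (Suc M) * t) * ee t"
      by (simp add: distrib_right flip: ee_add)
    with Suc show ?case by (simp add: distrib_right right_diff_distrib) (simp add: algebra_simps)
  qed simp
  then have "norm (\<Sum>m\<in>{1..M::nat}. ee (real m * t)) * norm (ee t - 1) = norm (ee (real (Suc M) * t) - ee t)"
    by (metis norm_mult)
  also have "\<dots> \<le> 2"
    using norm_triangle_ineq4[of "ee (real (Suc M) * t)" "ee t"] by simp
  finally show ?thesis .
qed

lemma near_if_geometric_ee_large:
  assumes "s > 0" "norm (\<Sum>m\<in>{1..M::nat}. ee (real m * t)) \<ge> s"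
  shows "near t (1 / (2 * s))"
proof -
  have half: "\<bar>t - of_int (round t)\<bar> \<le> 1/2"
    by (metis abs_minus_commute of_int_round_abs_le)
  have "s * (4 * \<bar>t - of_int (round t)\<bar>) \<le> norm (\<Sum>m\<in>{1..M::nat}. ee (real m * t)) * norm (ee t - 1)"
    using assms norm_ee_minus_one_ge[OF half] by (intro mult_mono) auto
  also have "\<dots> \<le> 2" by (rule norm_geometric_ee_le)
  finally show ?thesis unfolding near_def using assms(1)
    by (intro exI[of _ "round t"]) (simp add: field_simps)
qed

lemma near_mono: "near t a \<Longrightarrow> a \<le> b \<Longrightarrow> near t b"
  unfolding near_def by (meson order_trans)

lemma near_diff: "near s a \<Longrightarrow> near t b \<Longrightarrow> near (s - t) (a + b)"
proof -
  assume "near s a" "near t b"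
  then obtain i j :: int where "\<bar>s - i\<bar> \<le> a" "\<bar>t - j\<bar> \<le> b" unfolding near_def by blast
  then show ?thesis unfolding near_def by (intro exI[of _ "i - j"]) auto
qed

lemma near_mult_int: "near t a \<Longrightarrow> near (of_int m * t) (\<bar>of_int m\<bar> * a)"
proof -
  assume "near t a"
  then obtain i :: int where i: "\<bar>t - i\<bar> \<le> a" unfolding near_def by blast
  have "\<bar>of_int m * t - of_int (m * i)\<bar> = \<bar>of_int m\<bar> * \<bar>t - i\<bar>"
    by (simp add: right_diff_distrib flip: abs_mult)
  also have "\<dots> \<le> \<bar>of_int m\<bar> * a" using i by (intro mult_left_mono) auto
  finally show ?thesis unfolding near_def by blast
qed

lemma near_mult_nat: "near t a \<Longrightarrow> near (real m * t) (real m * a)"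
  using near_mult_int[of t a "int m"] by simp

lemma near_sum:
  assumes "\<And>i. i \<in> A \<Longrightarrow> near (f i) (g i)"
  shows "near (\<Sum>i\<in>A. f i) (\<Sum>i\<in>A. g i)"
proof -
  have "\<forall>i\<in>A. \<exists>b::int. \<bar>f i - b\<bar> \<le> g i" using assms near_def by auto
  then obtain b :: "_ \<Rightarrow> int" where b: "\<And>i. i \<in> A \<Longrightarrow> \<bar>f i - b i\<bar> \<le> g i" by metis
  have "\<bar>(\<Sum>i\<in>A. f i) - of_int (\<Sum>i\<in>A. b i)\<bar> = \<bar>\<Sum>i\<in>A. (f i - b i)\<bar>"
    by (simp add: sum_subtractf)
  also have "\<dots> \<le> (\<Sum>i\<in>A. g i)" using b sum_norm_le[of A "\<lambda>i. f i - b i" g] by auto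
  finally show ?thesis unfolding near_def by blast
qed

lemma norm_ee_diff_le_near: "near (s - t) \<tau> \<Longrightarrow> norm (ee s - ee t) \<le> 8 * \<tau>"
  unfolding near_def using norm_ee_diff_le[of s t] by (meson dual_order.trans mult_left_mono zero_le_numeral)

section \<open>Recurrence: a rational approximation from many near-integral multiples\<close>

lemma card_nat_interval_le:
  fixes A :: "nat set" and L c :: real
  assumes "finite A" "\<And>h. h \<in> A \<Longrightarrow> \<bar>real h - c\<bar> \<le> L" "L \<ge> 0"
  shows "real (card A) \<le> 2*L + 1"
proof (cases "A = {}")
  case False
  have "A \<subseteq> {Min A..Max A}" using assms(1) by auto
  then have "card A \<le> card {Min A..Max A}" by (intro card_mono) auto
  also have "\<dots> = Suc (Max A) - Min A" by simp
  finally have "real (card A) \<le> real (Max A) - real (Min A) + 1"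
    using Min_le[OF assms(1) Max_in[OF assms(1) False]] by linarith
  moreover have "\<bar>real (Max A) - c\<bar> \<le> L" "\<bar>real (Min A) - c\<bar> \<le> L"
    using assms False by auto
  ultimately show ?thesis by linarith
qed (use assms in auto)

lemma card_int_interval_le:
  fixes A :: "int set" and L :: real
  assumes "\<And>h. h \<in> A \<Longrightarrow> \<bar>real_of_int h\<bar> \<le> L" "L \<ge> 0"
  shows "finite A \<and> real (card A) \<le> 2*L + 1"
proof -
  have sub: "A \<subseteq> {-\<lfloor>L\<rfloor>..\<lfloor>L\<rfloor>}"
  proof
    fix h assume "h \<in> A"
    then have "real_of_int h \<le> L" "real_of_int (-h) \<le> L" using assms(1)[of h] by auto
    then have "h \<le> \<lfloor>L\<rfloor>" "-h \<le> \<lfloor>L\<rfloor>" by (metis le_floor_iff)+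
    then show "h \<in> {-\<lfloor>L\<rfloor>..\<lfloor>L\<rfloor>}" by auto
  qed
  then have "card A \<le> card {-\<lfloor>L\<rfloor>..\<lfloor>L\<rfloor>}" by (intro card_mono) auto
  also have "\<dots> = nat (2 * \<lfloor>L\<rfloor> + 1)" using assms(2) by simp
  finally have "real (card A) \<le> 2 * \<lfloor>L\<rfloor> + 1" using assms(2) by linarith
  then have "real (card A) \<le> 2 * L + 1" by linarith
  then show ?thesis using sub finite_subset by blast
qed

text \<open>Dirichlet's theorem gives q with q beta within eta < 1/(16 V) of an integer. If eta were
  larger than claimed, the points h beta would be spread too evenly for as many as N / V of them to
  be near integers.\<close>

lemma vinogradov_recurrence:
  fixes \<beta> \<epsilon> V :: real and N :: nat and H :: "nat set"
  assumes H: "H \<subseteq> {..<N}" and cardH: "real (card H) \<ge> N / V" and V: "V \<ge> 1"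
    and hnear: "\<And>h. h \<in> H \<Longrightarrow> near (real h * \<beta>) \<epsilon>"
    and \<epsilon>0: "\<epsilon> \<ge> 0" and \<epsilon>: "272 * V\<^sup>2 * \<epsilon> \<le> 1" and N: "N \<ge> 16 * V"
  shows "\<exists>q::nat. 1 \<le> q \<and> q \<le> 17 * V \<and> near (real q * \<beta>) (136 * V\<^sup>2 * \<epsilon> / N)"
proof -
  \<comment> \<open>Rounding 16 V up stays below 17 V since V >= 1; this is the origin of 17, of 136
    = 8 * 17 and of 272 = 16 * 17.\<close>
  define Q0 where "Q0 = nat \<lceil>16 * V\<rceil>"
  have Q0: "16 * V \<le> Q0" "Q0 \<le> 17 * V" using V unfolding Q0_def by linarith+
  have "Q0 > 0" using Q0 V by linarith
  then obtain a k where k: "0 < k" "k \<le> int Q0" "\<bar>of_int k * \<beta> - of_int a\<bar> < 1 / Q0"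
    using Dirichlet_approx by blast
  define q where "q = nat k"
  define \<delta> where "\<delta> = real q * \<beta> - a"
  define \<eta> where "\<eta> = \<bar>\<delta>\<bar>"
  have q: "1 \<le> q" "q \<le> 17 * V" using k Q0 unfolding q_def by linarith+
  have qk: "real q = of_int k" using k(1) q_def by simp
  have "\<eta> < 1 / Q0" using k(3) qk unfolding \<eta>_def \<delta>_def by simp
  also have "1 / Q0 \<le> 1 / (16 * V)" using Q0 V by (intro divide_left_mono) auto
  finally have \<eta>_less: "\<eta> < 1 / (16 * V)" .
  have \<eta>_near: "near (real q * \<beta>) \<eta>" unfolding near_def \<eta>_def \<delta>_def by blast
  have N0: "real N > 0" using N V by linarith
  have "\<eta> \<le> 136 * V\<^sup>2 * \<epsilon> / N"
  proof (cases "\<eta> = 0")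
    case True
    then show ?thesis using \<epsilon>0 by simp
  next
    case False
    then have \<eta>0: "\<eta> > 0" unfolding \<eta>_def by simp
    have "\<forall>h\<in>H. \<exists>b::int. \<bar>real h * \<beta> - b\<bar> \<le> \<epsilon>" using hnear near_def by auto
    then obtain b :: "nat \<Rightarrow> int" where b: "\<And>h. h \<in> H \<Longrightarrow> \<bar>real h * \<beta> - b h\<bar> \<le> \<epsilon>" by metis
    \<comment> \<open>An integer within q eps of - h delta. It takes few values, as h delta varies
      by at most N eta, and each value confines h to an interval of length 2 q eps / eta.\<close>
    define w where "w h = int h * a - int q * b h" for h
    have wb: "\<bar>w h + real h * \<delta>\<bar> \<le> q * \<epsilon>" if "h \<in> H" for h
    proof -
      have "w h + real h * \<delta> = real q * (real h * \<beta> - b h)"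
        unfolding w_def \<delta>_def by (simp add: algebra_simps)
      then have "\<bar>w h + real h * \<delta>\<bar> = q * \<bar>real h * \<beta> - b h\<bar>" by (simp add: abs_mult)
      then show ?thesis using b[OF that] by (simp add: mult_left_mono)
    qed
    have finH: "finite H" using H finite_subset by blast
    have hw: "\<bar>real_of_int i\<bar> \<le> N * \<eta> + q * \<epsilon>" if i: "i \<in> w ` H" for i
    proof -
      obtain h where h: "h \<in> H" "i = w h" using i by auto
      have "\<bar>real h * \<delta>\<bar> \<le> N * \<eta>" using H h(1) unfolding \<eta>_def
        by (auto simp: abs_mult intro!: mult_right_mono)
      then show ?thesis using wb[OF h(1)] h(2) by linarith
    qed
    have qe0: "real q * \<epsilon> \<ge> 0" using \<epsilon>0 by simp
    have cw: "real (card (w ` H)) \<le> 2 * (N * \<eta> + q * \<epsilon>) + 1"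
      using card_int_interval_le[OF hw] qe0 \<eta>0 by simp
    have fib: "real (card {h\<in>H. w h = i}) \<le> 2 * (q * \<epsilon> / \<eta>) + 1" for i
    proof (rule card_nat_interval_le)
      show "finite {h\<in>H. w h = i}" using finH by simp
      show "0 \<le> q * \<epsilon> / \<eta>" using qe0 \<eta>0 by simp
      fix h assume "h \<in> {h\<in>H. w h = i}"
      then have "\<bar>i + real h * \<delta>\<bar> \<le> q * \<epsilon>" using wb by blast
      moreover have "\<bar>i + real h * \<delta>\<bar> = \<eta> * \<bar>real h - (- i / \<delta>)\<bar>"
        using \<eta>0 unfolding \<eta>_def by (simp add: field_simps flip: abs_mult)
      ultimately show "\<bar>real h - (- i / \<delta>)\<bar> \<le> q * \<epsilon> / \<eta>" using \<eta>0 by (simp add: field_simps)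
    qed
    have "real (card H) = (\<Sum>i\<in>w ` H. real (card {h\<in>H. w h = i}))"
      using card_eq_sum sum.image_gen[OF finH, of "\<lambda>_. 1::nat" w] by (simp flip: of_nat_sum)
    also have "\<dots> \<le> (\<Sum>i\<in>w ` H. 2 * (q * \<epsilon> / \<eta>) + 1)" by (intro sum_mono fib)
    also have "\<dots> = card (w ` H) * (2 * (q * \<epsilon> / \<eta>) + 1)" by simp
    also have "\<dots> \<le> (2 * (N * \<eta> + q * \<epsilon>) + 1) * (2 * (q * \<epsilon> / \<eta>) + 1)"
      using cw qe0 \<eta>0 by (intro mult_right_mono) auto
    finally have main: "N / V \<le> (2 * (N * \<eta> + q * \<epsilon>) + 1) * (2 * (q * \<epsilon> / \<eta>) + 1)"
      using cardH by linarith
    have "q * \<epsilon> \<le> 17 * V * \<epsilon>" using q \<epsilon>0 by (intro mult_right_mono) auto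
    also have "\<dots> \<le> 17 * V\<^sup>2 * \<epsilon>" using V \<epsilon>0 by (simp add: power2_eq_square mult_right_mono)
    also have "\<dots> \<le> 1/2" using \<epsilon> by linarith
    finally have qe: "q * \<epsilon> \<le> 1/2" .
    have "N / V \<le> (2 * N * \<eta> + 2) * (2 * (q * \<epsilon> / \<eta>) + 1)"
      using qe qe0 \<eta>0 by (intro order_trans[OF main] mult_right_mono) (auto simp: algebra_simps)
    also have "\<dots> = 4 * N * (q * \<epsilon>) + 2 * N * \<eta> + 4 * q * \<epsilon> / \<eta> + 2"
      using \<eta>0 by (simp add: field_simps)
    finally have m2: "N / V \<le> 4 * N * (q * \<epsilon>) + 2 * N * \<eta> + 4 * q * \<epsilon> / \<eta> + 2" .
    have "16 * V * (q * \<epsilon>) \<le> 16 * V * (17 * V * \<epsilon>)"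
      using \<open>q * \<epsilon> \<le> 17 * V * \<epsilon>\<close> V by (intro mult_left_mono) auto
    then have "16 * V * (q * \<epsilon>) \<le> 1" using \<epsilon> by (simp add: power2_eq_square algebra_simps)
    then have t1: "4 * N * (q * \<epsilon>) \<le> N / (4 * V)"
      using V N0 by (simp add: field_simps)
    have t2: "2 * N * \<eta> \<le> N / (8 * V)" using \<eta>_less V N0 by (simp add: field_simps)
    have t3: "2 \<le> N / (8 * V)" using N V by (simp add: field_simps)
    have "N / V = 8 * (N / (8 * V))" "N / (4 * V) = 2 * (N / (8*V))" using V by (simp_all add: field_simps)
    \<comment> \<open>The other three terms use up at most half of N / V, so this one carries the
      remaining half.\<close>
    then have "4 * q * \<epsilon> / \<eta> \<ge> 4 * (N / (8 * V))" using m2 t1 t2 t3 by linarith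
    then have "\<eta> * N \<le> 8 * V * (q * \<epsilon>)" using \<eta>0 V N0 by (simp add: field_simps)
    also have "\<dots> \<le> 8 * V * (17 * V * \<epsilon>)"
      using \<open>q * \<epsilon> \<le> 17 * V * \<epsilon>\<close> V by (intro mult_left_mono) auto
    finally show ?thesis using N0 by (simp add: field_simps power2_eq_square)
  qed
  then show ?thesis using q \<eta>_near near_mono by blast
qed

section \<open>Weyl's inequality\<close>

text \<open>The squared modulus is expanded over pairs (m, n) and sorted by h = m - n >= 0; the
  pairs with m < n give the conjugates of those with m > n. Counting h = 0 twice makes the factor 2
  uniform.\<close>

lemma van_der_corput:
  fixes z :: "nat \<Rightarrow> complex"
  shows "norm (\<Sum>n\<in>{1..N}. z n) ^ 2 \<le> 2 * (\<Sum>h<N. norm (\<Sum>n\<in>{1..N - h}. z (n + h) * cnj (z n)))"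
proof -
  let ?A = "{(m, n). m \<in> {1..N} \<and> n \<in> {1..N} \<and> n \<le> m}"
  let ?B = "{(m, n). m \<in> {1..N} \<and> n \<in> {1..N} \<and> m < n}"
  let ?A' = "{(m, n). m \<in> {1..N} \<and> n \<in> {1..N} \<and> n < m}"
  let ?f = "\<lambda>(m, n). z m * cnj (z n)"
  let ?S = "\<lambda>h. \<Sum>n\<in>{1..N - h}. z (n + h) * cnj (z n)"
  have fin: "finite ?A" "finite ?B" "finite ?A'"
    by (rule finite_subset[of _ "{1..N} \<times> {1..N}"]; force)+
  have eq: "complex_of_real (norm (\<Sum>n\<in>{1..N}. z n) ^ 2) = sum ?f ?A + sum ?f ?B"
  proof -
    have "complex_of_real (norm (\<Sum>n\<in>{1..N}. z n) ^ 2) = (\<Sum>m\<in>{1..N}. z m) * cnj (\<Sum>n\<in>{1..N}. z n)"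
      by (rule complex_norm_square)
    also have "\<dots> = sum ?f ({1..N} \<times> {1..N})"
      by (simp add: sum_product sum.cartesian_product)
    also have "{1..N} \<times> {1..N} = ?A \<union> ?B" by auto
    also have "sum ?f (?A \<union> ?B) = sum ?f ?A + sum ?f ?B"
      using fin by (intro sum.union_disjoint) auto
    finally show ?thesis .
  qed
  have A: "sum ?f ?A = (\<Sum>h<N. ?S h)"
  proof -
    have "(\<Sum>h<N. ?S h) = sum (\<lambda>(h, n). z (n + h) * cnj (z n)) (SIGMA h:{..<N}. {1..N - h})"
      by (rule sum.Sigma) auto
    also have "\<dots> = sum ?f ?A"
      by (rule sum.reindex_bij_witness[of _ "\<lambda>(m, n). (m - n, n)" "\<lambda>(h, n). (n + h, n)"]) auto
    finally show ?thesis by simp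
  qed
  have A': "sum ?f ?A' = (\<Sum>h\<in>{1..<N}. ?S h)"
  proof -
    have "(\<Sum>h\<in>{1..<N}. ?S h) = sum (\<lambda>(h, n). z (n + h) * cnj (z n)) (SIGMA h:{1..<N}. {1..N - h})"
      by (rule sum.Sigma) auto
    also have "\<dots> = sum ?f ?A'"
      by (rule sum.reindex_bij_witness[of _ "\<lambda>(m, n). (m - n, n)" "\<lambda>(h, n). (n + h, n)"]) auto
    finally show ?thesis by simp
  qed
  have B: "sum ?f ?B = cnj (sum ?f ?A')"
    unfolding cnj_sum
    by (rule sum.reindex_bij_witness[of _ "\<lambda>(m, n). (n, m)" "\<lambda>(m, n). (n, m)"]) auto
  have "norm (\<Sum>n\<in>{1..N}. z n) ^ 2 = norm (sum ?f ?A + sum ?f ?B)"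
    unfolding eq[symmetric] by (simp add: norm_power)
  also have "\<dots> \<le> norm (sum ?f ?A) + norm (sum ?f ?A')"
    unfolding B by (rule order_trans[OF norm_triangle_ineq]) (simp only: complex_mod_cnj order_refl)
  also have "\<dots> \<le> (\<Sum>h<N. norm (?S h)) + (\<Sum>h\<in>{1..<N}. norm (?S h))"
    unfolding A A' by (intro add_mono norm_sum)
  also have "(\<Sum>h\<in>{1..<N}. norm (?S h)) \<le> (\<Sum>h<N. norm (?S h))"
    by (rule sum_mono2) auto
  finally show ?thesis by simp
qed

text \<open>The coefficient of n^j in P(n + h) - P(n), where P has degree D and coefficients
  alpha.\<close>

definition diff_coeff :: "nat \<Rightarrow> (nat \<Rightarrow> real) \<Rightarrow> nat \<Rightarrow> nat \<Rightarrow> real" where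
  "diff_coeff D \<alpha> h j = (\<Sum>i\<in>{j<..D}. (real (i choose j) * real h ^ (i - j)) * \<alpha> i)"

lemma diff_coeff_eq:
  "(\<Sum>j\<le>Suc d. \<alpha> j * real (n + h) ^ j) - (\<Sum>j\<le>Suc d. \<alpha> j * real n ^ j)
     = (\<Sum>j\<le>d. diff_coeff (Suc d) \<alpha> h j * real n ^ j)"
proof -
  have "(\<Sum>j\<le>Suc d. \<alpha> j * real (n + h) ^ j) - (\<Sum>j\<le>Suc d. \<alpha> j * real n ^ j)
      = (\<Sum>i\<le>Suc d. \<alpha> i * (\<Sum>j<i. real (i choose j) * real n ^ j * real h ^ (i - j)))"
  proof -
    have "real (n + h) ^ i - real n ^ i = (\<Sum>j<i. real (i choose j) * real n ^ j * real h ^ (i - j))" for i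
      using binomial_ring[of "real n" "real h" i] by (simp add: lessThan_Suc_atMost[symmetric])
    then show ?thesis by (simp only: sum_subtractf[symmetric] right_diff_distrib[symmetric] of_nat_add)
  qed
  also have "\<dots> = (\<Sum>i\<le>Suc d. \<Sum>j<i. \<alpha> i * (real (i choose j) * real n ^ j * real h ^ (i - j)))"
    by (simp add: sum_distrib_left)
  also have "\<dots> = (\<Sum>(i, j)\<in>(SIGMA i:{..Suc d}. {..<i}). \<alpha> i * (real (i choose j) * real n ^ j * real h ^ (i - j)))"
    by (rule sum.Sigma) auto
  also have "\<dots> = (\<Sum>(j, i)\<in>(SIGMA j:{..d}. {j<..Suc d}). \<alpha> i * (real (i choose j) * real n ^ j * real h ^ (i - j)))"
    by (rule sum.reindex_bij_witness[of _ "\<lambda>(i, j). (j, i)" "\<lambda>(i, j). (j, i)"]) auto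
  also have "\<dots> = (\<Sum>j\<le>d. \<Sum>i\<in>{j<..Suc d}. \<alpha> i * (real (i choose j) * real n ^ j * real h ^ (i - j)))"
    by (rule sum.Sigma[symmetric]) auto
  also have "\<dots> = (\<Sum>j\<le>d. diff_coeff (Suc d) \<alpha> h j * real n ^ j)"
    by (intro sum.cong refl) (simp add: diff_coeff_def sum_distrib_left sum_distrib_right mult_ac)
  finally show ?thesis .
qed

text \<open>The summand i = j + 1 equals (j + 1) h alpha_(j+1). In the others h^(i - j) <= N^(i - j)
  turns the precision N^-i into N^-j; the binomials and the number of terms cost a factor W^D
  each.\<close>

lemma near_diff_coeff_remainder:
  fixes \<alpha> :: "nat \<Rightarrow> real"
  assumes jD: "j < D" and hN: "h \<le> N" and N: "N \<ge> 1" and W: "W \<ge> 2"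
    and near: "\<And>i. i \<in> {Suc j<..D} \<Longrightarrow> near (real Q * \<alpha> i) (W ^ E / real N ^ i)"
  shows "near (real Q * diff_coeff D \<alpha> h j - real h * (real (Q * Suc j) * \<alpha> (Suc j))) (W ^ (E + 2 * D) / real N ^ j)"
proof -
  have "{j<..D} = insert (Suc j) {Suc j<..D}" using jD by auto
  then have eq: "real Q * diff_coeff D \<alpha> h j - real h * (real (Q * Suc j) * \<alpha> (Suc j))
     = (\<Sum>i\<in>{Suc j<..D}. real ((i choose j) * h ^ (i - j)) * (real Q * \<alpha> i))"
    unfolding diff_coeff_def by (simp add: sum_distrib_left algebra_simps)
  have "near (\<Sum>i\<in>{Suc j<..D}. real ((i choose j) * h ^ (i - j)) * (real Q * \<alpha> i))
     (\<Sum>i\<in>{Suc j<..D}. real ((i choose j) * h ^ (i - j)) * (W ^ E / real N ^ i))"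
    by (intro near_sum near_mult_nat near)
  moreover have "(\<Sum>i\<in>{Suc j<..D}. real ((i choose j) * h ^ (i - j)) * (W ^ E / real N ^ i))
     \<le> (\<Sum>i\<in>{Suc j<..D}. 2 ^ D * (W ^ E / real N ^ j))"
  proof (intro sum_mono)
    fix i assume i: "i \<in> {Suc j<..D}"
    have "(i choose j) \<le> 2 ^ i" by (rule binomial_le_pow2)
    also have "(2::nat) ^ i \<le> 2 ^ D" using i by (intro power_increasing) auto
    finally have "real (i choose j) \<le> 2 ^ D" by (metis of_nat_le_iff of_nat_numeral of_nat_power)
    moreover have "real h ^ (i - j) \<le> real N ^ (i - j)" using hN by (intro power_mono) auto
    ultimately have "real ((i choose j) * h ^ (i - j)) \<le> 2 ^ D * real N ^ (i - j)"
      unfolding of_nat_mult of_nat_power by (intro mult_mono) auto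
    then have "real ((i choose j) * h ^ (i - j)) * (W ^ E / real N ^ i) \<le> 2 ^ D * real N ^ (i - j) * (W ^ E / real N ^ i)"
      using W by (intro mult_right_mono) auto
    also have "\<dots> = 2 ^ D * (W ^ E / real N ^ j)"
    proof -
      have "real N ^ i = real N ^ (i - j) * real N ^ j" using i by (simp flip: power_add)
      then show ?thesis using N by simp
    qed
    finally show "real ((i choose j) * h ^ (i - j)) * (W ^ E / real N ^ i) \<le> 2 ^ D * (W ^ E / real N ^ j)" .
  qed
  moreover have "(\<Sum>i\<in>{Suc j<..D}. 2 ^ D * (W ^ E / real N ^ j)) \<le> W ^ (E + 2 * D) / real N ^ j"
  proof -
    have "real (card {Suc j<..D}) \<le> real D" by simp
    also have "\<dots> \<le> 2 ^ D" by (metis less_exp less_imp_le of_nat_le_iff of_nat_numeral of_nat_power)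
    also have "(2::real) ^ D \<le> W ^ D" using W by (intro power_mono) auto
    finally have c: "real (card {Suc j<..D}) \<le> W ^ D" .
    have "(\<Sum>i\<in>{Suc j<..D}. 2 ^ D * (W ^ E / real N ^ j)) = real (card {Suc j<..D}) * 2 ^ D * (W ^ E / real N ^ j)"
      by simp
    also have "\<dots> \<le> W ^ D * W ^ D * (W ^ E / real N ^ j)"
      using c W by (intro mult_right_mono mult_mono power_mono) auto
    also have "\<dots> = W ^ (E + 2 * D) / real N ^ j" by (simp add: power_add mult_2)
    finally show ?thesis .
  qed
  ultimately show ?thesis unfolding eq by (meson near_mono order_trans)
qed

text \<open>Absorbs numerical constants into powers of W, so that losses are recorded in exponents
  only.\<close>

lemma pow2_le_pow:
  assumes "(W::real) \<ge> 2" "c \<le> 2 ^ n"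
  shows "c \<le> W ^ n"
  using assms power_mono[of 2 W n] by linarith

text \<open>
  For many \<open>h\<close>, the coefficients of the differenced polynomial are close to rationals with a common
  small denominator \<open>q\<close>.  Its coefficient of index \<open>j\<close> is \<open>(j + 1) h \<alpha>\<^sub>j\<^sub>+\<^sub>1\<close> up to contributions
  of higher \<open>\<alpha>\<^sub>i\<close>, so the \<open>\<alpha>\<^sub>i\<close> are recovered from the top one downwards with
  \<open>vinogradov_recurrence\<close>; \<open>\<alpha>\<^sub>1\<close> is out of reach, as it only enters the constant term.
\<close>

lemma weyl_descent:
  fixes d B :: nat
  assumes "r \<le> d"
  shows "\<exists>E. \<forall>(\<alpha>::nat \<Rightarrow> real) N (W::real) q H. W \<ge> 2 \<longrightarrow> real N \<ge> W ^ E \<longrightarrow> 1 \<le> q \<longrightarrow> real q \<le> W ^ B \<longrightarrow>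
    H \<subseteq> {..<N} \<longrightarrow> real (card H) \<ge> N / W ^ B \<longrightarrow>
    (\<forall>h\<in>H. \<forall>j\<in>{1..d}. near (real q * diff_coeff (Suc d) \<alpha> h j) (W ^ B / real N ^ j)) \<longrightarrow>
    (\<exists>Q. 1 \<le> Q \<and> real Q \<le> W ^ E \<and> q dvd Q \<and> (\<forall>i\<in>{Suc d - r<..Suc d}. near (real Q * \<alpha> i) (W ^ E / real N ^ i)))"
  using assms
proof (induction r)
  case 0
  show ?case by (rule exI[of _ B]) auto
next
  case (Suc r)
  then obtain E where E: "\<And>(\<alpha>::nat \<Rightarrow> real) N (W::real) q H. W \<ge> 2 \<Longrightarrow> real N \<ge> W ^ E \<Longrightarrow> 1 \<le> q \<Longrightarrow> real q \<le> W ^ B \<Longrightarrow>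
    H \<subseteq> {..<N} \<Longrightarrow> real (card H) \<ge> N / W ^ B \<Longrightarrow>
    (\<forall>h\<in>H. \<forall>j\<in>{1..d}. near (real q * diff_coeff (Suc d) \<alpha> h j) (W ^ B / real N ^ j)) \<Longrightarrow>
    (\<exists>Q. 1 \<le> Q \<and> real Q \<le> W ^ E \<and> q dvd Q \<and> (\<forall>i\<in>{Suc d - r<..Suc d}. near (real Q * \<alpha> i) (W ^ E / real N ^ i)))"
    by (metis Suc_leD)
  define E1 where "E1 = E + B + 2 * Suc d + 1"
  define F where "F = 9 + 2 * B + E1 + E + d + 6"
  show ?case
  proof (rule exI[of _ F], intro allI impI)
    fix \<alpha> :: "nat \<Rightarrow> real" and N q :: nat and W :: real and H
    assume W: "W \<ge> 2" and N: "real N \<ge> W ^ F" and q: "1 \<le> q" "real q \<le> W ^ B"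
      and H: "H \<subseteq> {..<N}" "real (card H) \<ge> N / W ^ B"
      and hH: "\<forall>h\<in>H. \<forall>j\<in>{1..d}. near (real q * diff_coeff (Suc d) \<alpha> h j) (W ^ B / real N ^ j)"
    have W1: "W \<ge> 1" using W by simp
    have pinc: "W ^ a \<le> W ^ b" if "a \<le> b" for a b using that W1 by (rule power_increasing)
    have "real N \<ge> W ^ E" using N pinc[of E F] unfolding F_def by linarith
    from E[OF W this q H hH] obtain Q where Q: "1 \<le> Q" "real Q \<le> W ^ E" "q dvd Q"
      "\<And>i. i \<in> {Suc d - r<..Suc d} \<Longrightarrow> near (real Q * \<alpha> i) (W ^ E / real N ^ i)" by blast
    define j where "j = d - r"
    have j: "1 \<le> j" "j \<le> d" "Suc d - r = Suc j" "Suc d - Suc r = j" using Suc.prems unfolding j_def by auto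
    have N1: "real N \<ge> 1" using N one_le_power[OF W1, of F] by linarith
    then have N1': "N \<ge> 1" by simp
    obtain c where c: "Q = q * c" using Q(3) by auto
    then have cQ: "real c \<le> W ^ E" using Q(2) q(1) Q(1)
      by (metis dual_order.trans le_square mult.commute mult_le_mono1 nat_mult_1 of_nat_mono)
    define \<beta> where "\<beta> = real (Q * Suc j) * \<alpha> (Suc j)"
    define \<epsilon> where "\<epsilon> = W ^ E1 / real N ^ j"
    have near\<beta>: "near (real h * \<beta>) \<epsilon>" if "h \<in> H" for h
    proof -
      have "real c * (W ^ B / real N ^ j) \<le> W ^ E * (W ^ B / real N ^ j)"
        using cQ W by (intro mult_right_mono) auto
      moreover have "near (real c * (real q * diff_coeff (Suc d) \<alpha> h j)) (real c * (W ^ B / real N ^ j))"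
        using hH that j by (intro near_mult_nat) auto
      moreover have "real c * (real q * diff_coeff (Suc d) \<alpha> h j) = real Q * diff_coeff (Suc d) \<alpha> h j"
        by (simp add: c)
      ultimately have 1: "near (real Q * diff_coeff (Suc d) \<alpha> h j) (W ^ E * (W ^ B / real N ^ j))"
        by (simp only: near_mono)
      have 2: "near (real Q * diff_coeff (Suc d) \<alpha> h j - real h * \<beta>) (W ^ (E + 2 * Suc d) / real N ^ j)"
        unfolding \<beta>_def
        using that H j Q N1' W by (intro near_diff_coeff_remainder) auto
      have "near (real h * \<beta>) (W ^ E * (W ^ B / real N ^ j) + W ^ (E + 2 * Suc d) / real N ^ j)"
        using near_diff[OF 1 2] by simp
      moreover have "W ^ E * (W ^ B / real N ^ j) + W ^ (E + 2 * Suc d) / real N ^ j \<le> \<epsilon>"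
      proof -
        have "W ^ (E + B) \<le> W ^ (E + B + 2 * Suc d)" "W ^ (E + 2 * Suc d) \<le> W ^ (E + B + 2 * Suc d)"
          by (intro pinc; simp)+
        then have "W ^ E * W ^ B + W ^ (E + 2 * Suc d) \<le> 2 * W ^ (E + B + 2 * Suc d)"
          unfolding power_add[of W E B, symmetric] by linarith
        also have "\<dots> \<le> W * W ^ (E + B + 2 * Suc d)" using W by (intro mult_right_mono) auto
        also have "\<dots> = W ^ E1" unfolding E1_def by simp
        finally show ?thesis unfolding \<epsilon>_def
          by (simp only: times_divide_eq_right add_divide_distrib[symmetric]) (rule divide_right_mono, auto)
      qed
      ultimately show ?thesis by (rule near_mono)
    qed
    have V1: "W ^ B \<ge> 1" using W1 by (rule one_le_power)
    have \<epsilon>: "\<epsilon> \<ge> 0" using W unfolding \<epsilon>_def by auto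
    have "272 * (W ^ B)\<^sup>2 * W ^ E1 \<le> W ^ 9 * (W ^ B)\<^sup>2 * W ^ E1"
      using W by (intro mult_right_mono pow2_le_pow[OF W]) auto
    also have "\<dots> = W ^ (9 + 2 * B + E1)" by (simp add: power_add mult.commute flip: power_mult)
    also have "\<dots> \<le> W ^ F" unfolding F_def by (intro pinc) auto
    also have "\<dots> \<le> real N ^ 1" using N by simp
    also have "\<dots> \<le> real N ^ j" using N1 j by (intro power_increasing) auto
    finally have \<epsilon>1: "272 * (W ^ B)\<^sup>2 * \<epsilon> \<le> 1"
      unfolding \<epsilon>_def using N1 by (simp add: field_simps)
    have "16 * W ^ B \<le> W ^ 4 * W ^ B"
      using W by (intro mult_right_mono pow2_le_pow[OF W]) auto
    also have "\<dots> = W ^ (4 + B)" by (simp add: power_add)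
    also have "\<dots> \<le> W ^ F" unfolding F_def by (intro pinc) auto
    finally have N16: "real N \<ge> 16 * W ^ B" using N by linarith
    from vinogradov_recurrence[OF H(1,2) V1 near\<beta> \<epsilon> \<epsilon>1 N16]
    obtain q' where q': "1 \<le> q'" "real q' \<le> 17 * W ^ B" "near (real q' * \<beta>) (136 * (W ^ B)\<^sup>2 * \<epsilon> / real N)"
      by blast
    \<comment> \<open>The factor j + 1 is the binomial coefficient in front of alpha_(j+1), already
      contained in \<open>\<beta>\<close>; q' is the denominator just found for
      \<open>\<beta>\<close>.\<close>
    define Q' where "Q' = q' * Suc j * Q"
    have q'j0: "real (q' * Suc j) \<le> W ^ (5 + B + Suc d)"
    proof -
      have "real q' \<le> W ^ 5 * W ^ B"
        using q'(2) W by (elim order_trans) (intro mult_right_mono pow2_le_pow[OF W], auto)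
      moreover have "real (Suc j) \<le> W ^ Suc d"
      proof (rule pow2_le_pow[OF W])
        have "Suc j \<le> Suc d" using j by simp
        also have "\<dots> \<le> 2 ^ Suc d" by (metis less_exp less_imp_le)
        finally show "real (Suc j) \<le> 2 ^ Suc d" by (metis of_nat_le_iff of_nat_numeral of_nat_power)
      qed
      ultimately have "real q' * real (Suc j) \<le> W ^ 5 * W ^ B * W ^ Suc d" using W by (intro mult_mono) auto
      also have "W ^ 5 * W ^ B * W ^ Suc d = W ^ (5 + B + Suc d)" by (simp only: power_add)
      finally show ?thesis by (simp only: of_nat_mult)
    qed
    have q'j: "real (q' * Suc j) * W ^ E \<le> W ^ F"
    proof -
      from q'j0 have "real (q' * Suc j) * W ^ E \<le> W ^ (5 + B + Suc d) * W ^ E" using W by (intro mult_right_mono) auto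
      also have "\<dots> = W ^ (5 + B + Suc d + E)" by (simp add: power_add)
      also have "\<dots> \<le> W ^ F" unfolding F_def E1_def by (intro pinc) auto
      finally show ?thesis .
    qed
    have "real Q' = real (q' * Suc j) * real Q" unfolding Q'_def by simp
    also have "\<dots> \<le> real (q' * Suc j) * W ^ E" using Q by (intro mult_left_mono) auto
    finally have "real Q' \<le> W ^ F" using q'j by linarith
    moreover have "1 \<le> Q'" unfolding Q'_def using q' Q by simp
    moreover have "q dvd Q'" unfolding Q'_def using Q(3) by simp
    moreover have "near (real Q' * \<alpha> i) (W ^ F / real N ^ i)" if i: "i \<in> {Suc d - Suc r<..Suc d}" for i
    proof (cases "i = Suc j")
      case True
      have "136 * (W ^ B)\<^sup>2 * W ^ E1 \<le> W ^ 9 * (W ^ B)\<^sup>2 * W ^ E1"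
        using W by (intro mult_right_mono pow2_le_pow[OF W]) auto
      also have "\<dots> = W ^ (9 + 2 * B + E1)" by (simp add: power_add mult.commute flip: power_mult)
      also have "\<dots> \<le> W ^ F" unfolding F_def by (intro pinc) auto
      finally have "136 * (W ^ B)\<^sup>2 * W ^ E1 / real N ^ i \<le> W ^ F / real N ^ i" by (intro divide_right_mono) auto
      moreover have "136 * (W ^ B)\<^sup>2 * \<epsilon> / real N = 136 * (W ^ B)\<^sup>2 * W ^ E1 / real N ^ i"
        unfolding \<epsilon>_def True by simp
      moreover have "real q' * \<beta> = real Q' * \<alpha> i" unfolding True \<beta>_def Q'_def by (simp add: algebra_simps)
      ultimately show ?thesis using q'(3) near_mono by metis
    next
      case False
      then have "i \<in> {Suc d - r<..Suc d}" using i j by auto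
      from near_mult_nat[OF Q(4)[OF this], of "q' * Suc j"]
      have "near (real Q' * \<alpha> i) (real (q' * Suc j) * W ^ E / real N ^ i)"
        unfolding Q'_def by (simp add: mult_ac)
      then show ?thesis using q'j by (elim near_mono) (intro divide_right_mono, auto)
    qed
    ultimately show "\<exists>Q. 1 \<le> Q \<and> real Q \<le> W ^ F \<and> q dvd Q \<and>
        (\<forall>i\<in>{Suc d - Suc r<..Suc d}. near (real Q * \<alpha> i) (W ^ F / real N ^ i))" by blast
  qed
qed

lemma shift_average:
  fixes z :: "nat \<Rightarrow> complex"
  assumes z: "\<And>n. norm (z n) \<le> 1"
  shows "norm ((\<Sum>n\<in>{1..N}. z n) - (\<Sum>n\<in>{1..N}. z (n + l))) \<le> 2 * real l"
proof -
  have "(\<Sum>n\<in>{1..N}. z (n + l)) + (\<Sum>n\<in>{1..l}. z n) = (\<Sum>n\<in>{1..N + l}. z n)"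
  proof -
    have "(\<Sum>n\<in>{1..N}. z (n + l)) = (\<Sum>n\<in>{1 + l..N + l}. z n)"
      by (rule sum.shift_bounds_cl_nat_ivl[symmetric])
    moreover have "{1..N + l} = {1 + l..N + l} \<union> {1..l}" by auto
    ultimately show ?thesis by (simp only:) (subst sum.union_disjoint, auto)
  qed
  moreover have "(\<Sum>n\<in>{1..N}. z n) + (\<Sum>n\<in>{1 + N..l + N}. z n) = (\<Sum>n\<in>{1..N + l}. z n)"
  proof -
    have "{1..N + l} = {1..N} \<union> {1 + N..l + N}" by auto
    then show ?thesis by (simp only:) (subst sum.union_disjoint, auto)
  qed
  ultimately have "(\<Sum>n\<in>{1..N}. z n) - (\<Sum>n\<in>{1..N}. z (n + l)) = (\<Sum>n\<in>{1..l}. z n) - (\<Sum>n\<in>{1 + N..l + N}. z n)"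
    by (simp add: algebra_simps)
  also have "norm \<dots> \<le> norm (\<Sum>n\<in>{1..l}. z n) + norm (\<Sum>n\<in>{1 + N..l + N}. z n)"
    by (rule norm_triangle_ineq4)
  also have "norm (\<Sum>n\<in>{1..l}. z n) \<le> real l"
    using norm_sum[of z "{1..l}"] sum_bounded_above[of "{1..l}" "\<lambda>n. norm (z n)" 1] z by simp
  also have "norm (\<Sum>n\<in>{1 + N..l + N}. z n) \<le> real l"
    using norm_sum[of z "{1 + N..l + N}"] sum_bounded_above[of "{1 + N..l + N}" "\<lambda>n. norm (z n)" 1] z by simp
  finally show ?thesis by simp
qed

text \<open>The quotient D is a natural number: the approximation to Q alpha_i is later multiplied
  by m D, and only integral factors preserve nearness to integers.\<close>

lemma power_diff_bound:
  fixes n l N i :: nat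
  assumes "n \<le> N" "l \<le> N" "1 \<le> i"
  shows "\<exists>D::nat. (n + l) ^ i = n ^ i + l * D \<and> real D \<le> real i * 2 ^ i * real N ^ (i - 1)"
proof -
  define D where "D = (\<Sum>p<i. (n + l) ^ p * n ^ (i - Suc p))"
  have "int ((n + l) ^ i) - int (n ^ i) = int (l * D)"
    using diff_power_eq_sum[of "int (n + l)" "i - 1" "int n"] assms(3)
    unfolding D_def by (simp add: power_Suc[symmetric])
  then have eq: "(n + l) ^ i = n ^ i + l * D" by linarith
  have "D \<le> (\<Sum>p<i. 2 ^ i * N ^ (i - 1))"
    unfolding D_def
  proof (rule sum_mono)
    fix p assume p: "p \<in> {..<i}"
    have "(n + l) ^ p * n ^ (i - Suc p) \<le> (2 * N) ^ p * N ^ (i - Suc p)"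
      using assms by (intro mult_mono power_mono) auto
    also have "\<dots> = 2 ^ p * N ^ (i - 1)" using p by (simp add: power_mult_distrib flip: power_add)
    also have "\<dots> \<le> 2 ^ i * N ^ (i - 1)" using p by (intro mult_right_mono power_increasing) auto
    finally show "(n + l) ^ p * n ^ (i - Suc p) \<le> 2 ^ i * N ^ (i - 1)" .
  qed
  then have "D \<le> i * 2 ^ i * N ^ (i - 1)" by simp
  then have "real D \<le> real (i * 2 ^ i * N ^ (i - 1))" by (rule of_nat_mono)
  then show ?thesis using eq by (intro exI[of _ D]) auto
qed

text \<open>
  On progressions of difference \<open>Q\<close> the terms of degree at least 2 are nearly constant, so after
  averaging over such shifts a large sum becomes a large geometric sum in \<open>Q \<alpha>\<^sub>1\<close>.
\<close>

lemma near_linear_coefficient: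
  fixes \<alpha> :: "nat \<Rightarrow> real" and N Q d E :: nat and W :: real
  assumes W: "W \<ge> 2" and Q: "1 \<le> Q" "real Q \<le> W ^ E"
    and near: "\<And>i. i \<in> {2..d} \<Longrightarrow> near (real Q * \<alpha> i) (W ^ E / real N ^ i)"
    and N: "real N \<ge> W ^ (E + 3 * d + 8)" and d: "d \<ge> 1"
    and large: "norm (\<Sum>n\<in>{1..N}. ee (\<Sum>j\<le>d. \<alpha> j * real n ^ j)) \<ge> N / W"
  shows "near (real Q * \<alpha> 1) (W ^ (E + 3 * d + 11) / N)"
proof -
  define F where "F = E + 3 * d + 8"
  \<comment> \<open>The averaging length: short enough for shifts by Q M to change the sum by at
    most half of the assumed lower bound and for the higher terms to stay nearly constant, and long
    enough to locate Q alpha_1 to within a power of W over N.\<close>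
  define M where "M = nat \<lfloor>real N / W ^ F\<rfloor>"
  define g where "g n = (\<Sum>j\<le>d. \<alpha> j * real n ^ j)" for n :: nat
  have W1: "W \<ge> 1" using W by simp
  have pinc: "W ^ a \<le> W ^ b" if "a \<le> b" for a b using that W1 by (rule power_increasing)
  have N1: "real N \<ge> 1" using N one_le_power[OF W1, of "E + 3 * d + 8"] by linarith
  have WF: "W ^ F > 0" using W by simp
  have "real N / W ^ F \<ge> 1" using N WF unfolding F_def by simp
  then have M: "real M \<le> real N / W ^ F" "real M \<ge> real N / (2 * W ^ F)" "M \<ge> 1"
  proof -
    have "y \<le> 2 * real_of_int \<lfloor>y\<rfloor>" if "y \<ge> 1" for y :: real
    proof -
      have "real_of_int \<lfloor>y\<rfloor> \<ge> 1" using that by simp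
      then show ?thesis by linarith
    qed
    from this[OF \<open>real N / W ^ F \<ge> 1\<close>] show "real M \<ge> real N / (2 * W ^ F)" using \<open>real N / W ^ F \<ge> 1\<close> unfolding M_def
      by simp
    show "real M \<le> real N / W ^ F" "M \<ge> 1" using \<open>real N / W ^ F \<ge> 1\<close> unfolding M_def
      by (simp_all add: le_nat_iff)
  qed
  have MF: "real M * W ^ F \<le> N" using M(1) WF by (simp add: pos_le_divide_eq)
  have QM: "2 * real Q * real M \<le> N / (2 * W)"
  proof -
    have "4 * W * real Q * real M \<le> W ^ 2 * W * W ^ E * real M"
      using W Q(2) pow2_le_pow[OF W, of 4 2] by (intro mult_right_mono mult_mono) auto
    also have "\<dots> = W ^ (E + 3) * real M" by (simp add: power_add power3_eq_cube power2_eq_square)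
    also have "\<dots> \<le> W ^ F * real M" unfolding F_def by (intro mult_right_mono pinc) auto
    also have "\<dots> \<le> N" using MF by (simp add: mult.commute)
    finally show ?thesis using W by (simp add: field_simps)
  qed
  have QMN: "Q * m \<le> N" if "m \<in> {1..M}" for m
  proof -
    have "real (Q * m) \<le> real Q * real M" using that by (simp add: mult_left_mono)
    also have "\<dots> \<le> N / (2 * W)" using QM mult_nonneg_nonneg[of "real Q" "real M"] by linarith
    also have "\<dots> \<le> N" using W N1 by (simp add: field_simps)
    finally show ?thesis by (simp only: of_nat_le_iff)
  qed
  define S where "S = norm (\<Sum>n\<in>{1..N}. ee (g n))"
  have "real M * S \<le> (\<Sum>n\<in>{1..N}. norm (\<Sum>m\<in>{1..M}. ee (g (n + Q * m)))) + real M * (N / (2 * W))"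
  proof -
    have "real M * S = norm (\<Sum>m\<in>{1..M}. \<Sum>n\<in>{1..N}. ee (g n))"
      unfolding S_def by (simp add: norm_mult)
    also have "\<dots> = norm ((\<Sum>m\<in>{1..M}. \<Sum>n\<in>{1..N}. ee (g (n + Q * m)))
        + (\<Sum>m\<in>{1..M}. (\<Sum>n\<in>{1..N}. ee (g n)) - (\<Sum>n\<in>{1..N}. ee (g (n + Q * m)))))"
      by (simp add: sum_subtractf)
    also have "\<dots> \<le> norm (\<Sum>m\<in>{1..M}. \<Sum>n\<in>{1..N}. ee (g (n + Q * m)))
        + norm (\<Sum>m\<in>{1..M}. (\<Sum>n\<in>{1..N}. ee (g n)) - (\<Sum>n\<in>{1..N}. ee (g (n + Q * m))))"
      by (rule norm_triangle_ineq)
    also have "norm (\<Sum>m\<in>{1..M}. (\<Sum>n\<in>{1..N}. ee (g n)) - (\<Sum>n\<in>{1..N}. ee (g (n + Q * m))))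
        \<le> (\<Sum>m\<in>{1..M}. N / (2 * W))"
    proof (rule sum_norm_le)
      fix m assume m: "m \<in> {1..M}"
      have "norm ((\<Sum>n\<in>{1..N}. ee (g n)) - (\<Sum>n\<in>{1..N}. ee (g (n + Q * m)))) \<le> 2 * real (Q * m)"
        by (rule shift_average[of "\<lambda>n. ee (g n)"]) simp
      also have "\<dots> \<le> 2 * real Q * real M" using m by (simp add: mult_left_mono)
      finally show "norm ((\<Sum>n\<in>{1..N}. ee (g n)) - (\<Sum>n\<in>{1..N}. ee (g (n + Q * m)))) \<le> N / (2 * W)"
        using QM by linarith
    qed
    also have "(\<Sum>m\<in>{1..M}. \<Sum>n\<in>{1..N}. ee (g (n + Q * m))) = (\<Sum>n\<in>{1..N}. \<Sum>m\<in>{1..M}. ee (g (n + Q * m)))"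
      by (rule sum.swap)
    also have "norm \<dots> \<le> (\<Sum>n\<in>{1..N}. norm (\<Sum>m\<in>{1..M}. ee (g (n + Q * m))))"
      by (rule norm_sum)
    finally show ?thesis by simp
  qed
  moreover have "real M * S \<ge> real M * (N / W)"
    using large unfolding S_def g_def by (intro mult_left_mono) auto
  ultimately have avg: "(\<Sum>n\<in>{1..N}. norm (\<Sum>m\<in>{1..M}. ee (g (n + Q * m)))) \<ge> real M * (N / (2 * W))"
    by (simp add: field_simps)
  have "\<exists>n\<in>{1..N}. norm (\<Sum>m\<in>{1..M}. ee (g (n + Q * m))) \<ge> real M / (2 * W)"
  proof (rule ccontr)
    assume "\<not> ?thesis"
    then have "(\<Sum>n\<in>{1..N}. norm (\<Sum>m\<in>{1..M}. ee (g (n + Q * m)))) < (\<Sum>n\<in>{1..N}. real M / (2 * W))"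
      using N1 by (intro sum_strict_mono) (auto simp: not_le)
    then show False using avg by (simp add: mult.commute)
  qed
  then obtain n where n: "n \<in> {1..N}" "norm (\<Sum>m\<in>{1..M}. ee (g (n + Q * m))) \<ge> real M / (2 * W)" by blast
  define \<tau> where "\<tau> = W ^ (E + 3 * d) * real M / N"
  have near\<tau>: "near (g (n + Q * m) - (g n + real m * (real Q * \<alpha> 1))) \<tau>" if m: "m \<in> {1..M}" for m
  proof -
    have n': "n \<le> N" using n(1) by simp
    have "\<forall>i\<in>{1..d}. \<exists>D::nat. (n + Q * m) ^ i = n ^ i + Q * m * D \<and> real D \<le> real i * 2 ^ i * real N ^ (i - 1)"
      using power_diff_bound[OF n' QMN[OF m]] by (metis atLeastAtMost_iff)
    then obtain D :: "nat \<Rightarrow> nat" where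
      D: "\<And>i. i \<in> {1..d} \<Longrightarrow> (n + Q * m) ^ i = n ^ i + Q * m * D i"
         "\<And>i. i \<in> {1..d} \<Longrightarrow> real (D i) \<le> real i * 2 ^ i * real N ^ (i - 1)"
      by metis
    \<comment> \<open>The linear term is exactly m Q alpha_1 and is kept apart; the terms of degree
      at least 2 go into the error tau.\<close>
    have D1: "D 1 = 1" using D(1)[of 1] d Q(1) m by simp
    have set: "{..d} = insert 0 {1..d}" "{1..d} = insert 1 {2..d}" using d by auto
    have "g (n + Q * m) - g n = (\<Sum>i\<in>{1..d}. \<alpha> i * (real (n + Q * m) ^ i - real n ^ i))"
      unfolding g_def set(1) by (subst sum.insert, simp, simp)+ (simp add: right_diff_distrib sum_subtractf)
    also have "\<dots> = (\<Sum>i\<in>{1..d}. real (m * D i) * (real Q * \<alpha> i))"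
    proof (rule sum.cong[OF refl])
      fix i assume i: "i \<in> {1..d}"
      have "real (n + Q * m) ^ i = real ((n + Q * m) ^ i)" by simp
      also have "\<dots> = real n ^ i + real Q * real m * real (D i)" unfolding D(1)[OF i] by simp
      finally show "\<alpha> i * (real (n + Q * m) ^ i - real n ^ i) = real (m * D i) * (real Q * \<alpha> i)" by simp
    qed
    also have "\<dots> = real m * (real Q * \<alpha> 1) + (\<Sum>i\<in>{2..d}. real (m * D i) * (real Q * \<alpha> i))"
      unfolding set(2) by (subst sum.insert) (use D1 in auto)
    finally have eq: "g (n + Q * m) - (g n + real m * (real Q * \<alpha> 1)) = (\<Sum>i\<in>{2..d}. real (m * D i) * (real Q * \<alpha> i))"
      by simp
    have "near (\<Sum>i\<in>{2..d}. real (m * D i) * (real Q * \<alpha> i)) (\<Sum>i\<in>{2..d}. real (m * D i) * (W ^ E / real N ^ i))"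
      by (intro near_sum near_mult_nat near)
    moreover have "(\<Sum>i\<in>{2..d}. real (m * D i) * (W ^ E / real N ^ i)) \<le> (\<Sum>i\<in>{2..d}. W ^ (E + 2 * d) * real M / N)"
    proof (rule sum_mono)
      fix i assume i: "i \<in> {2..d}"
      have "real i * 2 ^ i \<le> W ^ d * W ^ d"
      proof (intro mult_mono)
        have "real i \<le> 2 ^ i" by (metis less_exp less_imp_le of_nat_le_iff of_nat_numeral of_nat_power)
        also have "(2::real) ^ i \<le> 2 ^ d" using i by (intro power_increasing) auto
        finally show "real i \<le> W ^ d" by (rule pow2_le_pow[OF W])
        have "(2::real) ^ i \<le> 2 ^ d" using i by (intro power_increasing) auto
        then show "2 ^ i \<le> W ^ d" by (rule pow2_le_pow[OF W])
      qed (use W in auto)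
      then have "real i * 2 ^ i * real N ^ (i - 1) \<le> W ^ d * W ^ d * real N ^ (i - 1)"
        by (intro mult_right_mono) auto
      then have "real (D i) \<le> W ^ (2 * d) * real N ^ (i - 1)"
        using D(2)[of i] i by (simp add: mult_2 power_add)
      then have "real (m * D i) \<le> real M * (W ^ (2 * d) * real N ^ (i - 1))"
        using m unfolding of_nat_mult by (intro mult_mono) auto
      then have "real (m * D i) * (W ^ E / real N ^ i) \<le> real M * (W ^ (2 * d) * real N ^ (i - 1)) * (W ^ E / real N ^ i)"
        using W by (intro mult_right_mono) auto
      also have "\<dots> = W ^ (E + 2 * d) * real M / N"
      proof -
        have "real N ^ i = real N ^ (i - 1) * real N" using i by (simp flip: power_Suc2)
        then show ?thesis using N1 by (simp add: power_add)
      qed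
      finally show "real (m * D i) * (W ^ E / real N ^ i) \<le> W ^ (E + 2 * d) * real M / N" .
    qed
    moreover have "(\<Sum>i\<in>{2..d}. W ^ (E + 2 * d) * real M / N) \<le> \<tau>"
    proof -
      have "real (card {2..d}) \<le> 2 ^ d"
        using less_exp[of d] by (metis card_atLeastAtMost diff_Suc_Suc diff_le_self less_imp_le numeral_2_eq_2 of_nat_le_iff of_nat_numeral of_nat_power order_trans)
      then have "real (card {2..d}) \<le> W ^ d" by (rule pow2_le_pow[OF W])
      then have "real (card {2..d}) * (W ^ (E + 2 * d) * real M / N) \<le> W ^ d * (W ^ (E + 2 * d) * real M / N)"
        using W by (intro mult_right_mono) auto
      also have "\<dots> = \<tau>"
      proof -
        have "E + 3 * d = d + (E + 2 * d)" by simp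
        then have "W ^ (E + 3 * d) = W ^ d * W ^ (E + 2 * d)" by (metis power_add)
        then show ?thesis unfolding \<tau>_def by simp
      qed
      finally show ?thesis by simp
    qed
    ultimately show ?thesis unfolding eq by (meson near_mono order_trans)
  qed
  have \<tau>0: "32 * W * \<tau> \<le> 1"
  proof -
    have "32 * W * (W ^ (E + 3 * d) * real M) \<le> W ^ 5 * W * (W ^ (E + 3 * d) * real M)"
      using W by (intro mult_right_mono pow2_le_pow[OF W]) auto
    also have "\<dots> = W ^ (E + 3 * d + 6) * real M" by (simp add: power_add power_numeral_reduce)
    also have "\<dots> \<le> W ^ F * real M" unfolding F_def by (intro mult_right_mono pinc) auto
    also have "\<dots> \<le> N" using MF by (simp add: mult.commute)
    finally show ?thesis unfolding \<tau>_def using N1 by (simp add: field_simps)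
  qed
  have "norm ((\<Sum>m\<in>{1..M}. ee (g (n + Q * m))) - ee (g n) * (\<Sum>m\<in>{1..M}. ee (real m * (real Q * \<alpha> 1)))) \<le> real M * (8 * \<tau>)"
  proof -
    have "(\<Sum>m\<in>{1..M}. ee (g (n + Q * m))) - ee (g n) * (\<Sum>m\<in>{1..M}. ee (real m * (real Q * \<alpha> 1)))
      = (\<Sum>m\<in>{1..M}. ee (g (n + Q * m)) - ee (g n + real m * (real Q * \<alpha> 1)))"
      by (simp add: sum_subtractf sum_distrib_left ee_add)
    also have "norm \<dots> \<le> (\<Sum>m\<in>{1..M}. 8 * \<tau>)"
      by (intro sum_norm_le norm_ee_diff_le_near near\<tau>)
    finally show ?thesis by simp
  qed
  also have "\<dots> \<le> real M / (4 * W)"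
  proof -
    have "real M * (32 * W * \<tau>) \<le> real M * 1" using \<tau>0 by (intro mult_left_mono) auto
    then show ?thesis using W by (simp add: field_simps)
  qed
  finally have "norm (\<Sum>m\<in>{1..M}. ee (g (n + Q * m))) - norm (ee (g n) * (\<Sum>m\<in>{1..M}. ee (real m * (real Q * \<alpha> 1)))) \<le> real M / (4 * W)"
    using norm_triangle_ineq2 order_trans by blast
  moreover have "real M / (2 * W) = 2 * (real M / (4 * W))" by simp
  ultimately have "norm (\<Sum>m\<in>{1..M}. ee (real m * (real Q * \<alpha> 1))) \<ge> real M / (4 * W)"
    using n(2) by (simp add: norm_mult)
  from near_if_geometric_ee_large[OF _ this]
  have "near (real Q * \<alpha> 1) (1 / (2 * (real M / (4 * W))))" using M(3) W by simp
  moreover have "1 / (2 * (real M / (4 * W))) \<le> W ^ (E + 3 * d + 11) / N"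
  proof -
    have "2 * W * N \<le> W * W * N" using W N1 by (intro mult_right_mono) auto
    also have "N \<le> real M * (2 * W ^ F)" using M(2) WF by (simp add: field_simps)
    also have "W * W * (real M * (2 * W ^ F)) \<le> W * W * (real M * (W * W ^ F))"
      using W by (intro mult_left_mono mult_right_mono) auto
    also have "\<dots> = W ^ (E + 3 * d + 11) * M" unfolding F_def by (simp add: power_add power_numeral_reduce)
    finally show ?thesis using W N1 M(3) by (simp add: field_simps)
  qed
  ultimately show ?thesis by (rule near_mono)
qed

text \<open>Weyl's inequality in inverse form, by induction on the degree. Differencing yields many
  h for which a sum of degree one less is large; a pigeonhole makes the denominators from the
  induction hypothesis agree, \<open>weyl_descent\<close> recovers the coefficients of index at
  least 2, and \<open>near_linear_coefficient\<close> the remaining one.\<close>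

theorem weyl_large_sum:
  "\<exists>C. \<forall>(\<alpha>::nat \<Rightarrow> real) N (W::real). W \<ge> 2 \<longrightarrow> N \<ge> 1 \<longrightarrow>
    norm (\<Sum>n\<in>{1..N}. ee (\<Sum>j\<le>d. \<alpha> j * real n ^ j)) \<ge> N / W \<longrightarrow>
    (\<exists>q. 1 \<le> q \<and> real q \<le> W ^ C \<and> (\<forall>j\<in>{1..d}. near (real q * \<alpha> j) (W ^ C / real N ^ j)))"
proof (induction d)
  case 0
  show ?case by (rule exI[of _ 0]) (auto intro: exI[of _ 1])
next
  case (Suc d)
  then obtain C where IH: "\<And>(\<alpha>::nat \<Rightarrow> real) N (W::real). W \<ge> 2 \<Longrightarrow> N \<ge> 1 \<Longrightarrow>
    norm (\<Sum>n\<in>{1..N}. ee (\<Sum>j\<le>d. \<alpha> j * real n ^ j)) \<ge> N / W \<Longrightarrow>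
    (\<exists>q. 1 \<le> q \<and> real q \<le> W ^ C \<and> (\<forall>j\<in>{1..d}. near (real q * \<alpha> j) (W ^ C / real N ^ j)))"
    by blast
  define B where "B = 4 * C + 4 * d + 4"
  obtain E where E: "\<And>(\<alpha>::nat \<Rightarrow> real) N (W::real) q H. W \<ge> 2 \<Longrightarrow> real N \<ge> W ^ E \<Longrightarrow> 1 \<le> q \<Longrightarrow> real q \<le> W ^ B \<Longrightarrow>
    H \<subseteq> {..<N} \<Longrightarrow> real (card H) \<ge> N / W ^ B \<Longrightarrow>
    (\<forall>h\<in>H. \<forall>j\<in>{1..d}. near (real q * diff_coeff (Suc d) \<alpha> h j) (W ^ B / real N ^ j)) \<Longrightarrow>
    (\<exists>Q. 1 \<le> Q \<and> real Q \<le> W ^ E \<and> q dvd Q \<and> (\<forall>i\<in>{Suc d - d<..Suc d}. near (real Q * \<alpha> i) (W ^ E / real N ^ i)))"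
    using weyl_descent[of d d B] by blast
  define G where "G = E + 3 * Suc d + 11"
  define K where "K = G * Suc d"
  show ?case
  proof (rule exI[of _ K], intro allI impI)
    fix \<alpha> :: "nat \<Rightarrow> real" and N :: nat and W :: real
    assume W: "W \<ge> 2" and N: "N \<ge> 1"
      and large: "norm (\<Sum>n\<in>{1..N}. ee (\<Sum>j\<le>Suc d. \<alpha> j * real n ^ j)) \<ge> N / W"
    have W1: "W \<ge> 1" using W by simp
    have pinc: "W ^ a \<le> W ^ b" if "a \<le> b" for a b using that W1 by (rule power_increasing)
    have GK: "G \<le> K" unfolding K_def by simp
    show "\<exists>q. 1 \<le> q \<and> real q \<le> W ^ K \<and> (\<forall>j\<in>{1..Suc d}. near (real q * \<alpha> j) (W ^ K / real N ^ j))"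
    \<comment> \<open>If N is at most a fixed power of W, the allowed error exceeds 1/2 and the
      denominator 1 is good enough.\<close>
    proof (cases "real N \<le> W ^ G")
      case True
      have "near (real 1 * \<alpha> j) (W ^ K / real N ^ j)" if j: "j \<in> {1..Suc d}" for j
      proof -
        have "real N ^ j \<le> (W ^ G) ^ j" using True by (intro power_mono) auto
        also have "\<dots> \<le> (W ^ G) ^ Suc d" using j one_le_power[OF W1, of G] by (intro power_increasing) auto
        also have "\<dots> = W ^ K" unfolding K_def by (simp only: power_mult)
        finally have "1 \<le> W ^ K / real N ^ j" using N by simp
        then have "1/2 \<le> W ^ K / real N ^ j" by linarith
        then show ?thesis using near_mono[OF near_half[of "\<alpha> j"]] by simp
      qed
      then show ?thesis using one_le_power[OF W1, of K] by (intro exI[of _ 1]) auto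
    next
      case False
      then have NG: "real N \<ge> W ^ G" by simp
      define z where "z n = ee (\<Sum>j\<le>Suc d. \<alpha> j * real n ^ j)" for n
      define S where "S h = norm (\<Sum>n\<in>{1..N - h}. ee (\<Sum>j\<le>d. diff_coeff (Suc d) \<alpha> h j * real n ^ j))" for h
      have zS: "norm (\<Sum>n\<in>{1..N - h}. z (n + h) * cnj (z n)) = S h" for h
        unfolding z_def S_def ee_diff[symmetric] diff_coeff_eq ..
      \<comment> \<open>With this choice the h outside H account for at most half of the lower bound
        (N / W)^2, so those in H, each contributing at most N, number at least N / W'.\<close>
      define W' where "W' = 4 * W\<^sup>2"
      have W': "W' \<ge> 2" "W' \<le> W ^ 4"
      proof -
        have "2 * 2 \<le> W * W" using W by (intro mult_mono) auto
        then show "W' \<ge> 2" "W' \<le> W ^ 4" unfolding W'_def using mult_right_mono[of 4 "W * W" "W * W"]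
          by (auto simp: power2_eq_square power4_eq_xxxx mult.assoc)
      qed
      define H where "H = {h \<in> {..<N}. S h \<ge> N / W'}"
      have SN: "S h \<le> real (N - h)" for h
        unfolding S_def
        using norm_sum[of "\<lambda>n. ee (\<Sum>j\<le>d. diff_coeff (Suc d) \<alpha> h j * real n ^ j)" "{1..N - h}"] by simp
      have cardH: "real (card H) \<ge> N / W'"
      proof -
        have "(N / W)\<^sup>2 \<le> norm (\<Sum>n\<in>{1..N}. z n) ^ 2"
          using large W unfolding z_def by (intro power_mono) auto
        also have "\<dots> \<le> 2 * (\<Sum>h<N. S h)" using van_der_corput[of z N] unfolding zS .
        finally have 1: "(N / W)\<^sup>2 \<le> 2 * (\<Sum>h<N. S h)" .
        have "(\<Sum>h<N. S h) = (\<Sum>h\<in>H. S h) + (\<Sum>h\<in>{..<N} - H. S h)"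
          by (subst add.commute, rule sum.subset_diff) (auto simp: H_def)
        also have "(\<Sum>h\<in>H. S h) \<le> (\<Sum>h\<in>H. real N)"
          by (intro sum_mono order_trans[OF SN]) simp
        also have "(\<Sum>h\<in>{..<N} - H. S h) \<le> (\<Sum>h\<in>{..<N} - H. N / W')"
          by (intro sum_mono) (auto simp: H_def)
        also have "(\<Sum>h\<in>{..<N} - H. N / W') \<le> (\<Sum>h\<in>{..<N}. N / W')"
          using W' by (intro sum_mono2) auto
        finally have 2: "(\<Sum>h<N. S h) \<le> card H * real N + real N * (N / W')" by simp
        have "(N / W)\<^sup>2 = 4 * (real N * (N / W'))" unfolding W'_def using W by (simp add: power2_eq_square)
        with 1 2 have "real N * (N / W') \<le> real N * card H" by (simp add: mult.commute)
        then show ?thesis by (rule mult_left_le_imp_le) (use N in auto)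
      qed
      have "\<forall>h\<in>H. \<exists>q. 1 \<le> q \<and> real q \<le> W ^ (4 * C) \<and>
          (\<forall>j\<in>{1..d}. near (real q * diff_coeff (Suc d) \<alpha> h j) (W ^ B / real N ^ j))"
      proof
        fix h assume h: "h \<in> H"
        then have h': "h < N" "S h \<ge> N / W'" unfolding H_def by auto
        have "S h \<ge> real (N - h) / W'" using h'(2) W' by (elim order_trans[rotated]) (auto intro: divide_right_mono)
        moreover have "1 \<le> N - h" using h'(1) by simp
        ultimately obtain q where q: "1 \<le> q" "real q \<le> W' ^ C"
          "\<And>j. j \<in> {1..d} \<Longrightarrow> near (real q * diff_coeff (Suc d) \<alpha> h j) (W' ^ C / real (N - h) ^ j)"
          using IH[OF W'(1), of "N - h" "diff_coeff (Suc d) \<alpha> h"] unfolding S_def by blast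
        have "W' ^ C \<le> (W ^ 4) ^ C" using W' by (intro power_mono) auto
        then have 1: "real q \<le> W ^ (4 * C)" using q(2) by (simp add: power_mult)
        have 2: "near (real q * diff_coeff (Suc d) \<alpha> h j) (W ^ B / real N ^ j)" if j: "j \<in> {1..d}" for j
        proof -
          \<comment> \<open>A sum of N - h terms can reach N / W' only if N - h is that large, so
            precision relative to N - h passes to N at the cost of a power of W.\<close>
          have "real N \<le> W' * real (N - h)"
            using h'(2) SN[of h] W' by (simp add: pos_divide_le_eq mult.commute)
              (smt (verit, best) mult_left_mono)
          then have "real N ^ j \<le> (W' * real (N - h)) ^ j" by (intro power_mono) auto
          also have "\<dots> = W' ^ j * real (N - h) ^ j" by (rule power_mult_distrib)
          also have "\<dots> \<le> (W ^ 4) ^ d * real (N - h) ^ j"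
          proof (intro mult_right_mono)
            have "W' ^ j \<le> (W ^ 4) ^ j" using W' by (intro power_mono) auto
            also have "\<dots> \<le> (W ^ 4) ^ d" using j one_le_power[OF W1, of 4] by (intro power_increasing) auto
            finally show "W' ^ j \<le> (W ^ 4) ^ d" .
          qed auto
          finally have a: "real N ^ j \<le> (W ^ 4) ^ d * real (N - h) ^ j" .
          have "W' ^ C * real N ^ j \<le> (W ^ 4) ^ C * ((W ^ 4) ^ d * real (N - h) ^ j)"
            using a \<open>W' ^ C \<le> (W ^ 4) ^ C\<close> W by (intro mult_mono) auto
          also have "\<dots> = W ^ (4 * C + 4 * d) * real (N - h) ^ j" by (simp add: power_add power_mult)
          also have "\<dots> \<le> W ^ B * real (N - h) ^ j" unfolding B_def by (intro mult_right_mono pinc) auto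
          finally have "W' ^ C / real (N - h) ^ j \<le> W ^ B / real N ^ j"
            using h'(1) N by (simp add: divide_le_eq pos_le_divide_eq mult.commute)
          with q(3)[OF j] show ?thesis by (rule near_mono)
        qed
        show "\<exists>q. 1 \<le> q \<and> real q \<le> W ^ (4 * C) \<and>
          (\<forall>j\<in>{1..d}. near (real q * diff_coeff (Suc d) \<alpha> h j) (W ^ B / real N ^ j))"
          using q(1) 1 2 by blast
      qed
      then obtain q where q: "\<And>h. h \<in> H \<Longrightarrow> 1 \<le> q h" "\<And>h. h \<in> H \<Longrightarrow> real (q h) \<le> W ^ (4 * C)"
          "\<And>h j. h \<in> H \<Longrightarrow> j \<in> {1..d} \<Longrightarrow> near (real (q h) * diff_coeff (Suc d) \<alpha> h j) (W ^ B / real N ^ j)"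
        by metis
      have finH: "finite H" unfolding H_def by simp
      have "real (card H) > 0" using cardH N W' by (elim less_le_trans[rotated]) simp
      then have Hne: "H \<noteq> {}" by auto
      \<comment> \<open>Pigeonhole: at most W^(4 C) denominators occur, so one of them is shared by
        at least N / W^B of the h.\<close>
      have "\<exists>r\<in>q ` H. real (card {h \<in> H. q h = r}) \<ge> N / W ^ B"
      proof (rule ccontr)
        assume "\<not> ?thesis"
        then have lt: "\<And>r. r \<in> q ` H \<Longrightarrow> real (card {h \<in> H. q h = r}) < N / W ^ B" by force
        have "real (card H) = (\<Sum>r\<in>q ` H. real (card {h \<in> H. q h = r}))"
          using card_eq_sum sum.image_gen[OF finH, of "\<lambda>_. 1::nat" q] by (simp flip: of_nat_sum)
        also have "\<dots> < (\<Sum>r\<in>q ` H. N / W ^ B)" using finH Hne lt by (intro sum_strict_mono) auto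
        also have "\<dots> = real (card (q ` H)) * (N / W ^ B)" by simp
        also have "\<dots> \<le> W ^ (4 * C) * (N / W ^ B)"
        proof (intro mult_right_mono)
          have "q ` H \<subseteq> {1..nat \<lfloor>W ^ (4 * C)\<rfloor>}" using q(1,2) by (auto simp: le_nat_floor)
          then have "card (q ` H) \<le> card {1..nat \<lfloor>W ^ (4 * C)\<rfloor>}" by (intro card_mono) auto
          then show "real (card (q ` H)) \<le> W ^ (4 * C)" using W by (simp add: le_nat_floor) (smt (verit) of_nat_floor of_nat_mono zero_le_power)
        qed (use W in auto)
        also have "\<dots> \<le> N / W'"
        proof -
          have "W ^ (4 * C) * W' \<le> W ^ (4 * C) * W ^ 4" using W W' by (intro mult_left_mono) auto
          also have "\<dots> = W ^ (4 * C + 4)" by (simp add: power_add)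
          also have "\<dots> \<le> W ^ B" unfolding B_def by (intro pinc) auto
          finally have "W ^ (4 * C) * W' * N \<le> W ^ B * N" by (intro mult_right_mono) auto
          then show ?thesis using W W' by (simp add: pos_le_divide_eq pos_divide_le_eq mult_ac)
        qed
        finally show False using cardH by linarith
      qed
      then obtain h0 where h0: "h0 \<in> H" "real (card {h \<in> H. q h = q h0}) \<ge> N / W ^ B" by blast
      have "W ^ (4 * C) \<le> W ^ B" unfolding B_def by (intro pinc) auto
      then have qB: "real (q h0) \<le> W ^ B" using q(2)[OF h0(1)] by linarith
      have NE: "real N \<ge> W ^ E" using NG pinc[of E G] unfolding G_def by linarith
      have "\<exists>Q. 1 \<le> Q \<and> real Q \<le> W ^ E \<and> q h0 dvd Q \<and> (\<forall>i\<in>{Suc d - d<..Suc d}. near (real Q * \<alpha> i) (W ^ E / real N ^ i))"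
      proof (rule E[OF W NE q(1)[OF h0(1)] qB, of "{h \<in> H. q h = q h0}"])
        show "\<forall>h\<in>{h \<in> H. q h = q h0}. \<forall>j\<in>{1..d}. near (real (q h0) * diff_coeff (Suc d) \<alpha> h j) (W ^ B / real N ^ j)"
          using q(3) by (metis (mono_tags, lifting) mem_Collect_eq)
      qed (use h0 in \<open>auto simp: H_def\<close>)
      then obtain Q where Q: "1 \<le> Q" "real Q \<le> W ^ E"
        "\<And>i. i \<in> {2..Suc d} \<Longrightarrow> near (real Q * \<alpha> i) (W ^ E / real N ^ i)" by fastforce
      have "near (real Q * \<alpha> 1) (W ^ G / N)"
        unfolding G_def using NG pinc[of "E + 3 * Suc d + 8" G] large
        by (intro near_linear_coefficient[OF W Q]) (auto simp: G_def)
      moreover have "W ^ G / N \<le> W ^ K / N" using GK by (intro divide_right_mono pinc) auto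
      ultimately have n1: "near (real Q * \<alpha> 1) (W ^ K / N)" by (rule near_mono)
      have "near (real Q * \<alpha> j) (W ^ K / real N ^ j)" if j: "j \<in> {1..Suc d}" for j
      proof (cases "j = 1")
        case True
        then show ?thesis using n1 by simp
      next
        case False
        then have "near (real Q * \<alpha> j) (W ^ E / real N ^ j)" using Q(3) j by auto
        moreover have "W ^ E / real N ^ j \<le> W ^ K / real N ^ j"
          using GK by (intro divide_right_mono pinc) (auto simp: G_def)
        ultimately show ?thesis by (rule near_mono)
      qed
      moreover have "real Q \<le> W ^ K" using Q(2) pinc[of E K] GK unfolding G_def by linarith
      ultimately show ?thesis using Q(1) by blast
    qed
  qed
qed

section \<open>The divisor bound\<close>

definition divisor_count :: "nat \<Rightarrow> nat" where
  "divisor_count n = card {d. d dvd n}"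

lemma divisor_count_mult_le:
  assumes "a > 0" "b > 0"
  shows "divisor_count (a * b) \<le> divisor_count a * divisor_count b"
proof -
  have "{d. d dvd a * b} \<subseteq> (\<lambda>(x, y). x * y) ` ({x. x dvd a} \<times> {y. y dvd b})"
    using division_decomp by force
  then have "divisor_count (a * b) \<le> card ((\<lambda>(x, y). x * y) ` ({x. x dvd a} \<times> {y. y dvd b}))"
    unfolding divisor_count_def using assms by (intro card_mono) auto
  also have "\<dots> \<le> card ({x. x dvd a} \<times> {y. y dvd b})"
    using assms by (intro card_image_le) auto
  finally show ?thesis by (simp add: divisor_count_def card_cartesian_product)
qed

lemma divisor_count_prime_power:
  assumes "prime (p::nat)"
  shows "divisor_count (p ^ e) \<le> e + 1"
proof -
  have "{d. d dvd p ^ e} \<subseteq> (\<lambda>i. p ^ i) ` {..e}"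
    using divides_primepow_nat[OF assms] by auto
  then have "divisor_count (p ^ e) \<le> card ((\<lambda>i. p ^ i) ` {..e})"
    unfolding divisor_count_def by (intro card_mono) auto
  also have "\<dots> \<le> e + 1" using card_image_le[of "{..e}" "\<lambda>i. p ^ i"] by simp
  finally show ?thesis .
qed

lemma divisor_count_prod_prime_powers:
  assumes "finite S" "\<And>p. p \<in> S \<Longrightarrow> prime (p::nat)"
  shows "divisor_count (\<Prod>p\<in>S. p ^ e p) \<le> (\<Prod>p\<in>S. e p + 1)"
  using assms
proof (induction S rule: finite_induct)
  case empty
  then show ?case by (simp add: divisor_count_def)
next
  case (insert p S)
  have "divisor_count (p ^ e p * (\<Prod>p\<in>S. p ^ e p)) \<le> divisor_count (p ^ e p) * divisor_count (\<Prod>p\<in>S. p ^ e p)"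
    using insert.prems by (intro divisor_count_mult_le) (auto intro!: prod_pos simp: prime_gt_0_nat)
  also have "\<dots> \<le> (e p + 1) * (\<Prod>p\<in>S. e p + 1)"
    using insert by (intro mult_mono divisor_count_prime_power) auto
  finally show ?case using insert by simp
qed

lemma Suc_le_two_power: "real e + 1 \<le> 2 ^ e"
  by (metis Suc_leI add.commute less_exp of_nat_Suc of_nat_le_iff of_nat_numeral of_nat_power)

text \<open>For p >= 2^m one has p^(e/m) >= 2^e >= e + 1, so only smaller primes need the factor m;
  for them e + 1 <= m (f + 1) <= m 2^f with f = e div m.\<close>

lemma Suc_le_prime_powr:
  fixes p m e :: nat
  assumes p: "p \<ge> 2" and m: "m \<ge> 1"
  shows "real e + 1 \<le> (if p < 2 ^ m then real m else 1) * real (p ^ e) powr (1 / m)"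
proof -
  have eq: "real (p ^ e) powr (1 / m) = real p powr (real e / m)"
    using p by (simp add: powr_realpow[symmetric] powr_powr)
  show ?thesis
  proof (cases "p < 2 ^ m")
    case True
    define f where "f = e div m"
    have "e + 1 \<le> m * (f + 1)" unfolding f_def using m
      by (metis Suc_eq_plus1 Suc_leI dividend_less_times_div less_le_trans mult_Suc_right zero_less_one add.commute)
    then have "real e + 1 \<le> real m * (real f + 1)" by (metis of_nat_1 of_nat_add of_nat_le_iff of_nat_mult)
    also have "\<dots> \<le> real m * 2 ^ f" by (intro mult_left_mono Suc_le_two_power) auto
    also have "(2::real) ^ f = 2 powr real f" by (simp add: powr_realpow)
    also have "2 powr real f \<le> 2 powr (real e / m)"
    proof (rule powr_mono)
      have "real (f * m) \<le> real e" unfolding f_def by (intro of_nat_mono) simp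
      then show "real f \<le> real e / m" using m by (simp add: field_simps)
    qed simp
    also have "2 powr (real e / m) \<le> real p powr (real e / m)" using p by (intro powr_mono2) auto
    finally show ?thesis using True eq by (simp add: mult_left_mono)
  next
    case False
    have "real e + 1 \<le> 2 ^ e" by (rule Suc_le_two_power)
    also have "\<dots> = (2 ^ m) powr (real e / m)" using m by (simp add: powr_realpow[symmetric] powr_powr)
    also have "\<dots> \<le> real p powr (real e / m)"
    proof (rule powr_mono2)
      have "2 ^ m \<le> p" using False by simp
      then show "(2::real) ^ m \<le> real p" by (metis of_nat_le_iff of_nat_numeral of_nat_power)
    qed auto
    finally show ?thesis using False eq by simp
  qed
qed

text \<open>Fewer than 2^m primes lie below 2^m, and each costs a factor m.\<close>

lemma divisor_bound:
  fixes m :: nat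
  assumes m: "m \<ge> 1" and n: "n \<ge> 1"
  shows "real (divisor_count n) \<le> real m ^ (2 ^ m) * real n powr (1 / m)"
proof -
  define S where "S = prime_factors n"
  define e where "e p = multiplicity p n" for p
  define F where "F p = (if p < 2 ^ m then real m else 1)" for p :: nat
  have S: "finite S" "\<And>p. p \<in> S \<Longrightarrow> prime p" unfolding S_def by auto
  have n_eq: "n = (\<Prod>p\<in>S. p ^ e p)"
    unfolding S_def e_def using n prime_factorization_nat[of n] by auto
  have "real (divisor_count n) \<le> real (\<Prod>p\<in>S. e p + 1)"
    using divisor_count_prod_prime_powers[OF S, of e] n_eq by (metis of_nat_mono)
  also have "\<dots> = (\<Prod>p\<in>S. real (e p) + 1)" by (simp add: add.commute)
  also have "\<dots> \<le> (\<Prod>p\<in>S. F p * real (p ^ e p) powr (1 / m))"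
  proof (rule prod_mono)
    fix p assume "p \<in> S"
    then have "p \<ge> 2" using S(2) prime_ge_2_nat by blast
    from Suc_le_prime_powr[OF this m]
    show "0 \<le> real (e p) + 1 \<and> real (e p) + 1 \<le> F p * real (p ^ e p) powr (1 / m)"
      unfolding F_def by simp
  qed
  also have "\<dots> = (\<Prod>p\<in>S. F p) * (\<Prod>p\<in>S. real (p ^ e p) powr (1 / m))" by (rule prod.distrib)
  also have "(\<Prod>p\<in>S. real (p ^ e p) powr (1 / m)) = (\<Prod>p\<in>S. real (p ^ e p)) powr (1 / m)"
    by (rule prod_powr_distrib[symmetric]) 
  also have "(\<Prod>p\<in>S. real (p ^ e p)) = real n" unfolding n_eq by simp
  also have "(\<Prod>p\<in>S. F p) \<le> real m ^ (2 ^ m)"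
  proof -
    have "(\<Prod>p\<in>S. F p) = (\<Prod>p\<in>S \<inter> {..<2 ^ m}. real m)"
      unfolding F_def by (simp only: prod.inter_restrict[OF S(1)] lessThan_iff)
    also have "\<dots> = real m ^ card (S \<inter> {..<2 ^ m})" by simp
    also have "\<dots> \<le> real m ^ (2 ^ m)"
      using m card_mono[of "{..<2 ^ m}" "S \<inter> {..<2 ^ m}"] by (intro power_increasing) auto
    finally show ?thesis .
  qed
  finally show ?thesis by (simp add: mult_right_mono)
qed

section \<open>Approximate rational relations\<close>

text \<open>Distinct fractions with denominators q^j and q'^j differ by at least (q q')^-j, so the
  two coincide. Divided by the gcd, the equation reads b m'^j = b' m^j with m and m' coprime; hence
  m^j divides b and cancels.\<close>

lemma common_denominator_gcd:
  fixes \<beta> \<delta> \<delta>' :: real and q q' j :: nat and b b' :: int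
  assumes "\<bar>\<beta> - b / real q ^ j\<bar> \<le> \<delta>" "\<bar>\<beta> - b' / real q' ^ j\<bar> \<le> \<delta>'"
    and small: "(\<delta> + \<delta>') * real (q * q') ^ j < 1" and q: "q \<ge> 1" "q' \<ge> 1"
  shows "b / real q ^ j = b' / real q' ^ j" "\<exists>c::int. b / real q ^ j = c / real (gcd q q') ^ j"
proof -
  have q0: "real q ^ j > 0" "real q' ^ j > 0" using q by auto
  have "\<bar>b / real q ^ j - b' / real q' ^ j\<bar> \<le> \<delta> + \<delta>'" using assms(1,2) by linarith
  then have "\<bar>b / real q ^ j - b' / real q' ^ j\<bar> * real (q * q') ^ j \<le> (\<delta> + \<delta>') * real (q * q') ^ j"
    by (intro mult_right_mono) auto
  also have "\<dots> < 1" by fact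
  also have "\<bar>b / real q ^ j - b' / real q' ^ j\<bar> * real (q * q') ^ j
      = \<bar>(b / real q ^ j - b' / real q' ^ j) * real (q * q') ^ j\<bar>" by (simp add: abs_mult)
  also have "(b / real q ^ j - b' / real q' ^ j) * real (q * q') ^ j = of_int (b * int q' ^ j - b' * int q ^ j)"
    using q by (simp add: field_simps power_mult_distrib)
  finally have "\<bar>real_of_int (b * int q' ^ j - b' * int q ^ j)\<bar> < 1" .
  then have "\<bar>b * int q' ^ j - b' * int q ^ j\<bar> < 1" by linarith
  then have eq: "b * int q' ^ j = b' * int q ^ j" by linarith
  then have "of_int b * real q' ^ j = of_int b' * real q ^ j"
    by (metis of_int_mult of_int_of_nat_eq of_int_power)
  then show "b / real q ^ j = b' / real q' ^ j" using q0 by (simp add: field_simps)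
  define g where "g = gcd q q'"
  have g: "g \<ge> 1" using q unfolding g_def by (simp add: Suc_leI)
  obtain m m' where m: "q = g * m" "q' = g * m'" "coprime m m'"
    unfolding g_def using q gcd_coprime_exists[of q q'] by (metis gcd_eq_0_iff mult.commute not_one_le_zero)
  have "b * int m' ^ j = b' * int m ^ j"
    using eq g unfolding m(1,2) by (simp add: power_mult_distrib)
  then have "int m ^ j dvd b * int m' ^ j" by (metis dvd_triv_right)
  moreover have "coprime (int m ^ j) (int m' ^ j)" using m(3) by simp
  ultimately have "int m ^ j dvd b" using coprime_dvd_mult_left_iff by blast
  then obtain c where "b = int m ^ j * c" by blast
  moreover have "real m > 0" using q m by (cases m) auto
  ultimately have "b / real q ^ j = c / real g ^ j"
    unfolding m(1) using g by (simp add: power_mult_distrib field_simps)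
  then show "\<exists>c::int. b / real q ^ j = c / real (gcd q q') ^ j" unfolding g_def by blast
qed

definition smul :: "nat \<Rightarrow> 'g::ab_group_add \<Rightarrow> 'g" where
  "smul c a = ((+) a ^^ c) 0"

lemma smul_0 [simp]: "smul 0 a = 0" and smul_Suc: "smul (Suc c) a = a + smul c a"
  by (simp_all add: smul_def)

lemma smul_add: "smul (m + n) a = smul m a + smul n a"
  by (induction m) (simp_all add: smul_Suc add.assoc)

lemma smul_diff: "n \<le> m \<Longrightarrow> smul m a - smul n a = smul (m - n) a"
  using smul_add[of "m - n" n a] by simp

lemma card_le_fibres:
  assumes "finite A" "finite B" "f ` A \<subseteq> B" "\<And>b. b \<in> B \<Longrightarrow> card {a\<in>A. f a = b} \<le> M"
  shows "card A \<le> card B * M"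
proof -
  have "card A = (\<Sum>b\<in>B. card {a\<in>A. f a = b})"
    using sum.group[OF assms(1,2,3), of "\<lambda>_. 1::nat"] by simp
  also have "\<dots> \<le> (\<Sum>b\<in>B. M)" using assms(4) by (intro sum_mono)
  finally show ?thesis by simp
qed

text \<open>
  In the application \<open>S\<close> consists of the integer vectors \<open>a\<close> of length \<open>k\<close>, \<open>L i a\<close> is a rescaled
  coordinate of \<open>a\<close>, and \<open>\<beta> j a\<close> is the coefficient of index \<open>j\<close> of \<open>a\<^sub>1 f\<^sub>1 + \<dots> + a\<^sub>k f\<^sub>k\<close>.
\<close>

locale diophantine_forms =
  fixes S :: "'g::ab_group_add set" and I :: "'i set" and L :: "'i \<Rightarrow> 'g \<Rightarrow> real"
    and d :: nat and \<beta> :: "nat \<Rightarrow> 'g \<Rightarrow> real" and X :: real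
  assumes finite_I: "finite I" and d_pos: "d \<ge> 1" and X_pos: "X > 0"
    and zero_S: "0 \<in> S" and diff_S: "a \<in> S \<Longrightarrow> b \<in> S \<Longrightarrow> a - b \<in> S"
    and L_diff: "L i (a - b) = L i a - L i b" and \<beta>_diff: "\<beta> j (a - b) = \<beta> j a - \<beta> j b"
    and finite_box': "finite {a\<in>S. \<forall>i\<in>I. \<bar>L i a\<bar> \<le> t}"
begin

definition box :: "real \<Rightarrow> 'g set" where
  "box t = {a\<in>S. \<forall>i\<in>I. \<bar>L i a\<bar> \<le> t}"

text \<open>
  If \<open>a \<in> lam q Z t\<close> then the polynomial with coefficients \<open>\<beta> j a\<close> is integral up to a small
  error at the multiples of \<open>q\<close> that are small compared with \<open>X / Z\<close>.
\<close>

definition lam :: "nat \<Rightarrow> nat \<Rightarrow> real \<Rightarrow> 'g set" where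
  "lam q Z t = {a\<in>box t. \<forall>j\<in>{1..d}. \<exists>b::int. \<bar>\<beta> j a - b / real q ^ j\<bar> \<le> t * (real Z / X) ^ j}"

text \<open>The dimension in the covering argument of \<open>card_lam_scale_le\<close>: one real
  parameter for each coordinate and one for each coefficient.\<close>

definition D :: nat where
  "D = card I + d"

lemma D_pos: "D \<ge> 1"
  unfolding D_def using d_pos by simp

lemma finite_box: "finite (box t)"
  unfolding box_def by (rule finite_box')

lemma finite_lam: "finite (lam q Z t)"
  by (rule finite_subset[OF _ finite_box[of t]]) (auto simp: lam_def)

lemma lam_box: "a \<in> lam q Z t \<Longrightarrow> a \<in> box t"
  by (simp add: lam_def)

lemma lam_S: "a \<in> lam q Z t \<Longrightarrow> a \<in> S"
  by (simp add: lam_def box_def)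

lemma L_0 [simp]: "L i 0 = 0"
  using L_diff[of i 0 0] by simp

lemma \<beta>_0 [simp]: "\<beta> j 0 = 0"
  using \<beta>_diff[of j 0 0] by simp

lemma L_add: "L i (a + b) = L i a + L i b"
  using L_diff[of i a "0 - b"] L_diff[of i 0 b] by simp

lemma \<beta>_add: "\<beta> j (a + b) = \<beta> j a + \<beta> j b"
  using \<beta>_diff[of j a "0 - b"] \<beta>_diff[of j 0 b] by simp

lemma add_S: "a \<in> S \<Longrightarrow> b \<in> S \<Longrightarrow> a + b \<in> S"
  using diff_S[of a "0 - b"] diff_S[of 0 b] zero_S by simp

lemma \<beta>_smul: "\<beta> j (smul c a) = real c * \<beta> j a"
  by (induction c) (simp_all add: smul_Suc \<beta>_add algebra_simps)

lemma zero_lam: "t \<ge> 0 \<Longrightarrow> 0 \<in> lam q Z t"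
  unfolding lam_def box_def using zero_S X_pos by (auto intro!: exI[of _ 0])

lemma card_lam_pos: "t \<ge> 0 \<Longrightarrow> card (lam q Z t) \<ge> 1"
  using zero_lam[of t q Z] finite_lam[of q Z t] by (metis One_nat_def Suc_leI card_gt_0_iff empty_iff)

lemma box_mono: "s \<le> t \<Longrightarrow> box s \<subseteq> box t"
  unfolding box_def by force

lemma box_diff: "a \<in> box s \<Longrightarrow> b \<in> box t \<Longrightarrow> a - b \<in> box (s + t)"
  unfolding box_def by (auto simp: diff_S L_diff) (smt (verit))

lemma box_add: "a \<in> box s \<Longrightarrow> b \<in> box t \<Longrightarrow> a + b \<in> box (s + t)"
  unfolding box_def by (auto simp: add_S L_add) (smt (verit))

lemma lam_mono:
  assumes "q dvd q'" "q' \<ge> 1" "Z \<le> Z'" "s \<le> t" "0 \<le> s"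
  shows "lam q Z s \<subseteq> lam q' Z' t"
proof
  fix a assume a: "a \<in> lam q Z s"
  obtain m where m: "q' = q * m" using assms(1) by blast
  have qm: "q > 0" "m > 0" using assms(2) m by (auto intro: Nat.gr0I)
  have "\<exists>b::int. \<bar>\<beta> j a - b / real q' ^ j\<bar> \<le> t * (real Z' / X) ^ j" if j: "j \<in> {1..d}" for j
  proof -
    obtain b :: int where b: "\<bar>\<beta> j a - b / real q ^ j\<bar> \<le> s * (real Z / X) ^ j" using a j unfolding lam_def by blast
    have "of_int (b * int m ^ j) / real q' ^ j = b / real q ^ j"
      unfolding m using qm by (simp add: power_mult_distrib)
    moreover have "s * (real Z / X) ^ j \<le> t * (real Z' / X) ^ j"
      using assms X_pos by (intro mult_mono power_mono divide_right_mono) auto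
    ultimately show ?thesis using b by (intro exI[of _ "b * int m ^ j"]) linarith
  qed
  then show "a \<in> lam q' Z' t" using a box_mono[OF assms(4)] unfolding lam_def by auto
qed

lemma lam_diff: "a \<in> lam q Z s \<Longrightarrow> b \<in> lam q Z t \<Longrightarrow> a - b \<in> lam q Z (s + t)"
proof -
  assume a: "a \<in> lam q Z s" and b: "b \<in> lam q Z t"
  have "\<exists>c::int. \<bar>\<beta> j (a - b) - c / real q ^ j\<bar> \<le> (s + t) * (real Z / X) ^ j" if j: "j \<in> {1..d}" for j
  proof -
    obtain x y :: int where "\<bar>\<beta> j a - x / real q ^ j\<bar> \<le> s * (real Z / X) ^ j"
      "\<bar>\<beta> j b - y / real q ^ j\<bar> \<le> t * (real Z / X) ^ j" using a b j unfolding lam_def by blast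
    then show ?thesis by (intro exI[of _ "x - y"]) (simp add: \<beta>_diff diff_divide_distrib distrib_right)
  qed
  then show ?thesis using a b box_diff unfolding lam_def by auto
qed

lemma lam_uminus: "b \<in> lam q Z t \<Longrightarrow> - b \<in> lam q Z t"
  using lam_diff[OF zero_lam[of 0], of b q Z t] by simp

lemma lam_add: "a \<in> lam q Z s \<Longrightarrow> b \<in> lam q Z t \<Longrightarrow> a + b \<in> lam q Z (s + t)"
  using lam_diff[of a q Z s "- b" t] lam_uminus by simp

lemma lam_minus_commute: "a - b \<in> lam q Z t \<longleftrightarrow> b - a \<in> lam q Z t"
  using lam_uminus[of "a - b"] lam_uminus[of "b - a"] by auto

lemma lam_smul: "a \<in> lam q Z t \<Longrightarrow> smul c a \<in> lam q Z (real c * t)"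
proof (induction c)
  case (Suc c)
  then show ?case using lam_add[of a q Z t "smul c a" "real c * t"]
    by (simp add: smul_Suc algebra_simps)
qed (simp add: zero_lam)

text \<open>With y = Z m / X the assumption reads s y < 1/2; as s >= 1, also y < 1 and y^j <= y, so
  the condition for j = 1 covers every j. The bound is 1/2 because two such errors are
  added.\<close>

lemma precision_bound:
  assumes "s \<ge> 1" "s * real Z * real m < X / 2" "j \<ge> 1"
  shows "s * (real Z / X) ^ j * real m ^ j < 1/2"
proof -
  define y where "y = real Z * real m / X"
  have y0: "y \<ge> 0" unfolding y_def using X_pos by simp
  have sy: "s * y < 1/2" using assms(2) X_pos unfolding y_def by (simp add: field_simps)
  moreover have "1 * y \<le> s * y" using assms(1) y0 by (intro mult_right_mono)
  ultimately have "y \<le> 1" by linarith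
  then have "y ^ j \<le> y ^ 1" using y0 assms(3) by (intro power_decreasing) auto
  then have "s * y ^ j \<le> s * y" using assms(1) by (intro mult_left_mono) auto
  moreover have "s * (real Z / X) ^ j * real m ^ j = s * y ^ j"
    unfolding y_def by (simp add: power_mult_distrib power_divide)
  ultimately show ?thesis using sy by linarith
qed

lemma lam_rational_unique:
  assumes j: "j \<in> {1..d}" and q: "q \<ge> 1" "q' \<ge> 1" and s: "s \<ge> 1" "s' \<ge> 1"
    and X: "s * real Z * real (q * q') < X / 2" "s' * real Z' * real (q * q') < X / 2"
    and b: "\<bar>x - of_int b / real q ^ j\<bar> \<le> s * (real Z / X) ^ j"
    and b': "\<bar>x - of_int b' / real q' ^ j\<bar> \<le> s' * (real Z' / X) ^ j"
  shows "of_int b / real q ^ j = of_int b' / real q' ^ j"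
    "\<exists>c::int. of_int b / real q ^ j = of_int c / real (gcd q q') ^ j"
proof -
  have "(s * (real Z / X) ^ j + s' * (real Z' / X) ^ j) * real (q * q') ^ j < 1"
    using precision_bound[OF s(1) X(1), of j] precision_bound[OF s(2) X(2), of j] j
    by (simp add: distrib_right)
  from common_denominator_gcd[OF b b' this q]
  show "of_int b / real q ^ j = of_int b' / real q' ^ j"
    "\<exists>c::int. of_int b / real q ^ j = of_int c / real (gcd q q') ^ j" by blast+
qed

text \<open>For large X the two fractions approximating a coefficient coincide. The conclusion keeps
  the precision and tolerance of the first membership; those of the second only have to be good
  enough for the comparison.\<close>

lemma lam_gcd:
  assumes a: "a \<in> lam q Z s" "a \<in> lam q' Z' s'" and q: "q \<ge> 1" "q' \<ge> 1" and s: "s \<ge> 1" "s' \<ge> 1"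
    and X: "s * real Z * real (q * q') < X / 2" "s' * real Z' * real (q * q') < X / 2"
  shows "a \<in> lam (gcd q q') Z s"
proof -
  have "\<exists>c::int. \<bar>\<beta> j a - c / real (gcd q q') ^ j\<bar> \<le> s * (real Z / X) ^ j" if j: "j \<in> {1..d}" for j
  proof -
    obtain b where b: "\<bar>\<beta> j a - of_int b / real q ^ j\<bar> \<le> s * (real Z / X) ^ j" using a(1) j unfolding lam_def by blast
    obtain b' where b': "\<bar>\<beta> j a - of_int b' / real q' ^ j\<bar> \<le> s' * (real Z' / X) ^ j" using a(2) j unfolding lam_def by blast
    show ?thesis using lam_rational_unique(2)[OF j q s X b b'] b by metis
  qed
  then show ?thesis using a(1) unfolding lam_def by auto
qed

lemma lam_unsmul:
  assumes "smul c a \<in> lam q Z s" "a \<in> box s" "c \<ge> 1" "q \<ge> 1" "s \<ge> 0"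
  shows "a \<in> lam (q * c) Z s"
proof -
  have "\<exists>b::int. \<bar>\<beta> j a - b / real (q * c) ^ j\<bar> \<le> s * (real Z / X) ^ j" if j: "j \<in> {1..d}" for j
  proof -
    obtain b :: int where b: "\<bar>real c * \<beta> j a - b / real q ^ j\<bar> \<le> s * (real Z / X) ^ j"
      using assms(1) j unfolding lam_def \<beta>_smul[symmetric] by blast
    have c: "real c \<ge> 1" using assms(3) by simp
    \<comment> \<open>Dividing by c produces the denominator q^j c, which divides (q c)^j since j >=
      1.\<close>
    have "of_int (b * int c ^ (j - 1)) / real (q * c) ^ j = b / real q ^ j / real c"
    proof -
      have "real c ^ j = real c ^ (j - 1) * real c" using j by (simp flip: power_Suc2)
      then show ?thesis using c assms(4) by (simp add: power_mult_distrib field_simps)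
    qed
    moreover have "\<bar>\<beta> j a - b / real q ^ j / real c\<bar> = \<bar>real c * \<beta> j a - b / real q ^ j\<bar> / real c"
    proof -
      have "real c * \<beta> j a - b / real q ^ j = real c * (\<beta> j a - b / real q ^ j / real c)"
        using c by (simp add: right_diff_distrib)
      then show ?thesis using c by (simp only: abs_mult) simp
    qed
    moreover have "\<bar>real c * \<beta> j a - b / real q ^ j\<bar> / real c \<le> s * (real Z / X) ^ j / 1"
      using b c assms(5) X_pos by (intro frac_le) auto
    ultimately show ?thesis by (intro exI[of _ "b * int c ^ (j - 1)"]) simp
  qed
  then show ?thesis using assms(2) unfolding lam_def by auto
qed

text \<open>The translates p + \<open>lam q Z t\<close> are pairwise disjoint, since a common
  element would put p - p' into \<open>lam q Z (2 * t)\<close>.\<close>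

lemma translates_card_le:
  assumes "finite P" "finite E"
    and "\<And>p x. p \<in> P \<Longrightarrow> x \<in> lam q Z t \<Longrightarrow> p + x \<in> E"
    and "\<And>p p'. p \<in> P \<Longrightarrow> p' \<in> P \<Longrightarrow> p \<noteq> p' \<Longrightarrow> p - p' \<notin> lam q Z (2 * t)"
  shows "card P * card (lam q Z t) \<le> card E"
proof -
  have "inj_on (\<lambda>(p, x). p + x) (P \<times> lam q Z t)"
  proof (rule inj_onI, clarify)
    fix p x p' x' assume h: "p \<in> P" "p' \<in> P" "x \<in> lam q Z t" "x' \<in> lam q Z t" "p + x = p' + x'"
    then have "p - p' = x' - x" by (simp add: algebra_simps)
    then have "p - p' \<in> lam q Z (2 * t)" using lam_diff[OF h(4,3)] by simp
    then have "p = p'" using assms(4) h by blast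
    then show "p = p' \<and> x = x'" using h(5) by simp
  qed
  then have "card (P \<times> lam q Z t) = card ((\<lambda>(p, x). p + x) ` (P \<times> lam q Z t))" by (simp add: card_image)
  also have "\<dots> \<le> card E" using assms(2,3) by (intro card_mono) auto
  finally show ?thesis by (simp add: card_cartesian_product)
qed

text \<open>Covering: in units of t the coordinates and the approximation errors lie in [-s, s].
  Elements for which all D of them have equal floors differ by an element of
  \<open>lam q Z t\<close>, and each floor takes at most 2 s + 2 values.\<close>

lemma card_lam_scale_le:
  assumes s: "s > 0" and t: "t > 0" and Z: "Z \<ge> 1"
  shows "real (card (lam q Z (s * t))) \<le> (2 * s + 2) ^ D * real (card (lam q Z t))"
proof -
  \<comment> \<open>A chosen numerator of the approximating fraction. Differences of these
    numerators serve for differences of elements.\<close>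
  define freq_coeff where "freq_coeff j a = (SOME b::int. \<bar>\<beta> j a - b / real q ^ j\<bar> \<le> s * t * (real Z / X) ^ j)" for j a
  have freq_coeff: "\<bar>\<beta> j a - freq_coeff j a / real q ^ j\<bar> \<le> s * t * (real Z / X) ^ j" if "a \<in> lam q Z (s * t)" "j \<in> {1..d}" for j a
    using someI_ex[of "\<lambda>b::int. \<bar>\<beta> j a - b / real q ^ j\<bar> \<le> s * t * (real Z / X) ^ j"] that
    unfolding freq_coeff_def lam_def by auto
  define \<xi> where "\<xi> w a = (case w of Inl i \<Rightarrow> L i a / t | Inr j \<Rightarrow> (\<beta> j a - freq_coeff j a / real q ^ j) / (t * (real Z / X) ^ j))" for w a
  define W where "W = I <+> {1..d}"
  have finW: "finite W" and cardW: "card W = D"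
    unfolding W_def D_def using finite_I by (auto simp: card_Plus)
  have pos: "t * (real Z / X) ^ j > 0" for j using t Z X_pos by simp
  have \<xi>_le: "\<bar>\<xi> w a\<bar> \<le> s" if "a \<in> lam q Z (s * t)" "w \<in> W" for w a
  proof (cases w)
    case (Inl i)
    then show ?thesis using that t unfolding \<xi>_def W_def lam_def box_def by (auto simp: abs_divide pos_divide_le_eq)
  next
    case (Inr j)
    then have j: "j \<in> {1..d}" using that unfolding W_def by auto
    show ?thesis using freq_coeff[OF that(1) j] pos[of j] unfolding \<xi>_def Inr
      by (simp only: sum.case abs_divide abs_of_pos[OF pos] pos_divide_le_eq[OF pos] mult.assoc)
  qed
  define f where "f a = (\<lambda>w\<in>W. \<lfloor>\<xi> w a\<rfloor>)" for a
  define V where "V = {\<lfloor>- s\<rfloor>..\<lfloor>s\<rfloor>}"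
  have fV: "f ` lam q Z (s * t) \<subseteq> W \<rightarrow>\<^sub>E V"
  proof
    fix y assume "y \<in> f ` lam q Z (s * t)"
    then obtain a where a: "a \<in> lam q Z (s * t)" "y = f a" by blast
    have "\<lfloor>\<xi> w a\<rfloor> \<in> V" if "w \<in> W" for w
      using \<xi>_le[OF a(1) that] unfolding V_def by (auto intro!: floor_mono simp: abs_le_iff)
    then show "y \<in> W \<rightarrow>\<^sub>E V" unfolding a(2) f_def by auto
  qed
  have fib: "card {a\<in>lam q Z (s * t). f a = y} \<le> card (lam q Z t)" for y
  proof (cases "{a\<in>lam q Z (s * t). f a = y} = {}")
    case False
    then obtain a0 where a0: "a0 \<in> lam q Z (s * t)" "f a0 = y" by blast
    have "(\<lambda>a. a - a0) ` {a\<in>lam q Z (s * t). f a = y} \<subseteq> lam q Z t"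
    proof clarify
      fix a assume a: "a \<in> lam q Z (s * t)" "y = f a"
      have near: "\<bar>\<xi> w a - \<xi> w a0\<bar> \<le> 1" if "w \<in> W" for w
      proof -
        have "f a w = f a0 w" using a a0 by simp
        then have "\<lfloor>\<xi> w a\<rfloor> = \<lfloor>\<xi> w a0\<rfloor>" using that unfolding f_def by simp
        then show ?thesis by linarith
      qed
      have "\<bar>L i (a - a0)\<bar> \<le> t" if i: "i \<in> I" for i
      proof -
        have "\<bar>L i a / t - L i a0 / t\<bar> \<le> 1" using near[of "Inl i"] i unfolding \<xi>_def W_def by auto
        then show ?thesis using t unfolding L_diff by (simp flip: diff_divide_distrib)
      qed
      then have 1: "a - a0 \<in> box t" using a a0 unfolding box_def by (auto intro: diff_S lam_S)
      have 2: "\<exists>b::int. \<bar>\<beta> j (a - a0) - b / real q ^ j\<bar> \<le> t * (real Z / X) ^ j" if j: "j \<in> {1..d}" for j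
      proof -
        define P where "P = t * (real Z / X) ^ j"
        have P: "P > 0" using pos unfolding P_def .
        have "\<bar>(\<beta> j a - freq_coeff j a / real q ^ j) / P - (\<beta> j a0 - freq_coeff j a0 / real q ^ j) / P\<bar> \<le> 1"
          using near[of "Inr j"] InrI[OF j, of I] unfolding \<xi>_def W_def P_def by simp
        then have "\<bar>(\<beta> j a - freq_coeff j a / real q ^ j) - (\<beta> j a0 - freq_coeff j a0 / real q ^ j)\<bar> \<le> P"
          using P by (simp flip: diff_divide_distrib)
        then show ?thesis unfolding P_def[symmetric]
          by (intro exI[of _ "freq_coeff j a - freq_coeff j a0"]) (simp add: \<beta>_diff diff_divide_distrib algebra_simps)
      qed
      show "a - a0 \<in> lam q Z t" using 1 2 unfolding lam_def by auto
    qed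
    moreover have "inj_on (\<lambda>a. a - a0) {a\<in>lam q Z (s * t). f a = y}" by (auto intro: inj_onI)
    ultimately show ?thesis using card_inj_on_le finite_lam by blast
  qed (metis card.empty zero_le)
  have "card (lam q Z (s * t)) \<le> card (W \<rightarrow>\<^sub>E V) * card (lam q Z t)"
    by (rule card_le_fibres[OF finite_lam _ fV fib]) (auto intro!: finite_PiE finW simp: V_def)
  then have "real (card (lam q Z (s * t))) \<le> real (card (W \<rightarrow>\<^sub>E V)) * real (card (lam q Z t))"
    by (metis of_nat_le_iff of_nat_mult)
  also have "card (W \<rightarrow>\<^sub>E V) = card V ^ D" using finW cardW by (simp add: card_PiE)
  also have "real (card V ^ D) * real (card (lam q Z t)) \<le> (2 * s + 2) ^ D * real (card (lam q Z t))"
  proof -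
    have "real (card V) \<le> 2 * s + 2" unfolding V_def using s by simp linarith
    then have "real (card V) ^ D \<le> (2 * s + 2) ^ D" by (intro power_mono) auto
    then show ?thesis by (simp add: mult_right_mono)
  qed
  finally show ?thesis .
qed

section \<open>Regular scales\<close>

definition dens :: "real \<Rightarrow> real \<Rightarrow> real" where
  "dens c t = (SUP p\<in>{1..} \<times> {1..}. real (card (lam (fst p) (snd p) t)) / real (fst p * snd p) powr c)"

lemma dens_bdd:
  assumes "c > 0"
  shows "bdd_above ((\<lambda>p. real (card (lam (fst p) (snd p) t)) / real (fst p * snd p) powr c) ` ({1..} \<times> {1..}))"
proof (rule bdd_aboveI2)
  fix p :: "nat \<times> nat" assume p: "p \<in> {1..} \<times> {1..}"
  have "1 \<le> real (fst p * snd p)" 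
  proof -
    have "1 * 1 \<le> fst p * snd p" using p by (intro mult_le_mono) auto
    then show ?thesis by (metis mult_1 of_nat_1 of_nat_mono)
  qed
  then have "1 \<le> real (fst p * snd p) powr c" using assms by (intro ge_one_powr_ge_zero) auto
  moreover have "card (lam (fst p) (snd p) t) \<le> card (box t)"
    using finite_box by (intro card_mono) (auto simp: lam_def)
  ultimately show "real (card (lam (fst p) (snd p) t)) / real (fst p * snd p) powr c \<le> real (card (box t))"
    using frac_le[of "real (card (box t))" "real (card (lam (fst p) (snd p) t))" 1 "real (fst p * snd p) powr c"]
    by simp
qed

lemma card_lam_le_dens:
  assumes "c > 0" "q \<ge> 1" "Z \<ge> 1"
  shows "real (card (lam q Z t)) \<le> dens c t * real (q * Z) powr c"
proof -
  have "real (card (lam q Z t)) / real (q * Z) powr c \<le> dens c t"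
    unfolding dens_def using cSUP_upper[OF _ dens_bdd[OF assms(1)], of "(q, Z)"] assms by auto
  then show ?thesis using assms by (simp add: pos_divide_le_eq)
qed

lemma dens_near_maximizer:
  assumes "c > 0" "t \<ge> 0"
  shows "\<exists>q Z. q \<ge> 1 \<and> Z \<ge> 1 \<and> dens c t * real (q * Z) powr c \<le> 2 * real (card (lam q Z t))"
proof -
  have "1 \<le> real (card (lam 1 1 t))" using card_lam_pos[OF assms(2)] by simp
  also have "\<dots> \<le> dens c t" using card_lam_le_dens[OF assms(1), of 1 1 t] by simp
  finally have "dens c t / 2 < dens c t" by simp
  moreover have "{1..} \<times> {1..} \<noteq> ({} :: (nat \<times> nat) set)" by auto
  ultimately have "\<exists>p\<in>{1..} \<times> {1..}. dens c t / 2 < real (card (lam (fst p) (snd p) t)) / real (fst p * snd p) powr c"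
    using less_cSUP_iff[OF _ dens_bdd[OF assms(1)], of "dens c t / 2" t, folded dens_def] by blast
  then obtain q Z where qZ: "q \<ge> 1" "Z \<ge> 1" "dens c t / 2 < real (card (lam q Z t)) / real (q * Z) powr c"
    by auto
  then have "dens c t * real (q * Z) powr c \<le> 2 * real (card (lam q Z t))"
    by (simp add: pos_less_divide_eq)
  then show ?thesis using qZ by blast
qed

lemma one_le_dens:
  assumes "c > 0" "t \<ge> 0"
  shows "1 \<le> dens c t"
  using card_lam_le_dens[OF assms(1), of 1 1 t] card_lam_pos[OF assms(2), of 1 1] by simp

lemma dens_scale:
  assumes "c > 0" "s > 0" "t > 0"
  shows "dens c (s * t) \<le> (2 * s + 2) ^ D * dens c t"
  unfolding dens_def[of c "s * t"]
proof (rule cSUP_least)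
  fix p :: "nat \<times> nat" assume p: "p \<in> {1..} \<times> {1..}"
  have "real (card (lam (fst p) (snd p) (s * t))) \<le> (2 * s + 2) ^ D * real (card (lam (fst p) (snd p) t))"
    using p assms by (intro card_lam_scale_le) auto
  also have "\<dots> \<le> (2 * s + 2) ^ D * (dens c t * real (fst p * snd p) powr c)"
    using p assms by (intro mult_left_mono card_lam_le_dens) auto
  finally show "real (card (lam (fst p) (snd p) (s * t))) / real (fst p * snd p) powr c \<le> (2 * s + 2) ^ D * dens c t"
    using p by (auto simp: pos_divide_le_eq mult.assoc)
qed auto

text \<open>
  A pair \<open>(q, Z)\<close> that nearly attains the supremum \<open>dens c t\<close> gains little from passing to
  \<open>(q h, Z H)\<close>; a pigeonhole over scales provides a \<open>t\<close> at which in addition enlarging \<open>t\<close> by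
  the factor \<open>1 + 1 / D\<close> costs only a constant.
\<close>

definition regular :: "real \<Rightarrow> nat \<Rightarrow> nat \<Rightarrow> real \<Rightarrow> bool" where
  "regular c q Z t \<longleftrightarrow> q \<ge> 1 \<and> Z \<ge> 1 \<and> (\<forall>h\<ge>1. \<forall>H\<ge>1.
     real (card (lam (q * h) (Z * H) (t + t / D))) \<le> 8 * real (h * H) powr c * real (card (lam q Z t)))"

lemma exists_regular:
  assumes c: "c > 0" and T: "T > 0"
  shows "\<exists>t q Z. T \<le> t \<and> t \<le> 243 * T \<and> regular c q Z t \<and> real (q * Z) powr c \<le> 2 * real (card (box t))"
proof -
  define \<rho> where "\<rho> = 1 + 1 / real D"
  have \<rho>: "\<rho> \<ge> 1" unfolding \<rho>_def by simp
  \<comment> \<open>The 5 D steps of ratio 1 + 1/D multiply T by at most exp 5, and exp 1 <= 3 gives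
    3^5 = 243.\<close>
  have \<rho>5: "\<rho> ^ (5 * D) \<le> 243"
  proof -
    have "\<rho> \<le> exp (1 / D)" unfolding \<rho>_def by (rule exp_ge_add_one_self)
    then have "\<rho> ^ D \<le> exp (1 / D) ^ D" using \<rho> by (intro power_mono) auto
    also have "\<dots> = exp 1" using D_pos by (simp flip: exp_of_nat_mult)
    also have "\<dots> \<le> 3" by (rule exp_le)
    finally have "(\<rho> ^ D) ^ 5 \<le> 3 ^ 5" using \<rho> by (intro power_mono) auto
    then show ?thesis by (simp add: power_mult[symmetric] mult.commute)
  qed
  \<comment> \<open>If the density grew by more than a factor 4 at each step, it would grow by 4^(5
    D) = 1024^D in total, while the covering bound allows only (2 * 243 + 2)^D = 488^D.\<close>
  have "\<exists>i<5 * D. dens c (\<rho> ^ Suc i * T) \<le> 4 * dens c (\<rho> ^ i * T)"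
  proof (rule ccontr)
    assume "\<not> ?thesis"
    then have gt: "dens c (\<rho> ^ Suc i * T) > 4 * dens c (\<rho> ^ i * T)" if "i < 5 * D" for i using that by force
    have "dens c (\<rho> ^ i * T) \<ge> 4 ^ i * dens c T" if "i \<le> 5 * D" for i
      using that
    proof (induction i)
      case (Suc i)
      then have "dens c (\<rho> ^ Suc i * T) > 4 * dens c (\<rho> ^ i * T)" by (intro gt) auto
      moreover have "4 ^ i * dens c T \<le> dens c (\<rho> ^ i * T)" using Suc by simp
      ultimately show ?case by simp
    qed simp
    then have 1: "4 ^ (5 * D) * dens c T \<le> dens c (\<rho> ^ (5 * D) * T)" by simp
    have "dens c (\<rho> ^ (5 * D) * T) \<le> (2 * \<rho> ^ (5 * D) + 2) ^ D * dens c T"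
      using \<rho> T c by (intro dens_scale) auto
    also have "\<dots> \<le> 488 ^ D * dens c T"
      using \<rho>5 \<rho> one_le_dens[OF c, of T] T by (intro mult_right_mono power_mono) auto
    finally have "4 ^ (5 * D) * dens c T \<le> 488 ^ D * dens c T" using 1 by linarith
    then have "(4::real) ^ (5 * D) \<le> 488 ^ D" using one_le_dens[OF c, of T] T by simp
    moreover have "(4::real) ^ (5 * D) = 1024 ^ D" by (simp add: power_mult)
    moreover have "(488::real) ^ D < 1024 ^ D" using D_pos by (intro power_strict_mono) auto
    ultimately show False by linarith
  qed
  then obtain i where i: "i < 5 * D" "dens c (\<rho> ^ Suc i * T) \<le> 4 * dens c (\<rho> ^ i * T)" by blast
  define t where "t = \<rho> ^ i * T"
  have t: "T \<le> t" "t \<le> 243 * T"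
  proof -
    show "T \<le> t" unfolding t_def using one_le_power[OF \<rho>, of i] T by simp
    have "\<rho> ^ i \<le> \<rho> ^ (5 * D)" using i(1) \<rho> by (intro power_increasing) auto
    then show "t \<le> 243 * T" unfolding t_def using \<rho>5 T by (intro mult_right_mono) auto
  qed
  have tt: "\<rho> ^ Suc i * T = t + t / D" unfolding t_def \<rho>_def by (simp add: algebra_simps)
  obtain q Z where qZ: "q \<ge> 1" "Z \<ge> 1" "dens c t * real (q * Z) powr c \<le> 2 * real (card (lam q Z t))"
    using dens_near_maximizer[OF c, of t] t T by auto
  \<comment> \<open>The factor 8 combines 4 from the growth of the density with 2 from
    near-maximality.\<close>
  have "real (card (lam (q * h) (Z * H) (t + t / D))) \<le> 8 * real (h * H) powr c * real (card (lam q Z t))"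
    if h: "h \<ge> 1" "H \<ge> 1" for h H
  proof -
    have "real (card (lam (q * h) (Z * H) (t + t / D))) \<le> dens c (t + t / D) * real ((q * h) * (Z * H)) powr c"
      using qZ h c by (intro card_lam_le_dens) (auto simp: Suc_le_eq)
    also have "\<dots> \<le> (4 * dens c t) * real ((q * h) * (Z * H)) powr c"
      using i(2) unfolding tt t_def[symmetric] by (intro mult_right_mono) auto
    also have "real ((q * h) * (Z * H)) powr c = real (q * Z) powr c * real (h * H) powr c"
      by (simp add: powr_mult[symmetric] mult_ac)
    also have "4 * dens c t * (real (q * Z) powr c * real (h * H) powr c) = 4 * real (h * H) powr c * (dens c t * real (q * Z) powr c)"
      by simp
    also have "\<dots> \<le> 4 * real (h * H) powr c * (2 * real (card (lam q Z t)))"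
      using qZ(3) by (intro mult_left_mono) auto
    finally show ?thesis by simp
  qed
  then have "regular c q Z t" unfolding regular_def using qZ by blast
  moreover have "real (q * Z) powr c \<le> 2 * real (card (box t))"
  proof -
    have "1 * real (q * Z) powr c \<le> dens c t * real (q * Z) powr c"
      using one_le_dens[OF c, of t] t T by (intro mult_right_mono) auto
    also have "\<dots> \<le> 2 * real (card (lam q Z t))" by (rule qZ(3))
    also have "card (lam q Z t) \<le> card (box t)"
      using finite_box by (intro card_mono) (auto simp: lam_def)
    finally show ?thesis by simp
  qed
  ultimately show ?thesis using t by blast
qed

text \<open>
  The translates of \<open>lam q Z t\<close> by the multiples \<open>p a\<close> are disjoint and lie in
  \<open>lam (q h) (Z H) (t + t / D)\<close>, whose size is bounded by regularity.
\<close>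

lemma regular_translates:
  assumes reg: "regular c q Z t" and a: "a \<in> lam (q * h) (Z * H) r" and h: "h \<ge> 1" "H \<ge> 1"
    and r: "r \<ge> 0" and t: "t > 0"
    and P: "finite P" "\<And>p. p \<in> P \<Longrightarrow> real p * r \<le> t / D"
    and sep: "\<And>p p'. p \<in> P \<Longrightarrow> p' \<in> P \<Longrightarrow> p < p' \<Longrightarrow> smul (p' - p) a \<notin> lam q Z (2 * t)"
  shows "real (card P) \<le> 8 * real (h * H) powr c"
proof -
  have qZ: "q \<ge> 1" "Z \<ge> 1" using reg unfolding regular_def by auto
  have ne: "smul p a - smul p' a \<notin> lam q Z (2 * t)" if "p \<in> P" "p' \<in> P" "p \<noteq> p'" for p p'
    using sep[of p p'] sep[of p' p] that smul_diff[of p p' a] smul_diff[of p' p a] lam_minus_commute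
    by (metis less_imp_le linorder_neqE_nat)
  have "inj_on (\<lambda>p. smul p a) P"
  proof (rule inj_onI, rule ccontr)
    fix p p' assume "p \<in> P" "p' \<in> P" "smul p a = smul p' a" "p \<noteq> p'"
    then show False using ne[of p p'] zero_lam[of "2 * t" q Z] t by simp
  qed
  then have "card P * card (lam q Z t) = card ((\<lambda>p. smul p a) ` P) * card (lam q Z t)"
    by (simp add: card_image)
  also have "\<dots> \<le> card (lam (q * h) (Z * H) (t + t / D))"
  proof (rule translates_card_le)
    show "finite ((\<lambda>p. smul p a) ` P)" using P(1) by simp
    show "finite (lam (q * h) (Z * H) (t + t / D))" by (rule finite_lam)
    show "y + x \<in> lam (q * h) (Z * H) (t + t / D)" if y: "y \<in> (\<lambda>p. smul p a) ` P" and x: "x \<in> lam q Z t" for y x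
    proof -
      obtain p where p: "p \<in> P" "y = smul p a" using y by blast
      have "y \<in> lam (q * h) (Z * H) (real p * r)" unfolding p(2) by (rule lam_smul[OF a])
      moreover have "x \<in> lam (q * h) (Z * H) t"
        using x lam_mono[of q "q * h" Z "Z * H" t t] qZ h t by (auto simp: Suc_le_eq)
      ultimately have "y + x \<in> lam (q * h) (Z * H) (real p * r + t)" by (rule lam_add)
      then show ?thesis
        using lam_mono[of "q * h" "q * h" "Z * H" "Z * H" "real p * r + t" "t + t / D"] P(2)[OF p(1)] qZ h t r
        by (auto simp: Suc_le_eq)
    qed
    show "y - y' \<notin> lam q Z (2 * t)" if "y \<in> (\<lambda>p. smul p a) ` P" "y' \<in> (\<lambda>p. smul p a) ` P" "y \<noteq> y'" for y y'
      using that ne by blast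
  qed
  finally have "real (card P) * real (card (lam q Z t)) \<le> real (card (lam (q * h) (Z * H) (t + t / D)))"
    by (metis of_nat_le_iff of_nat_mult)
  also have "\<dots> \<le> 8 * real (h * H) powr c * real (card (lam q Z t))"
    using reg h unfolding regular_def by auto
  finally show ?thesis using card_lam_pos[of t q Z] t by simp
qed

text \<open>As m exceeds 8 (h H)^c, \<open>regular_translates\<close> forbids m multiples of a to be
  separated modulo \<open>lam q Z (2 * t)\<close>, so e a lies there for some e with 1 <= e < m.
  Hence a has the denominator q e besides q h, and their gcd leaves h' = gcd(h, e).\<close>

lemma reduce_denominator:
  assumes reg: "regular c q Z t" and a: "a \<in> lam (q * h) (Z * H) 2" and h: "h \<ge> 1" "H \<ge> 1"
    and m: "8 * real (h * H) powr c < real m" "2 * real m \<le> t / D" and t: "t \<ge> 1"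
    and X: "4 * t * real (Z * H) * (real (q * h) * real (q * m)) < X"
  shows "\<exists>h'. 1 \<le> h' \<and> h' < m \<and> a \<in> lam (q * h') (Z * H) 2"
proof -
  have qZ: "q \<ge> 1" "Z \<ge> 1" using reg unfolding regular_def by auto
  have m0: "real m > 0" using m(1) by (smt (verit) powr_ge_zero)
  have "\<exists>p p'. p < p' \<and> p' < m \<and> smul (p' - p) a \<in> lam q Z (2 * t)"
  proof (rule ccontr)
    assume "\<not> ?thesis"
    moreover have "real p * 2 \<le> t / real D" if "p < m" for p
    proof -
      have "real p \<le> real m" using that by simp
      then show ?thesis using m(2) by linarith
    qed
    ultimately have "real (card {..<m}) \<le> 8 * real (h * H) powr c"
      using t by (intro regular_translates[OF reg a h]) auto
    then show False using m(1) by simp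
  qed
  then obtain p p' where p: "p < p'" "p' < m" "smul (p' - p) a \<in> lam q Z (2 * t)" by blast
  define e where "e = p' - p"
  have e: "1 \<le> e" "e < m" "smul e a \<in> lam q Z (2 * t)" using p unfolding e_def by auto
  have "a \<in> box (2 * t)" using lam_box[OF a] box_mono[of 2 "2 * t"] t by auto
  from lam_unsmul[OF e(3) this e(1) qZ(1)] t
  have a2: "a \<in> lam (q * e) Z (2 * t)" by simp
  have "real (q * h * (q * e)) \<le> real (q * h) * real (q * m)"
    using e(2) by (simp add: mult_left_mono)
  moreover have "4 * t * real (Z * H) > 0" using t qZ h by simp
  ultimately have big: "4 * t * real (Z * H) * real (q * h * (q * e)) < X"
    using X mult_left_mono[of "real (q * h * (q * e))" "real (q * h) * real (q * m)" "4 * t * real (Z * H)"] by linarith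
  have 1: "2 * real (Z * H) * real (q * h * (q * e)) < X / 2"
  proof -
    have "1 * (real (Z * H) * real (q * h * (q * e))) \<le> t * (real (Z * H) * real (q * h * (q * e)))"
      using t by (intro mult_right_mono) auto
    then show ?thesis using big by (simp add: mult.assoc)
  qed
  have 2: "2 * t * real Z * real (q * h * (q * e)) < X / 2"
  proof -
    have "real (Z * 1) \<le> real (Z * H)" using h by (intro of_nat_mono mult_left_mono) auto
    then have "real Z \<le> real (Z * H)" by simp
    then have "2 * t * real Z * real (q * h * (q * e)) \<le> 2 * t * real (Z * H) * real (q * h * (q * e))"
      using t by (intro mult_right_mono mult_left_mono) auto
    then show ?thesis using big by simp
  qed
  have "a \<in> lam (gcd (q * h) (q * e)) (Z * H) 2"
    using lam_gcd[OF a a2 _ _ _ _ 1 2] qZ h e t by (simp add: Suc_le_eq)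
  moreover have "gcd (q * h) (q * e) = q * gcd h e" by (simp add: gcd_mult_distrib_nat)
  moreover have "gcd h e \<ge> 1" using h by (simp add: Suc_le_eq)
  moreover have "gcd h e < m" using e(1,2) dvd_imp_le[OF gcd_dvd2, of e h] by linarith
  ultimately show ?thesis by metis
qed

text \<open>The error of a coefficient grows linearly along the multiples of a. If it were larger
  than claimed for a itself, m multiples with gaps of at least s would be separated modulo
  \<open>lam q Z (2 * t)\<close>, against \<open>regular_translates\<close>.\<close>

lemma reduce_precision:
  assumes reg: "regular c q Z t" and a: "a \<in> lam (q * h) (Z * H) 2" and h: "h \<ge> 1" "H \<ge> 1"
    and m: "8 * real (h * H) powr c < real m" "4 * real D * real m \<le> t" and t: "t \<ge> 1"
    and X: "4 * t * real (Z * H) * (real q * real (q * h)) * t < X"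
  shows "a \<in> lam (q * h) (Z * (4 * D * m)) 2"
proof (rule ccontr)
  assume na: "a \<notin> lam (q * h) (Z * (4 * D * m)) 2"
  have qZ: "q \<ge> 1" "Z \<ge> 1" using reg unfolding regular_def by auto
  have m0: "m \<ge> 1" using m(1) by (metis One_nat_def Suc_leI gr_zeroI less_eq_real_def mult_nonneg_nonneg not_le of_nat_0 powr_ge_zero zero_le_numeral)
  \<comment> \<open>The gap s is about t / H'; the factor 4 D m keeps m such gaps within the allowed
    range, 2 m s <= t / D.\<close>
  define H' where "H' = 4 * D * m"
  have H'1: "H' \<ge> 1" unfolding H'_def using m0 D_pos by (simp add: Suc_le_eq)
  obtain j where j: "j \<in> {1..d}" "\<And>b::int. \<not> \<bar>\<beta> j a - b / real (q * h) ^ j\<bar> \<le> 2 * (real (Z * H') / X) ^ j"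
    using na a unfolding lam_def H'_def by blast
  obtain b :: int where b: "\<bar>\<beta> j a - b / real (q * h) ^ j\<bar> \<le> 2 * (real (Z * H) / X) ^ j"
    using a j(1) unfolding lam_def by blast
  define \<theta> where "\<theta> = \<bar>\<beta> j a - b / real (q * h) ^ j\<bar>"
  define Y where "Y = (real Z / X) ^ j"
  have Y: "Y > 0" unfolding Y_def using qZ X_pos by simp
  have \<theta>: "\<theta> > 2 * real H' * Y"
  proof -
    have "real H' ^ 1 \<le> real H' ^ j" using H'1 j by (intro power_increasing) auto
    then have "2 * real H' * Y \<le> 2 * (real H' ^ j * Y)" using Y by simp
    also have "\<dots> = 2 * (real (Z * H') / X) ^ j" unfolding Y_def by (simp add: power_mult_distrib power_divide)
    also have "\<dots> < \<theta>" using j(2)[of b] unfolding \<theta>_def by simp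
    finally show ?thesis .
  qed
  define s where "s = nat \<lceil>t / real H'\<rceil>"
  have s: "real s \<ge> t / real H'" "real s \<le> t / real H' + 1" "s \<ge> 1"
    using t H'1 unfolding s_def by (auto simp: le_nat_iff ceiling_less_iff Suc_le_eq)
  have ms: "real (m * s) * 2 \<le> t / D"
  proof -
    have "real (m * s) * 2 \<le> 2 * real m * (t / real H' + 1)" using s(2) by (simp add: mult_left_mono)
    also have "\<dots> = t / (2 * real D) + 2 * real m"
      unfolding H'_def using m0 D_pos by (simp add: field_simps)
    also have "2 * real m \<le> t / (2 * real D)" using m(2) D_pos by (simp add: field_simps)
    finally show ?thesis by (simp add: field_simps)
  qed
  have mst: "real (m * s) \<le> t"
  proof -
    have "t / D \<le> t / 1" using D_pos t by (intro divide_left_mono) auto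
    then show ?thesis using ms by linarith
  qed
  have "real (card ((\<lambda>i. i * s) ` {..<m})) \<le> 8 * real (h * H) powr c"
  proof (rule regular_translates[OF reg a h])
    show "0 \<le> (2::real)" "0 < t" "finite ((\<lambda>i. i * s) ` {..<m})" using t by auto
    fix p assume "p \<in> (\<lambda>i. i * s) ` {..<m}"
    then have "p \<le> m * s" by auto
    then have "real p * 2 \<le> real (m * s) * 2" by (intro mult_right_mono of_nat_mono) auto
    then show "real p * 2 \<le> t / real D" using ms by linarith
  next
    fix p p' assume p: "p \<in> (\<lambda>i. i * s) ` {..<m}" "p' \<in> (\<lambda>i. i * s) ` {..<m}" "p < p'"
    then obtain i i' where i: "p = i * s" "p' = i' * s" "i' < m" by blast
    define e where "e = p' - p"
    have "e = (i' - i) * s" unfolding e_def i by (simp add: diff_mult_distrib)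
    moreover have "i < i'" using p(3) i by simp
    ultimately have e: "e \<ge> s" "e \<le> m * s" using i(3) by auto
    have e\<theta>: "\<bar>real e * \<beta> j a - of_int (int e * b) / real (q * h) ^ j\<bar> = real e * \<theta>"
    proof -
      have "real e * \<beta> j a - of_int (int e * b) / real (q * h) ^ j = real e * (\<beta> j a - b / real (q * h) ^ j)"
        by (simp add: right_diff_distrib)
      then show ?thesis unfolding \<theta>_def by (simp only: abs_mult abs_of_nat)
    qed
    show "smul (p' - p) a \<notin> lam q Z (2 * t)"
    proof
      assume "smul (p' - p) a \<in> lam q Z (2 * t)"
      then obtain b' :: int where b': "\<bar>real e * \<beta> j a - b' / real q ^ j\<bar> \<le> 2 * t * (real Z / X) ^ j"
        using j(1) unfolding lam_def \<beta>_smul[symmetric] e_def by blast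
      have freq_coeff: "\<bar>real e * \<beta> j a - of_int (int e * b) / real (q * h) ^ j\<bar> \<le> 2 * t * (real (Z * H) / X) ^ j"
      proof -
        have "real e * \<theta> \<le> t * (2 * (real (Z * H) / X) ^ j)"
        proof (rule mult_mono)
          have "real e \<le> real (m * s)" using e(2) by (rule of_nat_mono)
          then show "real e \<le> t" using mst by linarith
          show "\<theta> \<le> 2 * (real (Z * H) / X) ^ j" using b unfolding \<theta>_def .
        qed (use t in \<open>auto simp: \<theta>_def\<close>)
        then show ?thesis unfolding e\<theta> by simp
      qed
      have XX: "2 * t * real (Z * H) * real (q * (q * h)) < X / 2"
      proof -
        have "4 * t * real (Z * H) * (real q * real (q * h)) * 1 \<le> 4 * t * real (Z * H) * (real q * real (q * h)) * t"
          using t by (intro mult_left_mono) auto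
        then show ?thesis using X by simp
      qed
      have "real (Z * 1) \<le> real (Z * H)" using h by (intro of_nat_mono mult_left_mono) auto
    then have "real Z \<le> real (Z * H)" by simp
      then have "2 * t * real Z * real (q * (q * h)) \<le> 2 * t * real (Z * H) * real (q * (q * h))"
        using t by (intro mult_right_mono mult_left_mono) auto
      then have XX': "2 * t * real Z * real (q * (q * h)) < X / 2" using XX by linarith
      \<comment> \<open>X is large enough for b' / q^j to equal e times the original fraction, so
        the error of e a is exactly e theta.\<close>
      have eq: "of_int b' / real q ^ j = of_int (int e * b) / real (q * h) ^ j"
        by (rule lam_rational_unique(1)[OF j(1) _ _ _ _ XX' XX b' freq_coeff]) (use qZ h t in \<open>auto simp: Suc_le_eq\<close>)
      have "real e * \<theta> \<le> 2 * t * Y" using b' unfolding e\<theta>[symmetric] eq[symmetric] Y_def by simp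
      moreover have "real e * \<theta> > 2 * t * Y"
      proof -
        have "t \<le> real s * real H'" using s(1) H'1 by (simp add: pos_divide_le_eq)
        also have "\<dots> \<le> real e * real H'" using e(1) by (intro mult_right_mono) auto
        finally have "2 * t * Y \<le> 2 * (real e * real H') * Y" using Y by (intro mult_right_mono) auto
        also have "\<dots> = real e * (2 * real H' * Y)" by simp
        also have "\<dots> < real e * \<theta>" using \<theta> e(1) s(3) by (intro mult_strict_left_mono) auto
        finally show ?thesis .
      qed
      ultimately show False by linarith
    qed
  qed
  moreover have "card ((\<lambda>i. i * s) ` {..<m}) = m"
    using s(3) by (subst card_image) (auto intro!: inj_onI)
  ultimately show False using m(1) by simp
qed

text \<open>The solution of mu = 324 D sqrt mu, the inequality reached in
  \<open>small_level\<close>; 324 = 4 * 9^2.\<close>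

definition K0 :: nat where
  "K0 = (324 * D)\<^sup>2"

lemma K0_pos: "K0 \<ge> 1"
  unfolding K0_def using D_pos by (simp add: Suc_le_eq)

text \<open>
  Take \<open>h H\<close> minimal.  The two reductions bound it by a constant times \<open>D (h H) powr (2 c)\<close>, hence
  by \<open>K0\<close> since \<open>c \<le> 1 / 4\<close>.
\<close>

lemma small_level:
  assumes reg: "regular c q Z t" and c: "0 < c" "c \<le> 1/4"
    and a: "a \<in> lam (q * h) (Z * H) 2" and h: "h \<ge> 1" "H \<ge> 1" and t: "t \<ge> 1"
    and m: "4 * real D * (8 * real (h * H) powr c + 1) \<le> t"
    and X: "4 * t\<^sup>2 * (real q)\<^sup>2 * real Z * real (h * H) < X"
  shows "a \<in> lam (q * fact K0) (Z * K0) 2"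
proof -
  have qZ: "q \<ge> 1" "Z \<ge> 1" using reg unfolding regular_def by auto
  define P where "P \<mu> \<longleftrightarrow> (\<exists>h H. h \<ge> 1 \<and> H \<ge> 1 \<and> h * H = \<mu> \<and> a \<in> lam (q * h) (Z * H) 2)" for \<mu>
  define \<mu> where "\<mu> = (LEAST \<mu>. P \<mu>)"
  have "P (h * H)" unfolding P_def using a h by blast
  then have P\<mu>: "P \<mu>" and \<mu>le: "\<mu> \<le> h * H" unfolding \<mu>_def by (auto intro: LeastI Least_le)
  have least: "\<mu> \<le> h' * H'" if "h' \<ge> 1" "H' \<ge> 1" "a \<in> lam (q * h') (Z * H') 2" for h' H'
    unfolding \<mu>_def by (rule Least_le) (use that in \<open>auto simp: P_def\<close>)
  obtain h0 H0 where h0: "h0 \<ge> 1" "H0 \<ge> 1" "h0 * H0 = \<mu>" "a \<in> lam (q * h0) (Z * H0) 2" using P\<mu> unfolding P_def by blast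
  have \<mu>1: "\<mu> \<ge> 1" using h0 by (metis mult_le_mono nat_mult_1)
  define m0 where "m0 = nat \<lfloor>8 * real \<mu> powr c\<rfloor> + 1"
  have pw1: "real \<mu> powr c \<ge> 1" using \<mu>1 c by (intro ge_one_powr_ge_zero) auto
  have m0: "8 * real \<mu> powr c < real m0" "real m0 \<le> 8 * real \<mu> powr c + 1"
    unfolding m0_def using pw1 by (simp_all; linarith)+
  have "real \<mu> powr c \<le> real (h * H) powr c" using \<mu>le c by (intro powr_mono2) (auto simp: \<mu>le of_nat_mono simp flip: of_nat_mult)
  then have "real m0 \<le> 8 * real (h * H) powr c + 1" using m0(2) by linarith
  then have "4 * real D * real m0 \<le> 4 * real D * (8 * real (h * H) powr c + 1)" by (intro mult_left_mono) auto
  then have Dm: "4 * real D * real m0 \<le> t" using m by linarith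
  have Dm2: "2 * real m0 \<le> t / D" 
  proof -
    have "2 * real m0 * real D \<le> 4 * real D * real m0" by simp
    then have "2 * real m0 * real D \<le> t" using Dm by linarith
    then show ?thesis using D_pos by (simp add: pos_le_divide_eq)
  qed
  have m0t: "real m0 \<le> t"
  proof -
    have "1 * real m0 \<le> 4 * real D * real m0" using D_pos by (intro mult_right_mono) auto
    then show ?thesis using Dm by linarith
  qed
  have Xl: "4 * t\<^sup>2 * (real q)\<^sup>2 * real Z * real \<mu> < X"
  proof -
    have "real \<mu> \<le> real (h * H)" using \<mu>le by (rule of_nat_mono)
    then have "4 * t\<^sup>2 * (real q)\<^sup>2 * real Z * real \<mu> \<le> 4 * t\<^sup>2 * (real q)\<^sup>2 * real Z * real (h * H)"
      by (intro mult_left_mono) auto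
    then show ?thesis using X by linarith
  qed
  have "4 * t * real (Z * H0) * (real (q * h0) * real (q * m0)) < X"
  proof -
    have "4 * t * real (Z * H0) * (real (q * h0) * real (q * m0)) = 4 * t * ((real q)\<^sup>2 * real Z * real \<mu>) * real m0"
      unfolding h0(3)[symmetric] by (simp add: power2_eq_square mult_ac)
    also have "\<dots> \<le> 4 * t * ((real q)\<^sup>2 * real Z * real \<mu>) * t" using m0t t by (intro mult_left_mono) auto
    also have "\<dots> = 4 * t\<^sup>2 * (real q)\<^sup>2 * real Z * real \<mu>" by (simp add: power2_eq_square mult_ac)
    finally show ?thesis using Xl by linarith
  qed
  from reduce_denominator[OF reg h0(4,1,2) _ Dm2 t this] m0(1)
  obtain h' where h': "1 \<le> h'" "h' < m0" "a \<in> lam (q * h') (Z * H0) 2" unfolding h0(3) by blast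
  have "h0 * H0 \<le> h' * H0" using least[OF h'(1) h0(2) h'(3)] h0(3) by simp
  then have h0m: "h0 \<le> m0" using h0(2) h'(2) by auto
  have "4 * t * real (Z * H0) * (real q * real (q * h0)) * t < X"
  proof -
    have "4 * t * real (Z * H0) * (real q * real (q * h0)) * t = 4 * t\<^sup>2 * (real q)\<^sup>2 * real Z * real \<mu>"
      unfolding h0(3)[symmetric] by (simp add: power2_eq_square mult_ac)
    then show ?thesis using Xl by linarith
  qed
  from reduce_precision[OF reg h0(4,1,2) _ Dm t this] m0(1)
  have "a \<in> lam (q * h0) (Z * (4 * D * m0)) 2" unfolding h0(3) by blast
  moreover have "4 * D * m0 \<ge> 1" unfolding m0_def using D_pos by (simp add: Suc_le_eq)
  ultimately have "h0 * H0 \<le> h0 * (4 * D * m0)" using least[of h0 "4 * D * m0"] h0 by simp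
  then have H0m: "H0 \<le> 4 * D * m0" using h0(1) by auto
  have "\<mu> \<le> m0 * (4 * D * m0)" using h0m H0m h0(3) by (metis mult_le_mono)
  then have "real \<mu> \<le> real (m0 * (4 * D * m0))" by (rule of_nat_mono)
  also have "\<dots> = 4 * real D * (real m0)\<^sup>2" by (simp add: power2_eq_square)
  also have "\<dots> \<le> 4 * real D * (9 * real \<mu> powr c)\<^sup>2"
    using m0(2) pw1 by (intro mult_left_mono power_mono) auto
  also have "\<dots> = 324 * real D * (real \<mu> powr (2 * c))"
  proof -
    have "(real \<mu> powr c)\<^sup>2 = real \<mu> powr (2 * c)" unfolding power2_eq_square mult_2 by (rule powr_add[symmetric])
    moreover have "4 * real D * (9 * y)\<^sup>2 = 324 * real D * y\<^sup>2" for y by (simp add: power2_eq_square)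
    ultimately show ?thesis by (simp only:)
  qed
  also have "real \<mu> powr (2 * c) \<le> real \<mu> powr (1/2)" using c \<mu>1 by (intro powr_mono) auto
  also have "real \<mu> powr (1/2) = sqrt (real \<mu>)" by (simp add: powr_half_sqrt)
  finally have "real \<mu> \<le> 324 * real D * sqrt (real \<mu>)" by (simp add: mult_left_mono)
  then have "sqrt (real \<mu>) * sqrt (real \<mu>) \<le> 324 * real D * sqrt (real \<mu>)" by simp
  then have "sqrt (real \<mu>) \<le> 324 * real D" by (rule mult_right_le_imp_le) (use \<mu>1 in auto)
  then have "real \<mu> \<le> (324 * real D)\<^sup>2" using power_mono[of "sqrt (real \<mu>)" "324 * real D" 2] by (simp only: real_sqrt_pow2 real_sqrt_ge_zero of_nat_0_le_iff)
  also have "\<dots> = real K0" unfolding K0_def by (simp only: of_nat_power of_nat_mult of_nat_numeral)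
  finally have "\<mu> \<le> K0" by (simp only: of_nat_le_iff)
  moreover have "h0 * 1 \<le> h0 * H0" "1 * H0 \<le> h0 * H0" using h0(1,2) by (intro mult_le_mono; simp)+
  ultimately have "h0 \<le> K0" "H0 \<le> K0" using h0(3) by linarith+
  \<comment> \<open>The factorial is a common multiple of all denominators up to \<open>K0\<close>,
    so one pair serves every a.\<close>
  then have "h0 dvd fact K0" "H0 \<le> K0" using h0(1) by (auto intro: dvd_fact)
  then have "lam (q * h0) (Z * H0) 2 \<subseteq> lam (q * fact K0) (Z * K0) 2"
    using qZ by (intro lam_mono) (auto simp: Suc_le_eq)
  then show ?thesis using h0(4) by blast
qed

text \<open>What is kept of regularity once the small levels are absorbed into (q, Z). The first
  clause disposes of frequencies with large exponential sums, the second lets a maximal separated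
  set be turned into a covering by sets of bounded scale, and the third bounds separated sets by
  packing.\<close>

definition cleared :: "real \<Rightarrow> real \<Rightarrow> nat \<Rightarrow> nat \<Rightarrow> real \<Rightarrow> bool" where
  "cleared c U q Z t \<longleftrightarrow> q \<ge> 1 \<and> Z \<ge> 1 \<and>
    (\<forall>a\<in>box 1. \<forall>h\<ge>1. \<forall>H\<ge>1. real (h * H) \<le> 2 * t \<longrightarrow> a \<in> lam (q * h) (Z * H) 1 \<longrightarrow> a \<in> lam q Z 1) \<and>
    (\<forall>a\<in>box 2. a \<in> lam q Z (2 * t) \<longrightarrow> a \<in> lam q Z 2) \<and>
    (\<forall>h\<ge>1. \<forall>H\<ge>1. real (card (lam (q * h) (Z * H) (t + t / D))) \<le> U * real (h * H) powr c * real (card (lam q Z t)))"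

text \<open>By \<open>small_level\<close> every relation of small level has denominator q K0! and
  precision Z K0. The extra factor 2 in the precision lowers the tolerance 2, and U accounts for the
  level 2 K0 K0! of the new pair relative to the old one.\<close>

lemma cleared_if_regular:
  assumes reg: "regular c q Z t" and c: "0 < c" "c \<le> 1/4" and t: "t \<ge> 1"
    and m: "4 * real D * (8 * (4 * real K0 * fact K0 * t) powr c + 1) \<le> t"
    and X: "4 * t\<^sup>2 * (real q)\<^sup>2 * real Z * (4 * real K0 * fact K0 * t) < X"
  shows "cleared c (8 * (2 * real K0 * fact K0) powr c) (q * fact K0) (2 * Z * K0) t"
proof -
  have qZ: "q \<ge> 1" "Z \<ge> 1" using reg unfolding regular_def by auto
  have lev: "a \<in> lam (q * fact K0) (Z * K0) 2"
    if "a \<in> lam (q * h) (Z * H) 2" "h \<ge> 1" "H \<ge> 1" "real (h * H) \<le> 4 * real K0 * fact K0 * t" for a h H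
  proof (rule small_level[OF reg c that(1,2,3) t])
    have "real (h * H) powr c \<le> (4 * real K0 * fact K0 * t) powr c"
      using that(4) c by (intro powr_mono2) auto
    then have "4 * real D * (8 * real (h * H) powr c + 1) \<le> 4 * real D * (8 * (4 * real K0 * fact K0 * t) powr c + 1)"
      by (intro mult_left_mono) auto
    then show "4 * real D * (8 * real (h * H) powr c + 1) \<le> t" using m by linarith
    have "4 * t\<^sup>2 * (real q)\<^sup>2 * real Z * real (h * H) \<le> 4 * t\<^sup>2 * (real q)\<^sup>2 * real Z * (4 * real K0 * fact K0 * t)"
      using that(4) by (intro mult_left_mono) auto
    then show "4 * t\<^sup>2 * (real q)\<^sup>2 * real Z * real (h * H) < X" using X by linarith
  qed
  \<comment> \<open>As j >= 1, doubling Z gains at least a factor 2, so the tolerance drops from 2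
    to 1 and hence to any r >= 1.\<close>
  have drop: "a \<in> lam (q * fact K0) (2 * Z * K0) r" if a: "a \<in> lam (q * fact K0) (Z * K0) 2" "a \<in> box r" and r: "r \<ge> 1" for a r
  proof -
    have "\<exists>b::int. \<bar>\<beta> j a - b / real (q * fact K0) ^ j\<bar> \<le> r * (real (2 * Z * K0) / X) ^ j" if j: "j \<in> {1..d}" for j
    proof -
      obtain b :: int where b: "\<bar>\<beta> j a - b / real (q * fact K0) ^ j\<bar> \<le> 2 * (real (Z * K0) / X) ^ j"
        using a j unfolding lam_def by blast
      have "2 ^ 1 \<le> (2::real) ^ j" using j by (intro power_increasing) auto
      then have "2 * (real (Z * K0) / X) ^ j \<le> 2 ^ j * (real (Z * K0) / X) ^ j"
        using X_pos by (intro mult_right_mono) auto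
      also have "\<dots> = 1 * (real (2 * Z * K0) / X) ^ j" by (simp add: power_mult_distrib power_divide)
      also have "\<dots> \<le> r * (real (2 * Z * K0) / X) ^ j" using r X_pos by (intro mult_right_mono) auto
      finally show ?thesis using b by (intro exI[of _ b]) linarith
    qed
    then show ?thesis using a(2) unfolding lam_def by auto
  qed
  show ?thesis
    unfolding cleared_def
  proof (intro conjI ballI allI impI)
    show "q * fact K0 \<ge> 1" "2 * Z * K0 \<ge> 1" using qZ K0_pos by (auto simp: Suc_le_eq)
  next
    fix a h H assume a: "a \<in> box 1" "1 \<le> h" "1 \<le> H" "real (h * H) \<le> 2 * t" "a \<in> lam (q * fact K0 * h) (2 * Z * K0 * H) 1"
    have "a \<in> lam (q * (fact K0 * h)) (Z * (2 * K0 * H)) 2"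
      using a(5) lam_mono[of "q * fact K0 * h" "q * fact K0 * h" "2 * Z * K0 * H" "2 * Z * K0 * H" 1 2] qZ a K0_pos
      by (auto simp: mult_ac Suc_le_eq)
    moreover have "real ((fact K0 * h) * (2 * K0 * H)) \<le> 4 * real K0 * fact K0 * t"
    proof -
      have "real ((fact K0 * h) * (2 * K0 * H)) = 2 * real K0 * fact K0 * real (h * H)" by (simp add: mult_ac)
      also have "\<dots> \<le> 2 * real K0 * fact K0 * (2 * t)" using a(4) by (intro mult_left_mono) auto
      finally show ?thesis by simp
    qed
    ultimately have "a \<in> lam (q * fact K0) (Z * K0) 2" using a K0_pos by (intro lev[of a "fact K0 * h" "2 * K0 * H"]) (auto simp: Suc_le_eq)
    then show "a \<in> lam (q * fact K0) (2 * Z * K0) 1" using a(1) by (intro drop) auto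
  next
    fix a assume a: "a \<in> box 2" "a \<in> lam (q * fact K0) (2 * Z * K0) (2 * t)"
    \<comment> \<open>The tolerance 2 t is traded for precision: t <= T^j, so an error of 2 t
      (Z/X)^j is at most 2 (Z T/X)^j.\<close>
    define T where "T = nat \<lceil>t\<rceil>"
    have T: "t \<le> real T" "real T \<le> 2 * t" "T \<ge> 1" unfolding T_def using t by (auto simp: le_nat_iff; linarith)+
    have "a \<in> lam (q * fact K0) (Z * (2 * K0 * T)) 2"
    proof -
      have "\<exists>b::int. \<bar>\<beta> j a - b / real (q * fact K0) ^ j\<bar> \<le> 2 * (real (Z * (2 * K0 * T)) / X) ^ j" if j: "j \<in> {1..d}" for j
      proof -
        obtain b :: int where b: "\<bar>\<beta> j a - b / real (q * fact K0) ^ j\<bar> \<le> 2 * t * (real (2 * Z * K0) / X) ^ j"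
          using a(2) j unfolding lam_def by blast
        have "t \<le> real T ^ 1" using T by simp
        also have "\<dots> \<le> real T ^ j" using T j by (intro power_increasing) auto
        finally have "2 * t * (real (2 * Z * K0) / X) ^ j \<le> 2 * real T ^ j * (real (2 * Z * K0) / X) ^ j"
          using X_pos by (intro mult_right_mono) auto
        also have "\<dots> = 2 * (real (Z * (2 * K0 * T)) / X) ^ j" by (simp add: power_mult_distrib power_divide)
        finally show ?thesis using b by (intro exI[of _ b]) linarith
      qed
      then show ?thesis using a(1) unfolding lam_def by auto
    qed
    moreover have "real (fact K0 * (2 * K0 * T)) \<le> 4 * real K0 * fact K0 * t"
    proof -
      have "real (fact K0 * (2 * K0 * T)) = 2 * real K0 * fact K0 * real T" by (simp add: mult_ac)
      also have "\<dots> \<le> 2 * real K0 * fact K0 * (2 * t)" using T(2) by (intro mult_left_mono) auto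
      finally show ?thesis by simp
    qed
    ultimately have "a \<in> lam (q * fact K0) (Z * K0) 2" using T K0_pos by (intro lev[of a "fact K0" "2 * K0 * T"]) (auto simp: Suc_le_eq)
    then show "a \<in> lam (q * fact K0) (2 * Z * K0) 2" using a(1) by (intro drop) auto
  next
    fix h H :: nat assume h: "1 \<le> h" "1 \<le> H"
    have bound: "\<And>h H. h \<ge> 1 \<Longrightarrow> H \<ge> 1 \<Longrightarrow>
        real (card (lam (q * h) (Z * H) (t + t / D))) \<le> 8 * real (h * H) powr c * real (card (lam q Z t))"
      using reg unfolding regular_def by blast
    have "real (card (lam (q * (fact K0 * h)) (Z * (2 * K0 * H)) (t + t / D)))
        \<le> 8 * real ((fact K0 * h) * (2 * K0 * H)) powr c * real (card (lam q Z t))"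
      using h K0_pos by (intro bound) (auto simp: Suc_le_eq)
    also have "real ((fact K0 * h) * (2 * K0 * H)) powr c = (2 * real K0 * fact K0) powr c * real (h * H) powr c"
      by (simp add: powr_mult[symmetric] mult_ac)
    also have "8 * ((2 * real K0 * fact K0) powr c * real (h * H) powr c) * real (card (lam q Z t))
       \<le> 8 * ((2 * real K0 * fact K0) powr c * real (h * H) powr c) * real (card (lam (q * fact K0) (2 * Z * K0) t))"
    proof (intro mult_left_mono of_nat_mono card_mono finite_lam lam_mono)
      show "Z \<le> 2 * Z * K0" using K0_pos by (simp add: Suc_le_eq)
    qed (use qZ t in \<open>auto simp: Suc_le_eq\<close>)
    finally show "real (card (lam (q * fact K0 * h) (2 * Z * K0 * H) (t + t / D)))
       \<le> 8 * (2 * real K0 * fact K0) powr c * real (h * H) powr c * real (card (lam (q * fact K0) (2 * Z * K0) t))"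
      by (simp add: mult_ac)
  qed
qed

end

section \<open>Counting frequencies of a given level\<close>

text \<open>Take g <= Q maximising the number of m with g dividing \<open>v m\<close>, times g^eta,
  and compare with 1 and with g w. If g w > Q, no \<open>v m\<close> is divisible by it.\<close>

lemma popular_divisor:
  fixes v :: "'b \<Rightarrow> nat"
  assumes M: "finite M" and v: "\<And>m. m \<in> M \<Longrightarrow> 1 \<le> v m \<and> v m \<le> Q" and Q: "Q \<ge> 1" and \<eta>: "\<eta> \<ge> 0"
  shows "\<exists>g. 1 \<le> g \<and> g \<le> Q \<and> real (card M) \<le> real (card {m\<in>M. g dvd v m}) * real Q powr \<eta> \<and>
    (\<forall>w\<ge>1. real (card {m\<in>M. g * w dvd v m}) * real w powr \<eta> \<le> real (card {m\<in>M. g dvd v m}))"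
proof -
  define f where "f g = real (card {m\<in>M. g dvd v m}) * real g powr \<eta>" for g
  have "finite (f ` {1..Q})" "f ` {1..Q} \<noteq> {}" using Q by auto
  from Max_in[OF this] obtain g where g: "g \<in> {1..Q}" "Max (f ` {1..Q}) = f g" by auto
  have gmax: "f g' \<le> f g" if "g' \<in> {1..Q}" for g' unfolding g(2)[symmetric] using that by (intro Max_ge) auto
  have g1: "1 \<le> g" "g \<le> Q" using g by auto
  have "real (card M) = f 1" unfolding f_def by simp
  also have "\<dots> \<le> f g" using Q by (intro gmax) auto
  also have "\<dots> \<le> real (card {m\<in>M. g dvd v m}) * real Q powr \<eta>"
    unfolding f_def using g1 \<eta> by (intro mult_left_mono powr_mono2) auto
  finally have 1: "real (card M) \<le> real (card {m\<in>M. g dvd v m}) * real Q powr \<eta>" .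
  have 2: "real (card {m\<in>M. g * w dvd v m}) * real w powr \<eta> \<le> real (card {m\<in>M. g dvd v m})" if w: "w \<ge> 1" for w
  proof (cases "g * w \<le> Q")
    case True
    have "f (g * w) \<le> f g" using True g1 w by (intro gmax) (auto simp: Suc_le_eq)
    have "real g powr \<eta> * (real (card {m\<in>M. g * w dvd v m}) * real w powr \<eta>) \<le> real g powr \<eta> * real (card {m\<in>M. g dvd v m})"
    proof -
      have "real (g * w) powr \<eta> = real g powr \<eta> * real w powr \<eta>" by (simp add: powr_mult)
      then have "f (g * w) = real g powr \<eta> * (real (card {m\<in>M. g * w dvd v m}) * real w powr \<eta>)"
        unfolding f_def by simp
      moreover have "f g = real g powr \<eta> * real (card {m\<in>M. g dvd v m})" unfolding f_def by simp
      ultimately show ?thesis using \<open>f (g * w) \<le> f g\<close> by linarith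
    qed
    then show ?thesis using g1 by simp
  next
    case False
    have "\<not> g * w dvd v m" if "m \<in> M" for m
      using dvd_imp_le[of "g * w" "v m"] v[OF that] False by linarith
    then have "{m\<in>M. g * w dvd v m} = {}" by blast
    then show ?thesis by (simp only: card.empty)
  qed
  show ?thesis using g1 1 2 by blast
qed

text \<open>Lists grow at the front. Each of fewer than s entries excludes at most |M| / (2 s)
  candidates, so at least half of M remains.\<close>

lemma card_sorted_wrt_lists_ge:
  assumes M: "finite M" and bad: "\<And>m. m \<in> M \<Longrightarrow> 2 * real s * real (card {x\<in>M. \<not> P x m}) \<le> real (card M)" and n: "n \<le> s"
  shows "(real (card M) / 2) ^ n \<le> real (card {xs. length xs = n \<and> set xs \<subseteq> M \<and> sorted_wrt P xs})"
  using n
proof (induction n)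
  case 0
  have "{xs. length xs = 0 \<and> set xs \<subseteq> M \<and> sorted_wrt P xs} = {[]}" by auto
  then show ?case by simp
next
  case (Suc n)
  define T where "T n = {xs. length xs = n \<and> set xs \<subseteq> M \<and> sorted_wrt P xs}" for n
  define G where "G xs = {x\<in>M. \<forall>y\<in>set xs. P x y}" for xs
  have finT: "finite (T n)" for n
    by (rule finite_subset[OF _ finite_lists_length_eq[OF M, of n]]) (auto simp: T_def)
  have finG: "finite (G xs)" for xs unfolding G_def using M by simp
  have G: "real (card (G xs)) \<ge> real (card M) / 2" if xs: "xs \<in> T n" for xs
  proof -
    have "M - G xs = (\<Union>y\<in>set xs. {x\<in>M. \<not> P x y})" unfolding G_def by auto
    then have "card (M - G xs) \<le> (\<Sum>y\<in>set xs. card {x\<in>M. \<not> P x y})"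
      using card_UN_le[of "set xs" "\<lambda>y. {x\<in>M. \<not> P x y}"] by simp
    then have "real (card (M - G xs)) \<le> (\<Sum>y\<in>set xs. real (card {x\<in>M. \<not> P x y}))"
      by (metis of_nat_mono of_nat_sum)
    then have "2 * real s * real (card (M - G xs)) \<le> 2 * real s * (\<Sum>y\<in>set xs. real (card {x\<in>M. \<not> P x y}))"
      by (rule mult_left_mono) simp
    also have "\<dots> = (\<Sum>y\<in>set xs. 2 * real s * real (card {x\<in>M. \<not> P x y}))" by (rule sum_distrib_left)
    also have "\<dots> \<le> (\<Sum>y\<in>set xs. real (card M))"
      using xs by (intro sum_mono bad) (auto simp: T_def)
    also have "\<dots> = real (card (set xs)) * real (card M)" by simp
    also have "\<dots> \<le> real s * real (card M)"
    proof (intro mult_right_mono of_nat_mono)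
      have "card (set xs) \<le> length xs" by (rule card_length)
      then show "card (set xs) \<le> s" using xs Suc.prems unfolding T_def by auto
    qed simp
    finally have "2 * real (card (M - G xs)) \<le> real (card M)" using Suc.prems by simp
    moreover have "card (M - G xs) = card M - card (G xs)" "card (G xs) \<le> card M"
      using finG M by (auto intro!: card_Diff_subset card_mono simp: G_def)
    ultimately show ?thesis by (simp add: of_nat_diff)
  qed
  have "(real (card M) / 2) ^ Suc n = (real (card M) / 2) ^ n * (real (card M) / 2)" by simp
  also have "\<dots> \<le> real (card (T n)) * (real (card M) / 2)"
    using Suc unfolding T_def by (intro mult_right_mono) auto
  also have "\<dots> = (\<Sum>xs\<in>T n. real (card M) / 2)" by simp
  also have "\<dots> \<le> (\<Sum>xs\<in>T n. real (card (G xs)))" by (intro sum_mono G)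
  also have "\<dots> = real (card (SIGMA xs:T n. G xs))" using finT finG by (simp add: card_SigmaI)
  also have "\<dots> = real (card ((\<lambda>(xs, x). x # xs) ` (SIGMA xs:T n. G xs)))"
    by (subst card_image) (auto intro: inj_onI)
  also have "\<dots> \<le> real (card (T (Suc n)))"
    by (intro of_nat_mono card_mono finT) (auto simp: T_def G_def)
  finally show ?case unfolding T_def .
qed

lemma card_lists_nth_le:
  assumes "\<And>i. i < n \<Longrightarrow> finite (N i) \<and> real (card (N i)) \<le> B" "B \<ge> 0"
  shows "finite {xs. length xs = n \<and> (\<forall>i<n. xs ! i \<in> N i)} \<and> real (card {xs. length xs = n \<and> (\<forall>i<n. xs ! i \<in> N i)}) \<le> B ^ n"
  using assms(1)
proof (induction n arbitrary: N)
  case 0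
  have "{xs. length xs = 0 \<and> (\<forall>i<0. xs ! i \<in> N i)} = {[]}" by auto
  then show ?case by simp
next
  case (Suc n)
  define T where "T = {xs. length xs = n \<and> (\<forall>i<n. xs ! i \<in> N (Suc i))}"
  have T: "finite T \<and> real (card T) \<le> B ^ n" unfolding T_def by (rule Suc.IH) (use Suc.prems in auto)
  have eq: "{xs. length xs = Suc n \<and> (\<forall>i<Suc n. xs ! i \<in> N i)} = (\<lambda>(x, xs). x # xs) ` (N 0 \<times> T)"
  proof
    show "{xs. length xs = Suc n \<and> (\<forall>i<Suc n. xs ! i \<in> N i)} \<subseteq> (\<lambda>(x, xs). x # xs) ` (N 0 \<times> T)"
    proof clarify
      fix xs assume xs: "length xs = Suc n" "\<forall>i<Suc n. xs ! i \<in> N i"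
      then obtain y ys where "xs = y # ys" by (cases xs) auto
      then show "xs \<in> (\<lambda>(x, xs). x # xs) ` (N 0 \<times> T)" using xs unfolding T_def by force
    qed
  qed (auto simp: T_def nth_Cons split: nat.splits)
  have "real (card ((\<lambda>(x, xs). x # xs) ` (N 0 \<times> T))) \<le> real (card (N 0 \<times> T))"
    using T Suc.prems[of 0] by (intro of_nat_mono card_image_le) auto
  also have "\<dots> = real (card (N 0)) * real (card T)" by (simp add: card_cartesian_product)
  also have "\<dots> \<le> B * B ^ n" using T Suc.prems[of 0] assms(2) by (intro mult_mono) auto
  finally show ?case unfolding eq using T Suc.prems[of 0] by auto
qed

lemma gcd_mult_dvd_mult_gcd: "gcd (x::nat) (a * b) dvd gcd x a * gcd x b"
proof -
  have "gcd x (a * b) dvd gcd x a * b"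
    by (metis dvd_mult2 gcd_dvd1 gcd_dvd2 gcd_greatest gcd_mult_distrib_nat mult.commute)
  moreover have "gcd x (a * b) dvd gcd x a * x" by simp
  ultimately show ?thesis by (simp add: gcd_mult_distrib_nat)
qed

lemma gcd_prod_le:
  fixes w :: "'b \<Rightarrow> nat"
  assumes "finite A" "\<And>l. l \<in> A \<Longrightarrow> gcd x (w l) \<le> E" "x \<ge> 1"
  shows "gcd x (\<Prod>l\<in>A. w l) \<le> E ^ card A"
  using assms
proof (induction A rule: finite_induct)
  case (insert a A)
  have "gcd x (w a * (\<Prod>l\<in>A. w l)) \<le> gcd x (w a) * gcd x (\<Prod>l\<in>A. w l)"
    using insert.prems by (intro dvd_imp_le gcd_mult_dvd_mult_gcd) (auto simp: Suc_le_eq)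
  also have "\<dots> \<le> E * E ^ card A" using insert by (intro mult_mono) auto
  finally show ?case using insert by simp
qed simp

lemma card_dvd_multiples_le:
  fixes L Y :: nat and T :: real
  assumes "\<And>n. 1 \<le> n \<Longrightarrow> n \<le> L * Y \<Longrightarrow> real (divisor_count n) \<le> T" "L \<ge> 1"
  shows "finite {w. \<exists>y. 1 \<le> y \<and> y \<le> Y \<and> w dvd L * y} \<and> real (card {w. \<exists>y. 1 \<le> y \<and> y \<le> Y \<and> w dvd L * y}) \<le> real Y * T"
proof -
  have eq: "{w. \<exists>y. 1 \<le> y \<and> y \<le> Y \<and> w dvd L * y} = (\<Union>y\<in>{1..Y}. {w. w dvd L * y})" by auto
  have "card (\<Union>y\<in>{1..Y}. {w. w dvd L * y}) \<le> (\<Sum>y\<in>{1..Y}. divisor_count (L * y))"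
    unfolding divisor_count_def by (intro card_UN_le) auto
  then have "real (card (\<Union>y\<in>{1..Y}. {w. w dvd L * y})) \<le> (\<Sum>y\<in>{1..Y}. real (divisor_count (L * y)))"
    by (metis of_nat_mono of_nat_sum)
  also have "\<dots> \<le> (\<Sum>y\<in>{1..Y}. T)" using assms by (intro sum_mono assms(1)) (auto simp: Suc_le_eq)
  finally have "real (card (\<Union>y\<in>{1..Y}. {w. w dvd L * y})) \<le> real Y * T" by simp
  moreover have "finite (\<Union>y\<in>{1..Y}. {w. w dvd L * y})" using assms(2) by (auto intro!: finite_divisors_nat)
  ultimately show ?thesis unfolding eq by blast
qed

lemma card_le_fibres_real:
  assumes "finite A" "finite B" "f ` A \<subseteq> B" "\<And>b. b \<in> B \<Longrightarrow> real (card {a\<in>A. f a = b}) \<le> M"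
  shows "real (card A) \<le> real (card B) * M"
proof -
  have "real (card A) = (\<Sum>b\<in>B. real (card {a\<in>A. f a = b}))"
    using sum.group[OF assms(1,2,3), of "\<lambda>_. 1::real"] by simp
  also have "\<dots> \<le> (\<Sum>b\<in>B. M)" using assms(4) by (intro sum_mono)
  finally show ?thesis by simp
qed

section \<open>Orders of frequencies, separated sets, and sums of tuples\<close>

context diophantine_forms
begin

lemma lam_sum:
  assumes "finite A" "\<And>l. l \<in> A \<Longrightarrow> f l \<in> lam q Z r"
  shows "(\<Sum>l\<in>A. f l) \<in> lam q Z (real (card A) * r)"
  using assms
proof (induction A rule: finite_induct)
  case (insert a A)
  then have "f a + (\<Sum>l\<in>A. f l) \<in> lam q Z (r + real (card A) * r)" by (intro lam_add) auto
  then show ?case using insert by (simp add: algebra_simps)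
qed (simp add: zero_lam)

definition level_set :: "nat \<Rightarrow> nat \<Rightarrow> nat \<Rightarrow> 'g set" where
  "level_set q Z Q = {a\<in>box 1. \<exists>h\<ge>1. h \<le> Q \<and> a \<in> lam (q * h) (Z * Q) 1}"

text \<open>The reduced denominator of a relative to q. For large X it behaves like the order of a
  group element, see \<open>ord_dvd\<close>.\<close>

definition ord :: "nat \<Rightarrow> nat \<Rightarrow> 'g \<Rightarrow> nat" where
  "ord q Z a = (LEAST h. h \<ge> 1 \<and> a \<in> lam (q * h) Z 1)"

lemma ord_level_set:
  assumes "a \<in> level_set q Z Q"
  shows "1 \<le> ord q (Z * Q) a" "ord q (Z * Q) a \<le> Q" "a \<in> lam (q * ord q (Z * Q) a) (Z * Q) 1"
proof -
  obtain h where h: "h \<ge> 1" "h \<le> Q" "a \<in> lam (q * h) (Z * Q) 1" using assms unfolding level_set_def by auto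
  have "1 \<le> ord q (Z * Q) a \<and> a \<in> lam (q * ord q (Z * Q) a) (Z * Q) 1"
    unfolding ord_def by (rule LeastI[of _ h]) (use h in auto)
  then show "1 \<le> ord q (Z * Q) a" "a \<in> lam (q * ord q (Z * Q) a) (Z * Q) 1" by auto
  have "ord q (Z * Q) a \<le> h" unfolding ord_def by (rule Least_le) (use h in auto)
  then show "ord q (Z * Q) a \<le> Q" using h by linarith
qed

text \<open>By \<open>lam_gcd\<close> the gcd of the order and w is again admissible, and minimality
  makes it equal to the order.\<close>

lemma ord_dvd:
  assumes a: "a \<in> level_set q Z Q" and w: "a \<in> lam (q * w) (Z * Q) r" "w \<ge> 1" and r: "r \<ge> 1" and q: "q \<ge> 1"
    and X: "r * real (Z * Q) * real (q * Q * (q * w)) < X / 2"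
  shows "ord q (Z * Q) a dvd w"
proof -
  define v where "v = ord q (Z * Q) a"
  note v = ord_level_set[OF a, folded v_def]
  have "real (q * v * (q * w)) \<le> real (q * Q * (q * w))" using v(2) by (intro of_nat_mono mult_right_mono mult_left_mono) auto
  then have "r * real (Z * Q) * real (q * v * (q * w)) \<le> r * real (Z * Q) * real (q * Q * (q * w))"
    using r by (intro mult_left_mono) auto
  then have X2: "r * real (Z * Q) * real (q * v * (q * w)) < X / 2" using X by linarith
  have "1 * (real (Z * Q) * real (q * v * (q * w))) \<le> r * (real (Z * Q) * real (q * v * (q * w)))"
    using r by (intro mult_right_mono) auto
  then have X1: "1 * real (Z * Q) * real (q * v * (q * w)) < X / 2" using X2 by (simp add: mult.assoc)
  have "a \<in> lam (gcd (q * v) (q * w)) (Z * Q) 1"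
    by (rule lam_gcd[OF v(3) w(1) _ _ _ r X1 X2]) (use q v w in \<open>auto simp: Suc_le_eq\<close>)
  then have "a \<in> lam (q * gcd v w) (Z * Q) 1" by (simp add: gcd_mult_distrib_nat)
  moreover have "gcd v w \<ge> 1" using w(2) by (simp add: Suc_le_eq)
  ultimately have "v \<le> gcd v w" unfolding v_def ord_def[of q "Z * Q" a] by (intro Least_le) auto
  moreover have "gcd v w \<le> v" using v(1) by (intro dvd_imp_le) auto
  ultimately have "gcd v w = v" by linarith
  then show ?thesis unfolding v_def[symmetric] by (metis gcd_dvd2)
qed

definition separated :: "nat \<Rightarrow> nat \<Rightarrow> real \<Rightarrow> 'g set \<Rightarrow> bool" where
  "separated q Z t M \<longleftrightarrow> (\<forall>m\<in>M. \<forall>m'\<in>M. m \<noteq> m' \<longrightarrow> m - m' \<notin> lam q Z (2 * t))"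

text \<open>For a maximal separated M, every element of A differs from some m by an element of
  \<open>lam q Z (2 * t)\<close>. The difference lies in \<open>box 2\<close>, so
  \<open>cleared\<close> improves this to \<open>lam q Z 2\<close>, a set whose scale does not
  involve t.\<close>

lemma exists_separated_subset:
  assumes cl: "cleared c U q Z t" and A: "A \<subseteq> box 1"
  shows "\<exists>M\<subseteq>A. separated q Z t M \<and> card A \<le> card M * card (lam q Z 2)"
proof -
  have finA: "finite A" using A finite_box finite_subset by blast
  define F where "F = {M. M \<subseteq> A \<and> separated q Z t M}"
  have "finite F" unfolding F_def using finA by simp
  moreover have "{} \<in> F" unfolding F_def separated_def by simp
  ultimately obtain M where M: "M \<in> F" "\<And>M'. M' \<in> F \<Longrightarrow> M \<subseteq> M' \<Longrightarrow> M = M'"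
    using finite_has_maximal[of F] by blast
  have finM: "finite M" using M(1) finA finite_subset unfolding F_def by blast
  have cov: "\<exists>m\<in>M. a - m \<in> lam q Z 2" if a: "a \<in> A" for a
  proof (cases "a \<in> M")
    case True
    then show ?thesis using zero_lam[of 2 q Z] by (intro bexI[of _ a]) auto
  next
    case False
    then have "insert a M \<notin> F" using M(2)[of "insert a M"] by auto
    then have "\<not> separated q Z t (insert a M)" using a M(1) unfolding F_def by auto
    moreover have "separated q Z t M" using M(1) unfolding F_def by auto
    ultimately obtain m where m: "m \<in> M" "a - m \<in> lam q Z (2 * t)"
      unfolding separated_def using lam_minus_commute by blast
    have "a - m \<in> box (1 + 1)" using a m(1) A M(1) unfolding F_def by (intro box_diff) auto
    then have "a - m \<in> lam q Z 2" using cl m(2) unfolding cleared_def by auto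
    then show ?thesis using m(1) by blast
  qed
  have "A \<subseteq> (\<Union>m\<in>M. (\<lambda>x. m + x) ` lam q Z 2)"
  proof
    fix a assume "a \<in> A"
    then obtain m where "m \<in> M" "a - m \<in> lam q Z 2" using cov by blast
    then show "a \<in> (\<Union>m\<in>M. (\<lambda>x. m + x) ` lam q Z 2)" by (intro UN_I[of m] image_eqI[of _ _ "a - m"]) auto
  qed
  then have "card A \<le> card (\<Union>m\<in>M. (\<lambda>x. m + x) ` lam q Z 2)"
    using finM finite_lam by (intro card_mono) auto
  also have "\<dots> \<le> (\<Sum>m\<in>M. card ((\<lambda>x. m + x) ` lam q Z 2))" by (rule card_UN_le[OF finM])
  also have "\<dots> \<le> (\<Sum>m\<in>M. card (lam q Z 2))" by (intro sum_mono card_image_le finite_lam)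
  finally show ?thesis using M(1) unfolding F_def by auto
qed

text \<open>Shift N by one of its elements: the translates of \<open>lam q Z t\<close> by the result
  are disjoint and lie in a set whose size \<open>cleared\<close> controls.\<close>

lemma separated_card_le:
  assumes cl: "cleared c U q Z t" and t: "t \<ge> 0" and U: "U \<ge> 0" and N: "finite N" "separated q Z t N"
    and diff: "\<And>m m'. m \<in> N \<Longrightarrow> m' \<in> N \<Longrightarrow> m - m' \<in> lam (q * v) (Z * Q) r"
    and r: "0 \<le> r" "r \<le> t / D" and v: "v \<ge> 1" "Q \<ge> 1"
  shows "real (card N) \<le> U * real (v * Q) powr c"
proof (cases "N = {}")
  case True
  then show ?thesis using U by simp
next
  case False
  then obtain m0 where m0: "m0 \<in> N" by blast
  have qZ: "q \<ge> 1" "Z \<ge> 1" using cl unfolding cleared_def by auto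
  have "card N * card (lam q Z t) = card ((\<lambda>m. m - m0) ` N) * card (lam q Z t)"
    by (subst card_image) (auto intro: inj_onI)
  also have "\<dots> \<le> card (lam (q * v) (Z * Q) (t + t / D))"
  proof (rule translates_card_le)
    show "finite ((\<lambda>m. m - m0) ` N)" using N by simp
    show "finite (lam (q * v) (Z * Q) (t + t / D))" by (rule finite_lam)
    show "p + x \<in> lam (q * v) (Z * Q) (t + t / D)" if "p \<in> (\<lambda>m. m - m0) ` N" "x \<in> lam q Z t" for p x
    proof -
      have "p \<in> lam (q * v) (Z * Q) r" using that(1) diff m0 by auto
      moreover have "x \<in> lam (q * v) (Z * Q) t"
        using that(2) lam_mono[of q "q * v" Z "Z * Q" t t] qZ v t by (auto simp: Suc_le_eq)
      ultimately have "p + x \<in> lam (q * v) (Z * Q) (r + t)" by (rule lam_add)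
      then show ?thesis using lam_mono[of "q * v" "q * v" "Z * Q" "Z * Q" "r + t" "t + t / D"] qZ v t r
        by (auto simp: Suc_le_eq)
    qed
    show "p - p' \<notin> lam q Z (2 * t)" if "p \<in> (\<lambda>m. m - m0) ` N" "p' \<in> (\<lambda>m. m - m0) ` N" "p \<noteq> p'" for p p'
      using that N(2) unfolding separated_def by auto
  qed
  finally have "real (card N) * real (card (lam q Z t)) \<le> real (card (lam (q * v) (Z * Q) (t + t / D)))"
    by (metis of_nat_le_iff of_nat_mult)
  also have "\<dots> \<le> U * real (v * Q) powr c * real (card (lam q Z t))"
    using cl v unfolding cleared_def by blast
  finally show ?thesis using card_lam_pos[OF t, of q Z] by simp
qed

lemma box_sum_list: "set xs \<subseteq> box 1 \<Longrightarrow> sum_list xs \<in> box (real (length xs))"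
proof (induction xs)
  case Nil
  then show ?case using zero_S by (simp add: box_def)
next
  case (Cons x xs)
  then have "x + sum_list xs \<in> box (1 + real (length xs))" by (intro box_add) auto
  then show ?case by (simp add: add.commute)
qed

lemma sum_list_split: "i < length xs \<Longrightarrow> sum_list xs = xs ! i + (\<Sum>l\<in>{..<length xs} - {i}. xs ! l)"
  by (simp add: sum_list_sum_nth atLeast0LessThan sum.remove[of "{..<length xs}" i])

lemma prod_le_pow:
  fixes w :: "'b \<Rightarrow> nat"
  assumes "finite A" "\<And>l. l \<in> A \<Longrightarrow> w l \<le> Q" "card A \<le> s" "Q \<ge> 1"
  shows "(\<Prod>l\<in>A. w l) \<le> Q ^ s"
proof -
  have "(\<Prod>l\<in>A. w l) \<le> (\<Prod>l\<in>A. Q)" by (intro prod_mono) (use assms in auto)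
  also have "\<dots> = Q ^ card A" by simp
  also have "\<dots> \<le> Q ^ s" using assms by (intro power_increasing) auto
  finally show ?thesis .
qed

text \<open>
  The level set contains a large subset whose elements have orders sharing a popular common
  divisor \<open>g\<close>, such that the orders of most pairs have gcd at most \<open>g E\<close>.  For a tuple of such
  elements the order of its sum nearly determines, by the divisor bound, the order of each entry, and
  then separation bounds the number of entries.  So the sums of \<open>s\<close>-tuples fill a large part of
  \<open>box s\<close>.
\<close>

lemma tuples_bound:
  assumes cl: "cleared c U q Z t" and t: "t \<ge> 1" "4 \<le> t / D" and U: "U > 0" and c: "c > 0"
    and Q: "Q \<ge> 1" and s: "s \<ge> 1" and E: "E \<ge> 1" and \<eta>: "\<eta> \<ge> 0"
    and T: "\<And>n. 1 \<le> n \<Longrightarrow> n \<le> Q ^ s * E ^ s \<Longrightarrow> real (divisor_count n) \<le> T"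
    and TE: "2 * real s * T \<le> real E powr \<eta>"
    and big: "B0 * real (card (lam q Z 1)) \<le> real (card (level_set q Z Q))" and B0: "B0 \<ge> 0"
    and X: "2 * real s * real (Z * Q) * real (q * Q * (q * (Q * (Q ^ s * Q ^ s)))) < X / 2"
  shows "(B0 / (6 ^ D * real Q powr \<eta>) / (2 * (real (E ^ s) * T * (U * real (Q * Q) powr c)))) ^ s \<le> real (card (box s))"
proof -
  have qZ: "q \<ge> 1" "Z \<ge> 1" using cl unfolding cleared_def by auto
  have T1: "T \<ge> 1" using T[of 1] Q E by (simp add: divisor_count_def)
  have lsub: "level_set q Z Q \<subseteq> box 1" unfolding level_set_def by auto
  from exists_separated_subset[OF cl lsub]
  obtain M where M: "M \<subseteq> level_set q Z Q" "separated q Z t M" "card (level_set q Z Q) \<le> card M * card (lam q Z 2)"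
    by (elim exE conjE)
  have finM: "finite M" by (rule finite_subset[OF subset_trans[OF M(1) lsub] finite_box])
  have cardM: "B0 \<le> 6 ^ D * real (card M)"
  proof -
    have "real (card (lam q Z (2 * 1))) \<le> (2 * 2 + 2) ^ D * real (card (lam q Z 1))"
      using qZ by (intro card_lam_scale_le) auto
    then have l2: "real (card (lam q Z 2)) \<le> 6 ^ D * real (card (lam q Z 1))" by simp
    have "B0 * real (card (lam q Z 1)) \<le> real (card M * card (lam q Z 2))" using big M(3) by linarith
    also have "\<dots> \<le> real (card M) * (6 ^ D * real (card (lam q Z 1)))"
      using l2 unfolding of_nat_mult by (intro mult_left_mono) auto
    finally have "B0 * real (card (lam q Z 1)) \<le> (6 ^ D * real (card M)) * real (card (lam q Z 1))" by (simp add: mult_ac)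
    then show ?thesis using card_lam_pos[of 1 q Z] by simp
  qed
  define v where "v m = ord q (Z * Q) m" for m
  have v: "1 \<le> v m" "v m \<le> Q" "m \<in> lam (q * v m) (Z * Q) 1" if "m \<in> M" for m
    using ord_level_set[of m q Z Q] that M(1) unfolding v_def by auto
  obtain g where g: "1 \<le> g" "g \<le> Q" "real (card M) \<le> real (card {m\<in>M. g dvd v m}) * real Q powr \<eta>"
      "\<And>w. w \<ge> 1 \<Longrightarrow> real (card {m\<in>M. g * w dvd v m}) * real w powr \<eta> \<le> real (card {m\<in>M. g dvd v m})"
    using popular_divisor[OF finM, of v Q \<eta>] v Q \<eta> by blast
  define G where "G = {m\<in>M. g dvd v m}"
  have finG: "finite G" and GM: "G \<subseteq> M" unfolding G_def using finM by auto
  define w where "w m = v m div g" for m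
  have vw: "v m = g * w m" if "m \<in> G" for m using that unfolding G_def w_def by auto
  have w1: "1 \<le> w m" "w m \<le> Q" if "m \<in> G" for m
  proof -
    have "v m \<ge> 1" "v m \<le> Q" using v that GM by auto
    then show "1 \<le> w m" using vw[OF that] by (cases "w m") auto
    have "1 * w m \<le> g * w m" using g(1) by (intro mult_le_mono) auto
    then show "w m \<le> Q" using \<open>v m \<le> Q\<close> vw[OF that] by linarith
  qed
  define good where "good m m' \<longleftrightarrow> gcd (v m) (v m') \<le> g * E" for m m'
  \<comment> \<open>A partner x whose gcd with m exceeds g E shares with m a factor g u, where u >=
    E divides \<open>v m\<close>. There are at most T such u, and by the choice of g each accounts
    for a proportion of at most E^-eta of G.\<close>
  have bad: "2 * real s * real (card {x\<in>G. \<not> good x m}) \<le> real (card G)" if m: "m \<in> G" for m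
  proof -
    define W where "W = {u. u dvd v m \<and> E \<le> u}"
    have vm: "1 \<le> v m" "v m \<le> Q" using v m GM by auto
    have finW: "finite W" unfolding W_def using vm by (auto intro: finite_subset[OF _ finite_divisors_nat[of "v m"]])
    have "{x\<in>G. \<not> good x m} \<subseteq> (\<Union>u\<in>W. {x\<in>M. g * u dvd v x})"
    proof
      fix x assume x: "x \<in> {x\<in>G. \<not> good x m}"
      then have xG: "x \<in> G" "gcd (v x) (v m) > g * E" unfolding good_def by auto
      define u where "u = gcd (w x) (w m)"
      have gu: "gcd (v x) (v m) = g * u" unfolding u_def vw[OF xG(1)] vw[OF m] by (simp add: gcd_mult_distrib_nat)
      have "E \<le> u" using xG(2) unfolding gu by simp
      moreover have "u dvd v m" using vw[OF m] unfolding u_def by (simp add: dvd_mult)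
      moreover have "g * u dvd v x" using gu by (metis gcd_dvd1)
      ultimately show "x \<in> (\<Union>u\<in>W. {x\<in>M. g * u dvd v x})" using xG GM unfolding W_def by auto
    qed
    then have "card {x\<in>G. \<not> good x m} \<le> card (\<Union>u\<in>W. {x\<in>M. g * u dvd v x})"
      using finW finM by (intro card_mono finite_UN_I) simp_all
    also have "\<dots> \<le> (\<Sum>u\<in>W. card {x\<in>M. g * u dvd v x})" by (rule card_UN_le[OF finW])
    finally have "real (card {x\<in>G. \<not> good x m}) \<le> (\<Sum>u\<in>W. real (card {x\<in>M. g * u dvd v x}))"
      unfolding of_nat_sum[symmetric] by (rule of_nat_mono)
    also have "\<dots> \<le> (\<Sum>u\<in>W. real (card G) / real E powr \<eta>)"
    proof (rule sum_mono)
      fix u assume u: "u \<in> W"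
      then have u1: "u \<ge> 1" "E \<le> u" using E unfolding W_def by auto
      have "real (card {x\<in>M. g * u dvd v x}) * real E powr \<eta> \<le> real (card {x\<in>M. g * u dvd v x}) * real u powr \<eta>"
        using u1 \<eta> by (intro mult_left_mono powr_mono2) auto
      also have "\<dots> \<le> real (card G)" using g(4)[OF u1(1)] unfolding G_def .
      finally show "real (card {x\<in>M. g * u dvd v x}) \<le> real (card G) / real E powr \<eta>"
        using E by (simp add: pos_le_divide_eq)
    qed
    also have "\<dots> = real (card W) * (real (card G) / real E powr \<eta>)" by simp
    also have "\<dots> \<le> T * (real (card G) / real E powr \<eta>)"
    proof (intro mult_right_mono)
      have "card W \<le> divisor_count (v m)" unfolding divisor_count_def W_def using vm
        by (intro card_mono finite_divisors_nat) auto
      moreover have "v m \<le> Q ^ s * E ^ s"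
      proof -
        have "Q ^ 1 * 1 \<le> Q ^ s * E ^ s" using Q s E by (intro mult_le_mono power_increasing) auto
        then show ?thesis using vm by simp
      qed
      ultimately show "real (card W) \<le> T" using T[of "v m"] vm by linarith
    qed simp
    finally have "2 * real s * real (card {x\<in>G. \<not> good x m}) \<le> 2 * real s * (T * (real (card G) / real E powr \<eta>))"
      by (intro mult_left_mono) auto
    also have "\<dots> = (2 * real s * T) * real (card G) / real E powr \<eta>" by simp
    also have "\<dots> \<le> real E powr \<eta> * real (card G) / real E powr \<eta>"
      using TE by (intro divide_right_mono mult_right_mono) auto
    also have "\<dots> = real (card G)" using E by simp
    finally show ?thesis .
  qed
  define tuples where "tuples = {xs. length xs = s \<and> set xs \<subseteq> G \<and> sorted_wrt good xs}"
  have fin_tuples: "finite tuples"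
    by (rule finite_subset[OF _ finite_lists_length_eq[OF finG, of s]]) (auto simp: tuples_def)
  have card_tuples: "(real (card G) / 2) ^ s \<le> real (card tuples)"
    unfolding tuples_def by (rule card_sorted_wrt_lists_ge[OF finG bad]) auto
  have tuples_G: "xs ! i \<in> G" if "xs \<in> tuples" "i < s" for xs i
    using that unfolding tuples_def by auto
  have coprimeish: "gcd (w (xs ! i)) (w (xs ! l)) \<le> E" if xs: "xs \<in> tuples" and il: "i < s" "l < s" "i \<noteq> l" for xs i l
  proof -
    have "gcd (v (xs ! i)) (v (xs ! l)) \<le> g * E"
    proof (cases "i < l")
      case True
      then show ?thesis using sorted_wrt_nth_less[of good xs i l] xs il unfolding tuples_def good_def by auto
    next
      case False
      then have "good (xs ! l) (xs ! i)" using sorted_wrt_nth_less[of good xs l i] xs il unfolding tuples_def by auto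
      then show ?thesis unfolding good_def by (simp add: gcd.commute)
    qed
    then have "g * gcd (w (xs ! i)) (w (xs ! l)) \<le> g * E"
      using vw[OF tuples_G[OF xs il(1)]] vw[OF tuples_G[OF xs il(2)]] by (simp add: gcd_mult_distrib_nat)
    then show ?thesis using g(1) by simp
  qed
  \<comment> \<open>Multiplied by q g, this is a common denominator for all entries but the
    i-th.\<close>
  define W where "W xs i = (\<Prod>l\<in>{..<s} - {i}. w (xs ! l))" for xs i
  define P where "P ys = (\<Prod>l<s. w (ys ! l))" for ys
  have W1: "1 \<le> W xs i" "W xs i \<le> Q ^ s" if "xs \<in> tuples" for xs i
  proof -
    show "1 \<le> W xs i" unfolding W_def using w1 tuples_G[OF that] by (intro prod_ge_1) auto
    show "W xs i \<le> Q ^ s" unfolding W_def using w1 tuples_G[OF that] Q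
      by (intro prod_le_pow) (auto simp: card_Diff_singleton_if)
  qed
  have P1: "1 \<le> P ys" "P ys \<le> Q ^ s" if "ys \<in> tuples" for ys
  proof -
    show "1 \<le> P ys" unfolding P_def using w1 tuples_G[OF that] by (intro prod_ge_1) auto
    show "P ys \<le> Q ^ s" unfolding P_def using w1 tuples_G[OF that] Q by (intro prod_le_pow) auto
  qed
  have in_lam: "xs ! l \<in> lam (q * n) (Z * Q) 1" if "xs \<in> tuples" "l < s" "g * w (xs ! l) dvd n" "n \<ge> 1" for xs l n
  proof -
    have G: "xs ! l \<in> G" using tuples_G that by auto
    have "lam (q * v (xs ! l)) (Z * Q) 1 \<subseteq> lam (q * n) (Z * Q) 1"
      using that(3,4) qZ vw[OF G] by (intro lam_mono) (auto simp: Suc_le_eq)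
    then show ?thesis using v(3)[of "xs ! l"] G GM by auto
  qed
  have gW: "g * w (xs ! l) dvd g * W xs i" if "l \<in> {..<s} - {i}" for xs l i
    unfolding W_def using that by (intro mult_dvd_mono dvd_prodI) auto
  have gP: "g * w (ys ! l) dvd g * P ys" if "l < s" for ys l
    unfolding P_def using that by (intro mult_dvd_mono dvd_prodI) auto
  have sum_others: "(\<Sum>l\<in>{..<s} - {i}. xs ! l) \<in> lam (q * (g * W xs i * n)) (Z * Q) (real s - 1)"
    if "xs \<in> tuples" "i < s" "n \<ge> 1" for xs i n
  proof -
    have "(\<Sum>l\<in>{..<s} - {i}. xs ! l) \<in> lam (q * (g * W xs i * n)) (Z * Q) (real (card ({..<s} - {i})) * 1)"
    proof (rule lam_sum)
      fix l assume l: "l \<in> {..<s} - {i}"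
      show "xs ! l \<in> lam (q * (g * W xs i * n)) (Z * Q) 1"
        using gW[OF l, of xs] W1[OF that(1), of i] g(1) that(3) l by (intro in_lam[OF that(1)]) (auto simp: Suc_le_eq)
    qed simp
    moreover have "real (card ({..<s} - {i})) * 1 = real s - 1" using that(2) s by simp
    ultimately show ?thesis by (simp only:)
  qed
  have Xbig: "2 * real s * real (Z * Q) * real (q * Q * (q * n)) < X / 2" if "n \<le> Q * (Q ^ s * Q ^ s)" for n
  proof -
    have "real (q * Q * (q * n)) \<le> real (q * Q * (q * (Q * (Q ^ s * Q ^ s))))"
      using that by (intro of_nat_mono mult_le_mono) auto
    then have "2 * real s * real (Z * Q) * real (q * Q * (q * n)) \<le> 2 * real s * real (Z * Q) * real (q * Q * (q * (Q * (Q ^ s * Q ^ s))))"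
      by (intro mult_left_mono) auto
    then show ?thesis using X by linarith
  qed
  \<comment> \<open>The i-th entry is the sum of ys minus the other entries of xs, so its order g w
    divides g W P; then g cancels.\<close>
  have ord_divides: "w (xs ! i) dvd P ys * W xs i" if xs: "xs \<in> tuples" "ys \<in> tuples" "sum_list xs = sum_list ys" "i < s" for xs ys i
  proof -
    define n where "n = g * W xs i * P ys"
    have n: "1 \<le> n" "n \<le> Q * (Q ^ s * Q ^ s)"
    proof -
      show "1 \<le> n" unfolding n_def using g W1[OF xs(1), of i] P1[OF xs(2)] by (simp add: Suc_le_eq)
      show "n \<le> Q * (Q ^ s * Q ^ s)"
        unfolding n_def mult.assoc using g W1[OF xs(1), of i] P1[OF xs(2)] by (intro mult_le_mono) auto
    qed
    have "(\<Sum>l<s. ys ! l) \<in> lam (q * n) (Z * Q) (real (card {..<s}) * 1)"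
    proof (rule lam_sum)
      fix l assume l: "l \<in> {..<s}"
      have "g * w (ys ! l) dvd n" using gP[of l ys] l unfolding n_def by (metis dvd_mult2 lessThan_iff mult.assoc mult.commute)
      then show "ys ! l \<in> lam (q * n) (Z * Q) 1" using l n(1) by (intro in_lam[OF xs(2)]) auto
    qed simp
    moreover have "(\<Sum>l<s. ys ! l) = sum_list ys" using xs(2) unfolding tuples_def by (auto simp: sum_list_sum_nth atLeast0LessThan)
    ultimately have "sum_list ys \<in> lam (q * n) (Z * Q) (real s)" by simp
    moreover have "(\<Sum>l\<in>{..<s} - {i}. xs ! l) \<in> lam (q * n) (Z * Q) (real s - 1)"
      unfolding n_def using P1[OF xs(2)] by (intro sum_others xs)
    ultimately have "sum_list ys - (\<Sum>l\<in>{..<s} - {i}. xs ! l) \<in> lam (q * n) (Z * Q) (real s + (real s - 1))"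
      by (rule lam_diff)
    moreover have "sum_list ys - (\<Sum>l\<in>{..<s} - {i}. xs ! l) = xs ! i"
      using sum_list_split[of i xs] xs unfolding tuples_def by auto
    moreover have "lam (q * n) (Z * Q) (real s + (real s - 1)) \<subseteq> lam (q * n) (Z * Q) (2 * real s)"
      using qZ n s by (intro lam_mono) (auto simp: Suc_le_eq)
    ultimately have xin: "xs ! i \<in> lam (q * n) (Z * Q) (2 * real s)" by auto
    have "v (xs ! i) dvd n"
      unfolding v_def
      by (rule ord_dvd[OF _ xin n(1) _ qZ(1) Xbig[OF n(2)]]) (use tuples_G[OF xs(1,4)] GM M(1) s in auto)
    then have "g * w (xs ! i) dvd g * (P ys * W xs i)"
      using vw[OF tuples_G[OF xs(1,4)]] unfolding n_def by (simp add: mult_ac)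
    then show ?thesis using g(1) by simp
  qed
  \<comment> \<open>The reduced order of the i-th entry divides P times its gcd with W, and this gcd
    is at most E^s because the orders are nearly coprime in pairs. So once the sum is fixed,
    represented by ys, few orders remain.\<close>
  define \<Omega> where "\<Omega> ys = {u. \<exists>y. 1 \<le> y \<and> y \<le> E ^ s \<and> u dvd P ys * y}" for ys
  have w\<Omega>: "w (xs ! i) \<in> \<Omega> ys" if xs: "xs \<in> tuples" "ys \<in> tuples" "sum_list xs = sum_list ys" "i < s" for xs ys i
  proof -
    have G: "xs ! i \<in> G" using tuples_G xs by auto
    have "w (xs ! i) dvd gcd (P ys * w (xs ! i)) (P ys * W xs i)"
      using ord_divides[OF xs] by simp
    then have "w (xs ! i) dvd P ys * gcd (w (xs ! i)) (W xs i)" by (simp add: gcd_mult_distrib_nat)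
    moreover have "gcd (w (xs ! i)) (W xs i) \<le> E ^ s"
    proof -
      have "gcd (w (xs ! i)) (W xs i) \<le> E ^ card ({..<s} - {i})"
        unfolding W_def using coprimeish[OF xs(1)] xs(4) w1[OF G] by (intro gcd_prod_le) auto
      also have "\<dots> \<le> E ^ s" using E by (intro power_increasing) (auto simp: card_Diff_singleton_if)
      finally show ?thesis .
    qed
    moreover have "1 \<le> gcd (w (xs ! i)) (W xs i)" using w1[OF G] by (simp add: Suc_le_eq)
    ultimately show ?thesis unfolding \<Omega>_def by blast
  qed
  have card\<Omega>: "finite (\<Omega> ys) \<and> real (card (\<Omega> ys)) \<le> real (E ^ s) * T" if ys: "ys \<in> tuples" for ys
    unfolding \<Omega>_def
  proof (rule card_dvd_multiples_le)
    fix n assume n: "1 \<le> n" "n \<le> P ys * E ^ s"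
    have "P ys * E ^ s \<le> Q ^ s * E ^ s" using P1[OF ys] by (intro mult_le_mono) auto
    from T[OF n(1) order_trans[OF n(2) this]] show "real (divisor_count n) \<le> T" .
  qed (use P1[OF ys] in auto)
  define B where "B = U * real (Q * Q) powr c"
  have B0': "B \<ge> 0" unfolding B_def using U by simp
  \<comment> \<open>If sum and reduced orders agree with those of ys, the i-th entry lies in a
    separated set whose differences have a denominator of at most q Q; packing bounds the choices
    for each entry by B.\<close>
  have fib2: "real (card {xs\<in>tuples. sum_list xs = x \<and> map w xs = ws}) \<le> B ^ s" for x ws
  proof (cases "{xs\<in>tuples. sum_list xs = x \<and> map w xs = ws} = {}")
    case True
    then show ?thesis using B0' by (simp only: card.empty) simp
  next
    case False
    then obtain ys where ys: "ys \<in> tuples" "sum_list ys = x" "map w ys = ws" by blast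
    define \<gamma> where "\<gamma> i = gcd (v (ys ! i)) (g * W ys i)" for i
    define N where "N i = {m\<in>G. m - ys ! i \<in> lam (q * \<gamma> i) (Z * Q) 2}" for i
    have \<gamma>: "1 \<le> \<gamma> i" "\<gamma> i \<le> Q" if i: "i < s" for i
    proof -
      have "v (ys ! i) \<ge> 1" "v (ys ! i) \<le> Q" using v tuples_G[OF ys(1) i] GM by auto
      moreover from this(1) have "gcd (v (ys ! i)) (g * W ys i) \<le> v (ys ! i)" by (intro dvd_imp_le) auto
      ultimately show "1 \<le> \<gamma> i" "\<gamma> i \<le> Q" unfolding \<gamma>_def by (simp add: Suc_le_eq, linarith)
    qed
    have sub: "{xs\<in>tuples. sum_list xs = x \<and> map w xs = ws} \<subseteq> {xs. length xs = s \<and> (\<forall>i<s. xs ! i \<in> N i)}"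
    proof clarify
      fix xs assume xs: "xs \<in> tuples" "x = sum_list xs" "ws = map w xs"
      have len: "length xs = s" "length ys = s" using xs ys unfolding tuples_def by auto
      have weq: "w (xs ! i) = w (ys ! i)" if "i < s" for i
        using ys(3) xs(3) len that by (metis nth_map)
      have Weq: "W xs i = W ys i" for i unfolding W_def by (rule prod.cong) (auto simp: weq)
      have "xs ! i \<in> N i" if i: "i < s" for i
      proof -
        have G: "xs ! i \<in> G" "ys ! i \<in> G" using tuples_G xs ys i by auto
        have veq: "v (xs ! i) = v (ys ! i)" using vw[OF G(1)] vw[OF G(2)] weq[OF i] by simp
        have vi: "1 \<le> v (ys ! i)" "v (ys ! i) \<le> Q" using v G GM by auto
        have 1: "xs ! i - ys ! i \<in> lam (q * v (ys ! i)) (Z * Q) (1 + 1)"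
          using v(3)[of "xs ! i"] v(3)[of "ys ! i"] G GM unfolding veq by (intro lam_diff) auto
        have "(\<Sum>l\<in>{..<s} - {i}. ys ! l) - (\<Sum>l\<in>{..<s} - {i}. xs ! l) \<in> lam (q * (g * W ys i)) (Z * Q) ((real s - 1) + (real s - 1))"
          using sum_others[OF ys(1) i, of 1] sum_others[OF xs(1) i, of 1] unfolding Weq by (intro lam_diff) auto
        moreover have "(\<Sum>l\<in>{..<s} - {i}. ys ! l) - (\<Sum>l\<in>{..<s} - {i}. xs ! l) = xs ! i - ys ! i"
          using sum_list_split[of i xs] sum_list_split[of i ys] xs(2) ys(2) i len by (simp add: algebra_simps)
        moreover have "lam (q * (g * W ys i)) (Z * Q) ((real s - 1) + (real s - 1)) \<subseteq> lam (q * (g * W ys i)) (Z * Q) (2 * real s)"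
          using qZ g(1) W1[OF ys(1), of i] s by (intro lam_mono) (auto simp: Suc_le_eq)
        ultimately have 2: "xs ! i - ys ! i \<in> lam (q * (g * W ys i)) (Z * Q) (2 * real s)" by auto
        have "q * v (ys ! i) * (q * (g * W ys i)) \<le> q * Q * (q * (g * W ys i))"
          using vi by (intro mult_le_mono) auto
        then have le1: "real (q * v (ys ! i) * (q * (g * W ys i))) \<le> real (q * Q * (q * (g * W ys i)))" by (rule of_nat_mono)
        have "g * W ys i \<le> Q * (Q ^ s * Q ^ s)"
        proof -
          have "g * (W ys i * 1) \<le> Q * (Q ^ s * Q ^ s)" using g W1[OF ys(1), of i] Q by (intro mult_le_mono) auto
          then show ?thesis by simp
        qed
        from Xbig[OF this] have X2: "2 * real s * real (Z * Q) * real (q * v (ys ! i) * (q * (g * W ys i))) < X / 2"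
          using mult_left_mono[OF le1, of "2 * real s * real (Z * Q)"] by simp
        have "2 * (real (Z * Q) * real (q * v (ys ! i) * (q * (g * W ys i)))) \<le> 2 * real s * (real (Z * Q) * real (q * v (ys ! i) * (q * (g * W ys i))))"
          using s by (intro mult_right_mono) auto
        then have X1: "2 * real (Z * Q) * real (q * v (ys ! i) * (q * (g * W ys i))) < X / 2" using X2 by (simp only: mult.assoc)
        have "xs ! i - ys ! i \<in> lam (gcd (q * v (ys ! i)) (q * (g * W ys i))) (Z * Q) 2"
        proof (rule lam_gcd[OF _ 2 _ _ _ _ X1 X2])
          show "xs ! i - ys ! i \<in> lam (q * v (ys ! i)) (Z * Q) 2" using 1 by simp
        qed (use qZ vi g(1) W1[OF ys(1), of i] s in \<open>auto simp: Suc_le_eq\<close>)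
        moreover have "gcd (q * v (ys ! i)) (q * (g * W ys i)) = q * \<gamma> i" unfolding \<gamma>_def by (simp add: gcd_mult_distrib_nat)
        ultimately show ?thesis unfolding N_def using G by simp
      qed
      then show "length xs = s \<and> (\<forall>i<s. xs ! i \<in> N i)" using len by blast
    qed
    have N: "finite (N i) \<and> real (card (N i)) \<le> B" if i: "i < s" for i
    proof -
      have finN: "finite (N i)" unfolding N_def using finG by simp
      have "real (card (N i)) \<le> U * real (\<gamma> i * Q) powr c"
      proof (rule separated_card_le[OF cl _ _ finN])
        show "separated q Z t (N i)" using M(2) GM unfolding separated_def N_def by blast
        show "m - m' \<in> lam (q * \<gamma> i) (Z * Q) 4" if "m \<in> N i" "m' \<in> N i" for m m'
          using lam_diff[of "m - ys ! i" "q * \<gamma> i" "Z * Q" 2 "m' - ys ! i" 2] that unfolding N_def by auto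
      qed (use t U Q \<gamma>[OF i] in auto)
      also have "\<dots> \<le> B" unfolding B_def
        using U c \<gamma>[OF i] by (intro mult_left_mono powr_mono2) (auto intro!: of_nat_mono mult_right_mono)
      finally show ?thesis using finN by blast
    qed
    have "card {xs\<in>tuples. sum_list xs = x \<and> map w xs = ws} \<le> card {xs. length xs = s \<and> (\<forall>i<s. xs ! i \<in> N i)}"
      using card_lists_nth_le[of s N B, OF N B0'] sub by (intro card_mono) auto
    then show ?thesis using card_lists_nth_le[of s N B, OF N B0'] by linarith
  qed
  have fib1: "real (card {xs\<in>tuples. sum_list xs = x}) \<le> (real (E ^ s) * T) ^ s * B ^ s" for x
  proof (cases "{xs\<in>tuples. sum_list xs = x} = {}")
    case True
    then show ?thesis using B0' T1 by (simp only: card.empty) simp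
  next
    case False
    then obtain ys where ys: "ys \<in> tuples" "sum_list ys = x" by blast
    define WS where "WS = {ws. length ws = s \<and> (\<forall>i<s. ws ! i \<in> \<Omega> ys)}"
    have WS: "finite WS \<and> real (card WS) \<le> (real (E ^ s) * T) ^ s"
      unfolding WS_def using card\<Omega>[OF ys(1)] T1 by (intro card_lists_nth_le) auto
    have "real (card {xs\<in>tuples. sum_list xs = x}) \<le> real (card WS) * B ^ s"
    proof (rule card_le_fibres_real)
      show "map w ` {xs\<in>tuples. sum_list xs = x} \<subseteq> WS"
        unfolding WS_def using w\<Omega>[OF _ ys(1)] ys(2) by (auto simp: tuples_def)
      show "real (card {a \<in> {xs\<in>tuples. sum_list xs = x}. map w a = b}) \<le> B ^ s" for b
        using fib2[of x b] by (simp add: conj_assoc)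
    qed (use fin_tuples WS in auto)
    also have "\<dots> \<le> (real (E ^ s) * T) ^ s * B ^ s" using WS B0' by (intro mult_right_mono) auto
    finally show ?thesis .
  qed
  have "real (card tuples) \<le> real (card (box s)) * ((real (E ^ s) * T) ^ s * B ^ s)"
  proof (rule card_le_fibres_real[OF fin_tuples finite_box _ fib1])
    show "sum_list ` tuples \<subseteq> box (real s)"
    proof clarify
      fix xs assume "xs \<in> tuples"
      then have "set xs \<subseteq> box 1" "length xs = s" using GM M(1) lsub unfolding tuples_def by auto
      then show "sum_list xs \<in> box (real s)" using box_sum_list[of xs] by simp
    qed
  qed
  then have main: "(real (card G) / 2) ^ s \<le> real (card (box s)) * (real (E ^ s) * T * B) ^ s"
    using card_tuples by (simp only: power_mult_distrib)
  define K where "K = real (E ^ s) * T * B"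
  have K: "K > 0" unfolding K_def B_def using E T1 U Q by simp
  have cG: "B0 / (6 ^ D * real Q powr \<eta>) \<le> real (card G)"
  proof -
    have "B0 \<le> 6 ^ D * (real (card G) * real Q powr \<eta>)"
      using cardM g(3) unfolding G_def by (elim order_trans) (intro mult_left_mono, auto)
    then show ?thesis using Q by (simp add: pos_divide_le_eq mult_ac)
  qed
  have "(B0 / (6 ^ D * real Q powr \<eta>) / (2 * K)) ^ s \<le> (real (card G) / (2 * K)) ^ s"
    using cG K B0 by (intro power_mono divide_right_mono) auto
  also have "\<dots> = (real (card G) / 2) ^ s / K ^ s" by (simp add: power_divide power_mult_distrib)
  also have "\<dots> \<le> real (card (box s))" using main K unfolding K_def[symmetric] by (simp add: pos_divide_le_eq)
  finally show ?thesis unfolding K_def B_def .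
qed

end

section \<open>Exponential sums over a system of polynomials\<close>

text \<open>Vanishing off J keeps the box finite and places the boxes for all J in one group. Upper
  ends are excluded, so coordinate i has hi i - lo i values.\<close>

definition int_box :: "('i \<Rightarrow> int) \<Rightarrow> ('i \<Rightarrow> int) \<Rightarrow> 'i set \<Rightarrow> ('i \<Rightarrow> int) set" where
  "int_box lo hi J = {m. (\<forall>i\<in>J. lo i \<le> m i \<and> m i < hi i) \<and> (\<forall>i. i \<notin> J \<longrightarrow> m i = 0)}"

lemma int_box_empty: "int_box lo hi {} = {\<lambda>_. 0}"
  unfolding int_box_def by auto

lemma int_box_insert:
  assumes "i \<notin> J"
  shows "int_box lo hi (insert i J) = (\<lambda>(c, m). m(i := c)) ` ({lo i..<hi i} \<times> int_box lo hi J)"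
proof
  show "int_box lo hi (insert i J) \<subseteq> (\<lambda>(c, m). m(i := c)) ` ({lo i..<hi i} \<times> int_box lo hi J)"
  proof
    fix m assume m: "m \<in> int_box lo hi (insert i J)"
    have "m = (\<lambda>(c, m). m(i := c)) (m i, m(i := 0))" by auto
    moreover have "(m i, m(i := 0)) \<in> {lo i..<hi i} \<times> int_box lo hi J"
      using m assms unfolding int_box_def by auto
    ultimately show "m \<in> (\<lambda>(c, m). m(i := c)) ` ({lo i..<hi i} \<times> int_box lo hi J)" by (rule image_eqI)
  qed
  show "(\<lambda>(c, m). m(i := c)) ` ({lo i..<hi i} \<times> int_box lo hi J) \<subseteq> int_box lo hi (insert i J)"
    using assms unfolding int_box_def by auto
qed

lemma inj_on_int_box_insert:
  assumes "i \<notin> J"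
  shows "inj_on (\<lambda>(c, m). m(i := c)) ({lo i..<hi i} \<times> int_box lo hi J)"
proof (rule inj_onI, clarify)
  fix c m c' m' assume m: "m \<in> int_box lo hi J" "m' \<in> int_box lo hi J" "m(i := c) = m'(i := c')"
  have "c = c'" using fun_cong[OF m(3), of i] by simp
  moreover have "m l = m' l" for l
    using fun_cong[OF m(3), of l] m(1,2) assms unfolding int_box_def by (cases "l = i") auto
  ultimately show "c = c' \<and> m = m'" by auto
qed

lemma finite_int_box: "finite J \<Longrightarrow> finite (int_box lo hi J)"
  by (induction J rule: finite_induct) (simp_all add: int_box_empty int_box_insert)

lemma card_int_box: "finite J \<Longrightarrow> card (int_box lo hi J) = (\<Prod>i\<in>J. nat (hi i - lo i))"
proof (induction J rule: finite_induct)
  case (insert i J)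
  then show ?case
    by (simp add: int_box_insert card_image inj_on_int_box_insert card_cartesian_product)
qed (simp add: int_box_empty)

lemma sum_ee_int_box:
  "finite J \<Longrightarrow> (\<Sum>m\<in>int_box lo hi J. ee (\<Sum>i\<in>J. of_int (m i) * \<theta> i))
     = (\<Prod>i\<in>J. \<Sum>c\<in>{lo i..<hi i}. ee (of_int c * \<theta> i))"
proof (induction J rule: finite_induct)
  case (insert i J)
  have "(\<Sum>m\<in>int_box lo hi (insert i J). ee (\<Sum>l\<in>insert i J. of_int (m l) * \<theta> l))
      = (\<Sum>(c, m)\<in>{lo i..<hi i} \<times> int_box lo hi J. ee (of_int c * \<theta> i + (\<Sum>l\<in>J. of_int (m l) * \<theta> l)))"
    unfolding int_box_insert[OF insert(2)] sum.reindex[OF inj_on_int_box_insert[OF insert(2)]]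
  proof (rule sum.cong[OF refl], clarify)
    fix c m
    have "(\<Sum>l\<in>J. of_int ((m(i := c)) l) * \<theta> l) = (\<Sum>l\<in>J. of_int (m l) * \<theta> l)"
      using insert(2) by (intro sum.cong) auto
    then show "((\<lambda>m. ee (\<Sum>l\<in>insert i J. of_int (m l) * \<theta> l)) \<circ> (\<lambda>(c, m). m(i := c))) (c, m)
       = ee (of_int c * \<theta> i + (\<Sum>l\<in>J. of_int (m l) * \<theta> l))"
      using insert(1,2) by simp
  qed
  also have "\<dots> = (\<Sum>c\<in>{lo i..<hi i}. ee (of_int c * \<theta> i)) * (\<Sum>m\<in>int_box lo hi J. ee (\<Sum>l\<in>J. of_int (m l) * \<theta> l))"
    by (simp add: sum_product sum.cartesian_product ee_add)
  finally show ?case using insert by simp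
qed (simp add: int_box_empty)

text \<open>Starting the sum at 0 instead of 1 removes a factor \<open>ee \<theta>\<close> of
  modulus 1, after which \<open>near_if_geometric_ee_large\<close> applies.\<close>

lemma norm_sum_ee_int_le:
  fixes N :: nat
  assumes "\<not> near \<theta> \<epsilon>" "\<epsilon> > 0"
  shows "norm (\<Sum>c\<in>{0..<int N}. ee (of_int c * \<theta>)) \<le> 1 / (2 * \<epsilon>)"
proof (rule ccontr)
  define s where "s = norm (\<Sum>m\<in>{1..N}. ee (real m * \<theta>))"
  have "(\<Sum>c\<in>{0..<int N}. ee (of_int c * \<theta>)) = (\<Sum>m<N. ee (real m * \<theta>))"
    by (rule sum.reindex_bij_witness[of _ int nat]) auto
  also have "(\<Sum>m\<in>{1..N}. ee (real m * \<theta>)) = (\<Sum>m<N. ee (real (Suc m) * \<theta>))"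
    by (simp add: sum.atLeast1_atMost_eq)
  then have "(\<Sum>m\<in>{1..N}. ee (real m * \<theta>)) = ee \<theta> * (\<Sum>m<N. ee (real m * \<theta>))"
    by (simp add: sum_distrib_left distrib_right ee_add)
  then have "norm (\<Sum>m<N. ee (real m * \<theta>)) = s" unfolding s_def by (simp add: norm_mult)
  finally have eq: "norm (\<Sum>c\<in>{0..<int N}. ee (of_int c * \<theta>)) = s" by simp
  assume "\<not> norm (\<Sum>c\<in>{0..<int N}. ee (of_int c * \<theta>)) \<le> 1 / (2 * \<epsilon>)"
  then have s: "s > 1 / (2 * \<epsilon>)" unfolding eq by simp
  moreover have "1 / (2 * \<epsilon>) > 0" using assms(2) by simp
  ultimately have s0: "s > 0" by linarith
  then have "near \<theta> (1 / (2 * s))" by (rule near_if_geometric_ee_large[where M = N]) (simp add: s_def)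
  moreover have "1 / (2 * s) \<le> \<epsilon>" using s s0 assms(2) by (simp add: field_simps)
  ultimately show False using assms(1) near_mono by blast
qed

locale polynomial_system =
  fixes k d :: nat and f :: "nat \<Rightarrow> real poly" and n0 :: "nat \<Rightarrow> nat" and X :: real
  assumes k_pos: "k \<ge> 1" and d_pos': "d \<ge> 1" and X_pos': "X > 0"
    and n0_pos: "\<And>i. i \<in> {1..k} \<Longrightarrow> n0 i \<ge> 1"
    and deg: "\<And>i. i \<in> {1..k} \<Longrightarrow> degree (f i) \<le> d" and f0: "\<And>i. i \<in> {1..k} \<Longrightarrow> poly (f i) 0 = 0"
begin

definition side :: "nat \<Rightarrow> nat" where "side i = 4 * n0 i"

definition vol :: real where "vol = (\<Prod>i\<in>{1..k}. real (side i))"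

definition freqs :: "(nat \<Rightarrow> int) set" where "freqs = {a. \<forall>i. i \<notin> {1..k} \<longrightarrow> a i = 0}"

definition scaled_coord :: "nat \<Rightarrow> (nat \<Rightarrow> int) \<Rightarrow> real" where "scaled_coord i a = real_of_int (a i) / real (side i)"

definition freq_coeff :: "nat \<Rightarrow> (nat \<Rightarrow> int) \<Rightarrow> real" where
  "freq_coeff j a = (\<Sum>i\<in>{1..k}. real_of_int (a i) * coeff (f i) j)"

lemma side_pos: "i \<in> {1..k} \<Longrightarrow> side i \<ge> 4"
  unfolding side_def using n0_pos[of i] by auto

lemma abs_box_subset:
  assumes "t \<ge> 0"
  shows "{a\<in>freqs. \<forall>i\<in>{1..k}. \<bar>scaled_coord i a\<bar> \<le> t} \<subseteq> int_box (\<lambda>i. - \<lfloor>t * real (side i)\<rfloor>) (\<lambda>i. \<lfloor>t * real (side i)\<rfloor> + 1) {1..k}"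
proof
  fix a assume a: "a \<in> {a\<in>freqs. \<forall>i\<in>{1..k}. \<bar>scaled_coord i a\<bar> \<le> t}"
  have "- \<lfloor>t * real (side i)\<rfloor> \<le> a i \<and> a i < \<lfloor>t * real (side i)\<rfloor> + 1" if i: "i \<in> {1..k}" for i
  proof -
    have "\<bar>real_of_int (a i)\<bar> \<le> t * real (side i)"
    proof -
      have "\<bar>real_of_int (a i)\<bar> / real (side i) \<le> t" using a i unfolding scaled_coord_def by (auto simp: abs_divide)
      then show ?thesis using side_pos[OF i] by (simp add: pos_divide_le_eq)
    qed
    then have "real_of_int (a i) \<le> t * real (side i)" "real_of_int (- a i) \<le> t * real (side i)" by auto
    then have "a i \<le> \<lfloor>t * real (side i)\<rfloor>" "- a i \<le> \<lfloor>t * real (side i)\<rfloor>" by (metis le_floor_iff)+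
    then show ?thesis by linarith
  qed
  then show "a \<in> int_box (\<lambda>i. - \<lfloor>t * real (side i)\<rfloor>) (\<lambda>i. \<lfloor>t * real (side i)\<rfloor> + 1) {1..k}"
    using a unfolding int_box_def freqs_def by blast
qed

sublocale diophantine_forms freqs "{1..k}" scaled_coord d freq_coeff X
proof
  show "finite {a\<in>freqs. \<forall>i\<in>{1..k}. \<bar>scaled_coord i a\<bar> \<le> t}" for t
  proof (cases "t \<ge> 0")
    case True
    then show ?thesis by (intro finite_subset[OF abs_box_subset finite_int_box]) simp_all
  next
    \<comment> \<open>For negative t the box is empty because there is at least one
      coordinate.\<close>
    case False
    have "\<not> (\<forall>i\<in>{1..k}. \<bar>scaled_coord i a\<bar> \<le> t)" for a
    proof
      assume "\<forall>i\<in>{1..k}. \<bar>scaled_coord i a\<bar> \<le> t"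
      then have "\<bar>scaled_coord 1 a\<bar> \<le> t" using k_pos by auto
      then show False using False by linarith
    qed
    then have "{a\<in>freqs. \<forall>i\<in>{1..k}. \<bar>scaled_coord i a\<bar> \<le> t} = {}" by simp
    then show ?thesis by (simp only: finite.emptyI)
  qed
qed (use d_pos' X_pos' in \<open>auto simp: freqs_def scaled_coord_def freq_coeff_def diff_divide_distrib left_diff_distrib sum_subtractf\<close>)

lemma vol_ge_1: "vol \<ge> 1"
  unfolding vol_def using side_pos by (intro prod_ge_1) force

lemma card_box_le:
  assumes t: "t \<ge> 1"
  shows "real (card (box t)) \<le> (3 * t) ^ k * vol"
proof -
  have "card (box t) \<le> card (int_box (\<lambda>i. - \<lfloor>t * real (side i)\<rfloor>) (\<lambda>i. \<lfloor>t * real (side i)\<rfloor> + 1) {1..k})"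
    unfolding box_def using abs_box_subset[of t] t by (intro card_mono finite_int_box) auto
  then have "real (card (box t)) \<le> (\<Prod>i\<in>{1..k}. real (nat (2 * \<lfloor>t * real (side i)\<rfloor> + 1)))"
    by (simp add: card_int_box flip: of_nat_prod)
  also have "\<dots> \<le> (\<Prod>i\<in>{1..k}. 3 * t * real (side i))"
  proof (rule prod_mono)
    fix i assume i: "i \<in> {1..k}"
    have "1 * 1 \<le> t * real (side i)" using t side_pos[OF i] by (intro mult_mono) auto
    then show "0 \<le> real (nat (2 * \<lfloor>t * real (side i)\<rfloor> + 1)) \<and> real (nat (2 * \<lfloor>t * real (side i)\<rfloor> + 1)) \<le> 3 * t * real (side i)"
      by (simp add: mult.assoc) linarith
  qed
  also have "\<dots> = (3 * t) ^ k * vol" unfolding vol_def by (simp add: prod.distrib)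
  finally show ?thesis .
qed

text \<open>The polynomial with coefficients \<open>freq_coeff j a\<close> at q n, arranged as a
  polynomial in n for Weyl's inequality; \<open>phase_eq\<close> relates it to the f_i.\<close>

definition phase :: "nat \<Rightarrow> (nat \<Rightarrow> int) \<Rightarrow> nat \<Rightarrow> real" where
  "phase q a n = (\<Sum>j\<le>d. (freq_coeff j a * real q ^ j) * real n ^ j)"

lemma phase_eq: "phase q a n = (\<Sum>i\<in>{1..k}. real_of_int (a i) * poly (f i) (real (q * n)))"
proof -
  have p: "poly (f i) y = (\<Sum>j\<le>d. coeff (f i) j * y ^ j)" if "i \<in> {1..k}" for i y
  proof -
    have "poly (f i) y = (\<Sum>j\<le>degree (f i). coeff (f i) j * y ^ j)" by (rule poly_altdef)
    also have "\<dots> = (\<Sum>j\<le>d. coeff (f i) j * y ^ j)"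
      using deg[OF that] by (intro sum.mono_neutral_left) (auto simp: coeff_eq_0)
    finally show ?thesis .
  qed
  have "(\<Sum>i\<in>{1..k}. real_of_int (a i) * poly (f i) (real (q * n)))
      = (\<Sum>i\<in>{1..k}. \<Sum>j\<le>d. real_of_int (a i) * (coeff (f i) j * real (q * n) ^ j))"
    by (simp add: p sum_distrib_left)
  also have "\<dots> = (\<Sum>j\<le>d. \<Sum>i\<in>{1..k}. real_of_int (a i) * (coeff (f i) j * real (q * n) ^ j))"
    by (rule sum.swap)
  also have "\<dots> = phase q a n"
    unfolding phase_def freq_coeff_def by (simp add: sum_distrib_left sum_distrib_right power_mult_distrib mult_ac)
  finally show ?thesis by simp
qed

lemma freq_coeff_0: "freq_coeff 0 a = 0"
  unfolding freq_coeff_def using f0 by (simp add: poly_0_coeff_0)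

definition \<sigma> :: "nat \<Rightarrow> nat \<Rightarrow> (nat \<Rightarrow> int) \<Rightarrow> real" where
  "\<sigma> q Y a = norm (\<Sum>n\<in>{1..Y}. ee (phase q a n)) / real Y"

lemma \<sigma>_nonneg: "\<sigma> q Y a \<ge> 0"
  unfolding \<sigma>_def by simp

lemma \<sigma>_le_1: "\<sigma> q Y a \<le> 1"
proof -
  have "norm (\<Sum>n\<in>{1..Y}. ee (phase q a n)) \<le> (\<Sum>n\<in>{1..Y}. norm (ee (phase q a n)))" by (rule norm_sum)
  then show ?thesis unfolding \<sigma>_def by (cases "Y = 0") (simp_all add: divide_le_eq)
qed

text \<open>Weyl's inequality gives h such that h q^j times the j-th coefficient is an integer up to
  W^C / Y^j. After division by h q^j, the lower bound on q Y makes the error at most (64 W^C Z /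
  X)^j.\<close>

lemma level_set_if_large:
  assumes C: "\<forall>(\<alpha>::nat \<Rightarrow> real) N (W::real). W \<ge> 2 \<longrightarrow> N \<ge> 1 \<longrightarrow>
    norm (\<Sum>n\<in>{1..N}. ee (\<Sum>j\<le>d. \<alpha> j * real n ^ j)) \<ge> N / W \<longrightarrow>
    (\<exists>q. 1 \<le> q \<and> real q \<le> W ^ C \<and> (\<forall>j\<in>{1..d}. near (real q * \<alpha> j) (W ^ C / real N ^ j)))"
    and q: "q \<ge> 1" "Z \<ge> 1" and Y: "Y \<ge> 1" "real (q * Y) \<ge> X / (64 * real Z)"
    and W: "W \<ge> 2" and Q: "real Q \<ge> 64 * W ^ C" and a: "a \<in> box 1" "\<sigma> q Y a \<ge> 1 / W"
  shows "a \<in> level_set q Z Q"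
proof -
  have large: "norm (\<Sum>n\<in>{1..Y}. ee (\<Sum>j\<le>d. (freq_coeff j a * real q ^ j) * real n ^ j)) \<ge> Y / W"
    using a(2) Y W unfolding \<sigma>_def phase_def by (simp add: field_simps)
  from C[rule_format, OF W Y(1) large] obtain h where h: "1 \<le> h" "real h \<le> W ^ C"
    "\<forall>j\<in>{1..d}. near (real h * (freq_coeff j a * real q ^ j)) (W ^ C / real Y ^ j)" by (elim exE conjE)
  have WC: "W ^ C \<ge> 1" using W by (intro one_le_power) auto
  have hQ: "h \<le> Q" using h(2) Q WC by linarith
  have "\<exists>b::int. \<bar>freq_coeff j a - b / real (q * h) ^ j\<bar> \<le> 1 * (real (Z * Q) / X) ^ j" if j: "j \<in> {1..d}" for j
  proof -
    obtain b :: int where b: "\<bar>real h * (freq_coeff j a * real q ^ j) - b\<bar> \<le> W ^ C / real Y ^ j"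
      using bspec[OF h(3) j] unfolding near_def by (elim exE)
    \<comment> \<open>The fraction found has denominator h q^j and is expanded to denominator (q
      h)^j.\<close>
    define b' where "b' = b * int h ^ (j - 1)"
    have h0: "real h \<ge> 1" using h by simp
    have q0: "real q ^ j > 0" using q by simp
    have hj: "real h ^ j = real h ^ (j - 1) * real h" using j by (simp flip: power_Suc2)
    have eq: "of_int b' / real (q * h) ^ j = b / (real h * real q ^ j)"
      unfolding b'_def using h0 q0 by (simp add: power_mult_distrib hj)
    have "freq_coeff j a - b / (real h * real q ^ j) = (real h * (freq_coeff j a * real q ^ j) - b) / (real h * real q ^ j)"
      using h0 q0 by (simp add: field_simps)
    then have "\<bar>freq_coeff j a - b / (real h * real q ^ j)\<bar> = \<bar>real h * (freq_coeff j a * real q ^ j) - b\<bar> / (real h * real q ^ j)"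
      using h0 q0 by (simp add: abs_divide abs_mult)
    also have "\<dots> \<le> (W ^ C / real Y ^ j) / (1 * real q ^ j)"
      using b h0 q0 WC by (intro frac_le mult_right_mono) auto
    also have "\<dots> = W ^ C / real (q * Y) ^ j" by (simp add: power_mult_distrib mult.commute)
    also have "\<dots> \<le> W ^ C / (X / (64 * real Z)) ^ j"
      using Y q X_pos' WC by (intro divide_left_mono power_mono mult_pos_pos zero_less_power) auto
    also have "\<dots> = W ^ C * 64 ^ j * (real Z / X) ^ j"
      using X_pos' q by (simp add: power_divide power_mult_distrib field_simps)
    also have "\<dots> \<le> (64 * W ^ C) ^ j * (real Z / X) ^ j"
    proof (intro mult_right_mono)
      have "(W ^ C) ^ 1 \<le> (W ^ C) ^ j" using WC j by (intro power_increasing) auto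
      then show "W ^ C * 64 ^ j \<le> (64 * W ^ C) ^ j" by (simp add: power_mult_distrib)
    qed (use X_pos' in auto)
    also have "\<dots> \<le> real Q ^ j * (real Z / X) ^ j"
      using Q WC X_pos' by (intro mult_right_mono power_mono) auto
    also have "\<dots> = 1 * (real (Z * Q) / X) ^ j" by (simp add: power_mult_distrib power_divide mult.commute)
    finally show ?thesis using eq by (intro exI[of _ b']) simp
  qed
  then have "a \<in> lam (q * h) (Z * Q) 1" using a(1) unfolding lam_def by blast
  then show ?thesis using a(1) h(1) hQ unfolding level_set_def by blast
qed

end

lemma sum_half_powers_le: "(\<Sum>i\<in>{m<..<J}. (1/2::real) ^ i) \<le> (1/2) ^ m"
proof -
  have "(\<Sum>i\<in>{m<..<m + Suc J}. (1/2::real) ^ i) = (1/2) ^ m - (1/2) ^ (m + J)" for J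
  proof (induction J)
    case (Suc J)
    have "{m<..<m + Suc (Suc J)} = insert (m + Suc J) {m<..<m + Suc J}" by auto
    then show ?case using Suc by simp
  next
    case 0
    have "{m<..<m + Suc 0} = {}" by auto
    then show ?case by simp
  qed
  from this[of J] have "(\<Sum>i\<in>{m<..<m + Suc J}. (1/2::real) ^ i) \<le> (1/2) ^ m" by simp
  moreover have "(\<Sum>i\<in>{m<..<J}. (1/2::real) ^ i) \<le> (\<Sum>i\<in>{m<..<m + Suc J}. (1/2::real) ^ i)"
    by (intro sum_mono2) auto
  ultimately show ?thesis by linarith
qed

lemma sum_powers_32_le: "(\<Sum>j\<in>{1..d}. (1/32::real) ^ j) \<le> 1/16"
proof -
  have "(\<Sum>j\<in>{1..d}. (1/32::real) ^ j) \<le> 1/16 - (1/32) ^ d / 16"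
  proof (induction d)
    case (Suc d)
    have "(1/32::real) ^ d \<ge> 0" by simp
    moreover have "(\<Sum>j\<in>{1..Suc d}. (1/32::real) ^ j) = (\<Sum>j\<in>{1..d}. (1/32) ^ j) + (1/32) ^ d / 32" by simp
    moreover have "(1/32::real) ^ Suc d = (1/32) ^ d / 32" by simp
    ultimately show ?case using Suc by linarith
  qed simp
  moreover have "(1/32::real) ^ d / 16 \<ge> 0" by simp
  ultimately show ?thesis by linarith
qed

text \<open>
  Dyadic decomposition of \<open>A\<close> (in powers of 4) according to the size of \<open>\<sigma>\<close>.
\<close>

lemma level_sum_bound:
  fixes \<sigma> :: "'b \<Rightarrow> real"
  assumes A: "finite A" and small: "\<And>a. a \<in> A \<Longrightarrow> \<sigma> a \<le> (1/4) ^ (i1 + 1)"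
    and lev: "\<And>i. i1 < i \<Longrightarrow> i < J \<Longrightarrow> real (card {a\<in>A. (1/4) ^ (i + 1) \<le> \<sigma> a}) \<le> R * 2 ^ (i + 1)"
    and R: "R \<ge> 0"
  shows "(\<Sum>a\<in>A. \<sigma> a) \<le> 2 * R * (1/2) ^ i1 + real (card A) * (1/4) ^ J"
proof -
  define ind where "ind i a = (if (1/4) ^ (i + 1) \<le> \<sigma> a then 1 else 0 :: real)" for i a
  \<comment> \<open>Raising J by one either adds an indicator equal to 1, whose term 4^-J already
    suffices, or lowers the remainder to 4^-(J+1). Up to i1 the assumption \<open>small\<close> is
    used instead.\<close>
  have pt: "\<sigma> a \<le> (1/4) ^ J + (\<Sum>i\<in>{i1<..<J}. (1/4) ^ i * ind i a)" if a: "a \<in> A" for a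
  proof (induction J)
    case 0
    have "\<sigma> a \<le> 1" using small[OF a] power_le_one[of "1/4::real" "i1 + 1"] by linarith
    then show ?case by simp
  next
    case (Suc J)
    show ?case
    proof (cases "i1 < J")
      case True
      then have "{i1<..<Suc J} = insert J {i1<..<J}" by auto
      then have eq: "(\<Sum>i\<in>{i1<..<Suc J}. (1/4) ^ i * ind i a) = (1/4) ^ J * ind J a + (\<Sum>i\<in>{i1<..<J}. (1/4) ^ i * ind i a)"
        by simp
      have nn: "(\<Sum>i\<in>{i1<..<J}. (1/4) ^ i * ind i a) \<ge> 0" by (intro sum_nonneg) (simp add: ind_def)
      show ?thesis
      proof (cases "(1/4) ^ (J + 1) \<le> \<sigma> a")
        case True
        then have "ind J a = 1" unfolding ind_def by simp
        then have "\<sigma> a \<le> (\<Sum>i\<in>{i1<..<Suc J}. (1/4) ^ i * ind i a)" unfolding eq using Suc by simp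
        moreover have "(1/4::real) ^ Suc J \<ge> 0" by simp
        ultimately show ?thesis by linarith
      next
        case False
        then have "\<sigma> a \<le> (1/4) ^ Suc J" by simp
        moreover have "(1/4) ^ J * ind J a \<ge> 0" unfolding ind_def by simp
        ultimately show ?thesis unfolding eq using nn by linarith
      qed
    next
      case False
      then have le: "(1/4::real) ^ (i1 + 1) \<le> (1/4) ^ Suc J" by (intro power_decreasing) auto
      moreover have "{i1<..<Suc J} = {}" using False by auto
      moreover have "\<sigma> a \<le> (1/4) ^ Suc J" using order_trans[OF small[OF a] le] .
      ultimately show ?thesis by (simp only: sum.empty add_0_right)
    qed
  qed
  have "(\<Sum>a\<in>A. \<sigma> a) \<le> (\<Sum>a\<in>A. (1/4) ^ J + (\<Sum>i\<in>{i1<..<J}. (1/4) ^ i * ind i a))"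
    by (intro sum_mono pt)
  also have "\<dots> = real (card A) * (1/4) ^ J + (\<Sum>i\<in>{i1<..<J}. (1/4) ^ i * (\<Sum>a\<in>A. ind i a))"
    by (simp add: sum.distrib sum_distrib_left sum.swap[of _ A])
  also have "(\<Sum>i\<in>{i1<..<J}. (1/4) ^ i * (\<Sum>a\<in>A. ind i a)) \<le> (\<Sum>i\<in>{i1<..<J}. 2 * R * (1/2) ^ i)"
  proof (rule sum_mono)
    fix i assume i: "i \<in> {i1<..<J}"
    have "(\<Sum>a\<in>A. ind i a) = real (card {a\<in>A. (1/4) ^ (i + 1) \<le> \<sigma> a})"
      unfolding ind_def using A by (simp add: sum.If_cases Int_def)
    then have "(1/4) ^ i * (\<Sum>a\<in>A. ind i a) \<le> (1/4) ^ i * (R * 2 ^ (i + 1))"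
      using lev[of i] i by (intro mult_left_mono) auto
    also have "\<dots> = 2 * R * ((1/4) ^ i * 2 ^ i)" by simp
    also have "(1/4::real) ^ i * 2 ^ i = (1/2) ^ i" by (simp flip: power_mult_distrib)
    finally show "(1/4) ^ i * (\<Sum>a\<in>A. ind i a) \<le> 2 * R * (1/2) ^ i" .
  qed
  also have "\<dots> = 2 * R * (\<Sum>i\<in>{i1<..<J}. (1/2) ^ i)" by (simp add: sum_distrib_left)
  also have "\<dots> \<le> 2 * R * (1/2) ^ i1" using R by (intro mult_left_mono sum_half_powers_le) auto
  finally show ?thesis by simp
qed

section \<open>The second moment and the count of frequencies of a given level\<close>

context polynomial_system
begin

text \<open>J varies because \<open>fourier_lower_bound\<close> drops one coordinate at a
  time.\<close>

definition side_box :: "nat set \<Rightarrow> (nat \<Rightarrow> int) set" where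
  "side_box J = int_box (\<lambda>_. 0) (\<lambda>i. int (side i)) J"

lemma finite_side_box: "J \<subseteq> {1..k} \<Longrightarrow> finite (side_box J)"
  unfolding side_box_def by (rule finite_int_box) (auto intro: finite_subset)

lemma card_side_box: "J \<subseteq> {1..k} \<Longrightarrow> card (side_box J) = (\<Prod>i\<in>J. side i)"
  unfolding side_box_def by (subst card_int_box) (auto intro: finite_subset)

lemma side_box_diff:
  assumes "m \<in> side_box J" "m' \<in> side_box J" "J \<subseteq> {1..k}"
  shows "m - m' \<in> box 1"
proof -
  have z: "m i = 0" "m' i = 0" if "i \<notin> J" for i using assms that unfolding side_box_def int_box_def by auto
  have "(m - m') i = 0" if "i \<notin> {1..k}" for i
  proof -
    have "i \<notin> J" using that assms(3) by blast
    then show ?thesis using z[of i] by simp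
  qed
  then have "m - m' \<in> freqs" unfolding freqs_def by blast
  moreover have "\<bar>scaled_coord i (m - m')\<bar> \<le> 1" if i: "i \<in> {1..k}" for i
  proof -
    have "\<bar>m i - m' i\<bar> \<le> int (side i)"
    proof (cases "i \<in> J")
      case True
      then have "0 \<le> m i" "m i < int (side i)" "0 \<le> m' i" "m' i < int (side i)"
        using assms unfolding side_box_def int_box_def by auto
      then show ?thesis by linarith
    qed (use z in auto)
    then have "\<bar>real_of_int (m i - m' i)\<bar> \<le> real (side i)" by linarith
    then show ?thesis using side_pos[OF i] unfolding scaled_coord_def by (simp add: abs_divide pos_divide_le_eq)
  qed
  ultimately show ?thesis unfolding box_def by blast
qed

text \<open>For fixed m the differences m - m' are distinct and lie in \<open>box 1\<close>.\<close>

lemma pair_sum_le: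
  assumes J: "J \<subseteq> {1..k}" and h: "\<And>a. h a \<ge> (0::real)"
  shows "(\<Sum>m\<in>side_box J. \<Sum>m'\<in>side_box J. h (m - m')) \<le> real (card (side_box J)) * (\<Sum>a\<in>box 1. h a)"
proof -
  have "(\<Sum>m'\<in>side_box J. h (m - m')) \<le> (\<Sum>a\<in>box 1. h a)" if m: "m \<in> side_box J" for m
  proof -
    have "(\<Sum>m'\<in>side_box J. h (m - m')) = sum h ((\<lambda>m'. m - m') ` side_box J)"
      by (subst sum.reindex) (auto intro: inj_onI)
    also have "\<dots> \<le> (\<Sum>a\<in>box 1. h a)"
      using h side_box_diff[OF m _ J] by (intro sum_mono2 finite_box) auto
    finally show ?thesis .
  qed
  then have "(\<Sum>m\<in>side_box J. \<Sum>m'\<in>side_box J. h (m - m')) \<le> (\<Sum>m\<in>side_box J. \<Sum>a\<in>box 1. h a)" by (rule sum_mono)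
  then show ?thesis by simp
qed

definition box_exp_sum :: "nat \<Rightarrow> nat set \<Rightarrow> nat \<Rightarrow> complex" where
  "box_exp_sum q J n = (\<Sum>m\<in>side_box J. ee (\<Sum>i\<in>J. real_of_int (m i) * poly (f i) (real (q * n))))"

lemma box_exp_sum_eq: "J \<subseteq> {1..k} \<Longrightarrow> box_exp_sum q J n = (\<Prod>i\<in>J. \<Sum>c\<in>{0..<int (side i)}. ee (of_int c * poly (f i) (real (q * n))))"
  unfolding box_exp_sum_def side_box_def by (rule sum_ee_int_box) (auto intro: finite_subset)

lemma norm_box_exp_sum_sq:
  assumes J: "J \<subseteq> {1..k}"
  shows "complex_of_real (\<Sum>n\<in>{1..Y}. (norm (box_exp_sum q J n))\<^sup>2) = (\<Sum>m\<in>side_box J. \<Sum>m'\<in>side_box J. \<Sum>n\<in>{1..Y}. ee (phase q (m - m') n))"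
proof -
  have 1: "complex_of_real ((norm (box_exp_sum q J n))\<^sup>2) = (\<Sum>m\<in>side_box J. \<Sum>m'\<in>side_box J. ee (phase q (m - m') n))" for n
  proof -
    have ph: "ee (\<Sum>i\<in>J. real_of_int (m i) * poly (f i) (real (q * n))) * cnj (ee (\<Sum>i\<in>J. real_of_int (m' i) * poly (f i) (real (q * n))))
        = ee (phase q (m - m') n)" if m: "m \<in> side_box J" "m' \<in> side_box J" for m m'
    proof -
      have z: "m i = 0" "m' i = 0" if "i \<notin> J" for i using m that unfolding side_box_def int_box_def by auto
      have "(\<Sum>i\<in>J. real_of_int (m i) * poly (f i) (real (q * n))) - (\<Sum>i\<in>J. real_of_int (m' i) * poly (f i) (real (q * n)))
          = (\<Sum>i\<in>J. real_of_int ((m - m') i) * poly (f i) (real (q * n)))"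
        by (simp add: sum_subtractf left_diff_distrib)
      also have "\<dots> = phase q (m - m') n"
        unfolding phase_eq using J z by (intro sum.mono_neutral_left) auto
      finally show ?thesis by (simp only: ee_diff[symmetric])
    qed
    have "complex_of_real ((norm (box_exp_sum q J n))\<^sup>2) = box_exp_sum q J n * cnj (box_exp_sum q J n)" by (rule complex_norm_square)
    also have "\<dots> = (\<Sum>m\<in>side_box J. \<Sum>m'\<in>side_box J. ee (\<Sum>i\<in>J. real_of_int (m i) * poly (f i) (real (q * n)))
        * cnj (ee (\<Sum>i\<in>J. real_of_int (m' i) * poly (f i) (real (q * n)))))"
      unfolding box_exp_sum_def cnj_sum by (rule sum_product)
    also have "\<dots> = (\<Sum>m\<in>side_box J. \<Sum>m'\<in>side_box J. ee (phase q (m - m') n))"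
      by (intro sum.cong refl ph)
    finally show ?thesis .
  qed
  have "complex_of_real (\<Sum>n\<in>{1..Y}. (norm (box_exp_sum q J n))\<^sup>2) = (\<Sum>n\<in>{1..Y}. \<Sum>m\<in>side_box J. \<Sum>m'\<in>side_box J. ee (phase q (m - m') n))"
    unfolding of_real_sum 1 ..
  also have "\<dots> = (\<Sum>m\<in>side_box J. \<Sum>n\<in>{1..Y}. \<Sum>m'\<in>side_box J. ee (phase q (m - m') n))" by (rule sum.swap)
  also have "\<dots> = (\<Sum>m\<in>side_box J. \<Sum>m'\<in>side_box J. \<Sum>n\<in>{1..Y}. ee (phase q (m - m') n))"
    by (intro sum.cong refl sum.swap)
  finally show ?thesis .
qed

text \<open>At q n <= X / (32 Z) the error of the j-th coefficient contributes at most 32^-j. The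
  total 1/16, times the Lipschitz constant 8 of \<open>ee\<close>, is the 1/2 needed in
  \<open>Re_sum_phase_ge\<close>.\<close>

lemma near_phase:
  assumes a: "a \<in> lam q Z 1" and q: "q \<ge> 1" and n: "n \<in> {1..Y}" and Y: "real (q * Y) \<le> X / (32 * real Z)" and Z: "Z \<ge> 1"
  shows "near (phase q a n) (1/16)"
proof -
  have "{..d} = insert 0 {1..d}" by auto
  then have ph: "phase q a n = (\<Sum>j\<in>{1..d}. (freq_coeff j a * real q ^ j) * real n ^ j)"
    unfolding phase_def by (simp add: freq_coeff_0)
  have "near ((freq_coeff j a * real q ^ j) * real n ^ j) ((1/32) ^ j)" if j: "j \<in> {1..d}" for j
  proof -
    obtain b :: int where b: "\<bar>freq_coeff j a - b / real q ^ j\<bar> \<le> 1 * (real Z / X) ^ j" using a j unfolding lam_def by blast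
    have "(freq_coeff j a * real q ^ j) * real n ^ j - of_int (b * int n ^ j) = (freq_coeff j a - b / real q ^ j) * (real q ^ j * real n ^ j)"
      using q by (simp add: field_simps)
    then have "\<bar>(freq_coeff j a * real q ^ j) * real n ^ j - of_int (b * int n ^ j)\<bar> = \<bar>freq_coeff j a - b / real q ^ j\<bar> * (real q ^ j * real n ^ j)"
      by (simp add: abs_mult)
    also have "\<dots> \<le> (real Z / X) ^ j * (real q ^ j * real n ^ j)" using b by (intro mult_right_mono) auto
    also have "\<dots> = (real Z / X * real (q * n)) ^ j" by (simp only: power_mult_distrib of_nat_mult)
    also have "\<dots> \<le> (1/32) ^ j"
    proof (rule power_mono)
      have "real (q * n) \<le> real (q * Y)" using n by (intro of_nat_mono mult_le_mono) auto
      then have "real (q * n) \<le> X / (32 * real Z)" using Y by linarith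
      then have "real Z / X * real (q * n) \<le> real Z / X * (X / (32 * real Z))"
        using X_pos' by (intro mult_left_mono) auto
      also have "\<dots> = 1/32" using X_pos' Z by simp
      finally show "real Z / X * real (q * n) \<le> 1/32" .
    qed (use X_pos' in auto)
    finally show ?thesis unfolding near_def by blast
  qed
  then have "near (phase q a n) (\<Sum>j\<in>{1..d}. (1/32) ^ j)" unfolding ph by (rule near_sum)
  then show ?thesis using sum_powers_32_le near_mono by blast
qed

lemma Re_sum_phase_ge:
  assumes a: "a \<in> lam q Z 1" and q: "q \<ge> 1" and Y: "real (q * Y) \<le> X / (32 * real Z)" and Z: "Z \<ge> 1"
  shows "Re (\<Sum>n\<in>{1..Y}. ee (phase q a n)) \<ge> real Y / 2"
proof -
  have "Re (ee (phase q a n)) \<ge> 1/2" if n: "n \<in> {1..Y}" for n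
  proof -
    have "near (phase q a n - 0) (1/16)" using near_phase[OF a q n Y Z] by simp
    then have "norm (ee (phase q a n) - ee 0) \<le> 8 * (1/16)" by (rule norm_ee_diff_le_near)
    then have "\<bar>Re (ee (phase q a n) - 1)\<bar> \<le> 1/2" using abs_Re_le_cmod[of "ee (phase q a n) - 1"] by simp
    then have "\<bar>Re (ee (phase q a n)) - 1\<bar> \<le> 1/2" by simp
    then show ?thesis by linarith
  qed
  then have "(\<Sum>n\<in>{1..Y}. Re (ee (phase q a n))) \<ge> (\<Sum>n\<in>{1..Y}. 1/2)" by (rule sum_mono)
  then show ?thesis by simp
qed

text \<open>2^k is lost by restricting to the middle half of the box and 10^D by shrinking
  \<open>lam q Z 1\<close> to scale 1/4; the factor 4 leaves room in
  \<open>fourier_lower_bound\<close>.\<close>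

definition \<nu> :: real where
  "\<nu> = 1 / (4 * 2 ^ k * 10 ^ D)"

lemma \<nu>_bounds: "0 < \<nu>" "\<nu> \<le> 1"
proof -
  have "1 \<le> (4::real) * 2 ^ k * 10 ^ D"
  proof -
    have "(1::real) \<le> 2 ^ k" "(1::real) \<le> 10 ^ D" by (rule one_le_power, simp)+
    moreover from this(1) have "1 \<le> 4 * (2::real) ^ k" by linarith
    ultimately have "1 * 1 \<le> (4 * 2 ^ k) * (10::real) ^ D" by (intro mult_mono) auto
    then show ?thesis by simp
  qed
  then show "0 < \<nu>" "\<nu> \<le> 1" unfolding \<nu>_def by auto
qed

text \<open>
  Pairs \<open>(m + a, m)\<close> with \<open>m\<close> in the middle half of the box and \<open>a \<in> lam q Z (1/4)\<close> lie in the
  box; this is why the side lengths are multiples of 4.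
\<close>

lemma card_pairs_ge:
  assumes Z: "Z \<ge> 1"
  shows "4 * \<nu> * real (card (side_box {1..k})) * real (card (lam q Z 1))
     \<le> real (card {p \<in> side_box {1..k} \<times> side_box {1..k}. fst p - snd p \<in> lam q Z 1})"
proof -
  define Mid where "Mid = int_box (\<lambda>i. int (n0 i)) (\<lambda>i. 3 * int (n0 i)) {1..k}"
  have cMid: "real (card Mid) = real (card (side_box {1..k})) / 2 ^ k"
  proof -
    have "real (card Mid) = (\<Prod>i\<in>{1..k}. real (side i) / 2)"
      unfolding Mid_def by (simp add: card_int_box side_def)
    also have "\<dots> = (\<Prod>i\<in>{1..k}. real (side i)) / 2 ^ k" by (simp add: prod_dividef)
    finally show ?thesis by (simp add: card_side_box)
  qed
  have "real (card (lam q Z (4 * (1/4)))) \<le> (2 * 4 + 2) ^ D * real (card (lam q Z (1/4)))"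
    using Z by (intro card_lam_scale_le) auto
  then have c1: "real (card (lam q Z 1)) \<le> 10 ^ D * real (card (lam q Z (1/4)))" by simp
  have "card (lam q Z (1/4) \<times> Mid) \<le> card {p \<in> side_box {1..k} \<times> side_box {1..k}. fst p - snd p \<in> lam q Z 1}"
  proof (rule card_inj_on_le)
    show "inj_on (\<lambda>(a, m). (m + a, m)) (lam q Z (1/4) \<times> Mid)" by (auto intro!: inj_onI)
    show "finite {p \<in> side_box {1..k} \<times> side_box {1..k}. fst p - snd p \<in> lam q Z 1}" using finite_side_box by auto
    show "(\<lambda>(a, m). (m + a, m)) ` (lam q Z (1/4) \<times> Mid) \<subseteq> {p \<in> side_box {1..k} \<times> side_box {1..k}. fst p - snd p \<in> lam q Z 1}"
    proof clarify
      fix a m assume a: "a \<in> lam q Z (1/4)" and m: "m \<in> Mid"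
      have mi: "int (n0 i) \<le> m i" "m i < 3 * int (n0 i)" if "i \<in> {1..k}" for i using m that unfolding Mid_def int_box_def by auto
      have mz: "m i = 0" "a i = 0" if "i \<notin> {1..k}" for i using m lam_S[OF a] that unfolding Mid_def int_box_def freqs_def by auto
      have ai: "\<bar>a i\<bar> \<le> int (n0 i)" if i: "i \<in> {1..k}" for i
      proof -
        have "\<bar>scaled_coord i a\<bar> \<le> 1/4" using lam_box[OF a] i unfolding box_def by auto
        then have "\<bar>real_of_int (a i)\<bar> / real (side i) \<le> 1/4" unfolding scaled_coord_def by (simp add: abs_divide)
        then have "\<bar>real_of_int (a i)\<bar> \<le> 1/4 * real (side i)" using side_pos[OF i] by (simp only: pos_divide_le_eq)
        then have "\<bar>real_of_int (a i)\<bar> \<le> real (n0 i)" unfolding side_def by simp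
        then show ?thesis by linarith
      qed
      have "m \<in> side_box {1..k}" unfolding side_box_def int_box_def side_def using mi mz by force
      moreover have "m + a \<in> side_box {1..k}"
      proof -
        have "0 \<le> (m + a) i \<and> (m + a) i < int (side i)" if i: "i \<in> {1..k}" for i
          using mi[OF i] ai[OF i] unfolding side_def by (auto simp: abs_le_iff)
        then show ?thesis unfolding side_box_def int_box_def using mz by auto
      qed
      moreover have "fst (m + a, m) - snd (m + a, m) = a" by simp
      moreover have "a \<in> lam q Z 1"
      proof -
        have "a \<in> box 1" using lam_box[OF a] box_mono[of "1/4" 1] by auto
        moreover have "\<exists>b::int. \<bar>freq_coeff j a - b / real q ^ j\<bar> \<le> 1 * (real Z / X) ^ j" if j: "j \<in> {1..d}" for j
        proof -
          obtain b :: int where "\<bar>freq_coeff j a - b / real q ^ j\<bar> \<le> 1/4 * (real Z / X) ^ j" using a j unfolding lam_def by blast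
          moreover have "1/4 * (real Z / X) ^ j \<le> 1 * (real Z / X) ^ j" using X_pos' by (intro mult_right_mono) auto
          ultimately show ?thesis by (intro exI[of _ b]) linarith
        qed
        ultimately show ?thesis unfolding lam_def by blast
      qed
      ultimately show "(m + a, m) \<in> side_box {1..k} \<times> side_box {1..k} \<and> fst (m + a, m) - snd (m + a, m) \<in> lam q Z 1"
        by simp
    qed
  qed
  then have "real (card (lam q Z (1/4))) * real (card Mid) \<le> real (card {p \<in> side_box {1..k} \<times> side_box {1..k}. fst p - snd p \<in> lam q Z 1})"
    by (simp add: card_cartesian_product flip: of_nat_mult)
  moreover have "4 * \<nu> * real (card (side_box {1..k})) * real (card (lam q Z 1)) \<le> real (card (lam q Z (1/4))) * real (card Mid)"
  proof -
    have "4 * \<nu> * real (card (side_box {1..k})) * real (card (lam q Z 1)) = real (card Mid) * (real (card (lam q Z 1)) / 10 ^ D)"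
      unfolding \<nu>_def cMid by simp
    also have "\<dots> \<le> real (card Mid) * real (card (lam q Z (1/4)))"
      using c1 by (intro mult_left_mono) (auto simp: pos_divide_le_eq mult.commute)
    finally show ?thesis by (simp add: mult.commute)
  qed
  ultimately show ?thesis by linarith
qed

text \<open>
  Without a solution the second moment of \<open>box_exp_sum\<close> is small, as for each \<open>n\<close> one factor of
  the product of geometric sums is.  Expanding the square, the frequency differences in
  \<open>lam q Z 1\<close> contribute a large positive real part, which the others have to compensate.
\<close>

lemma fourier_lower_bound:
  assumes q: "q \<ge> 1" "Z \<ge> 1" and Y: "Y \<ge> 1" "real (q * Y) \<le> X / (32 * real Z)"
    and eps: "\<And>i. i \<in> {1..k} \<Longrightarrow> \<epsilon> i > 0" "(\<Sum>i\<in>{1..k}. 1 / (4 * (\<epsilon> i)\<^sup>2 * real (side i))) \<le> \<nu>"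
    and nosol: "\<And>n. n \<in> {1..Y} \<Longrightarrow> \<exists>i\<in>{1..k}. \<not> near (poly (f i) (real (q * n))) (\<epsilon> i)"
  shows "\<nu> / 2 * real (card (lam q Z 1)) \<le> (\<Sum>a\<in>box 1 - lam q Z 1. \<sigma> q Y a)"
proof -
  define I where "I = {1..k}"
  define B where "B = side_box I"
  define \<Lambda> where "\<Lambda> = lam q Z 1"
  define R where "R = (\<Sum>a\<in>box 1 - \<Lambda>. \<sigma> q Y a)"
  define c where "c a = (\<Sum>n\<in>{1..Y}. ee (phase q a n))" for a
  have norm_c: "norm (c a) = real Y * \<sigma> q Y a" for a unfolding c_def \<sigma>_def using Y by simp
  have \<Lambda>box: "\<Lambda> \<subseteq> box 1" unfolding \<Lambda>_def using lam_box by auto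
  have finB: "finite B" unfolding B_def I_def by (rule finite_side_box) simp
  have Y0: "real Y > 0" using Y by simp
  have total: "(\<Sum>a\<in>box 1. \<sigma> q Y a) \<le> real (card \<Lambda>) + R"
  proof -
    have "(\<Sum>a\<in>box 1. \<sigma> q Y a) = R + (\<Sum>a\<in>\<Lambda>. \<sigma> q Y a)"
      unfolding R_def using \<Lambda>box finite_box by (rule sum.subset_diff)
    also have "(\<Sum>a\<in>\<Lambda>. \<sigma> q Y a) \<le> (\<Sum>a\<in>\<Lambda>. 1)" by (intro sum_mono \<sigma>_le_1)
    finally show ?thesis by simp
  qed
  \<comment> \<open>A bound by absolute values; it is applied with one coordinate removed from the
    index set.\<close>
  have upper: "(\<Sum>n\<in>{1..Y}. (norm (box_exp_sum q J n))\<^sup>2) \<le> real Y * real (card (side_box J)) * (real (card \<Lambda>) + R)" if J: "J \<subseteq> {1..k}" for J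
  proof -
    have "(\<Sum>n\<in>{1..Y}. (norm (box_exp_sum q J n))\<^sup>2) = norm (complex_of_real (\<Sum>n\<in>{1..Y}. (norm (box_exp_sum q J n))\<^sup>2))"
      by (simp only: norm_of_real abs_of_nonneg sum_nonneg zero_le_power2)
    also have "\<dots> \<le> (\<Sum>m\<in>side_box J. \<Sum>m'\<in>side_box J. norm (c (m - m')))"
      unfolding norm_box_exp_sum_sq[OF J] c_def by (intro order_trans[OF norm_sum] sum_mono norm_sum)
    also have "\<dots> \<le> real (card (side_box J)) * (\<Sum>a\<in>box 1. norm (c a))" by (rule pair_sum_le[OF J]) simp
    also have "(\<Sum>a\<in>box 1. norm (c a)) = real Y * (\<Sum>a\<in>box 1. \<sigma> q Y a)" by (simp add: norm_c sum_distrib_left)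
    also have "real (card (side_box J)) * (real Y * (\<Sum>a\<in>box 1. \<sigma> q Y a)) \<le> real (card (side_box J)) * (real Y * (real (card \<Lambda>) + R))"
      using total by (intro mult_left_mono) auto
    finally show ?thesis by (simp add: mult_ac)
  qed
  have lower: "real Y * real (card B) * (2 * \<nu> * real (card \<Lambda>) - R) \<le> (\<Sum>n\<in>{1..Y}. (norm (box_exp_sum q I n))\<^sup>2)"
  proof -
    have "(\<Sum>n\<in>{1..Y}. (norm (box_exp_sum q I n))\<^sup>2) = Re (complex_of_real (\<Sum>n\<in>{1..Y}. (norm (box_exp_sum q I n))\<^sup>2))" by (rule Re_complex_of_real[symmetric])
    also have "\<dots> = (\<Sum>m\<in>B. \<Sum>m'\<in>B. Re (c (m - m')))"
      unfolding norm_box_exp_sum_sq[of I, unfolded I_def, OF order_refl, folded I_def] c_def B_def by simp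
    finally have eq: "(\<Sum>n\<in>{1..Y}. (norm (box_exp_sum q I n))\<^sup>2) = (\<Sum>m\<in>B. \<Sum>m'\<in>B. Re (c (m - m')))" .
    define u where "u a = (if a \<in> \<Lambda> then 1 else 0 :: real)" for a
    define w where "w a = (if a \<in> \<Lambda> then 0 else \<sigma> q Y a)" for a
    \<comment> \<open>Relations count positively with weight Y / 2. Nothing is known about the signs
      of the other terms, so they are subtracted with their full modulus.\<close>
    have pt: "Re (c a) \<ge> real Y / 2 * u a - real Y * w a" for a
    proof (cases "a \<in> \<Lambda>")
      case True
      then show ?thesis using Re_sum_phase_ge[of a q Z Y] q Y unfolding u_def w_def c_def \<Lambda>_def by simp
    next
      case False
      then show ?thesis using abs_Re_le_cmod[of "c a"] norm_c[of a] unfolding u_def w_def by simp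
    qed
    have "(\<Sum>m\<in>B. \<Sum>m'\<in>B. Re (c (m - m'))) \<ge> (\<Sum>m\<in>B. \<Sum>m'\<in>B. real Y / 2 * u (m - m') - real Y * w (m - m'))"
      by (intro sum_mono pt)
    moreover have "(\<Sum>m\<in>B. \<Sum>m'\<in>B. real Y / 2 * u (m - m') - real Y * w (m - m'))
      = real Y / 2 * (\<Sum>m\<in>B. \<Sum>m'\<in>B. u (m - m')) - real Y * (\<Sum>m\<in>B. \<Sum>m'\<in>B. w (m - m'))"
      by (simp add: sum_subtractf sum_distrib_left)
    moreover have "(\<Sum>m\<in>B. \<Sum>m'\<in>B. w (m - m')) \<le> real (card B) * R"
    proof -
      have "(\<Sum>m\<in>B. \<Sum>m'\<in>B. w (m - m')) \<le> real (card B) * (\<Sum>a\<in>box 1. w a)"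
        unfolding B_def I_def by (rule pair_sum_le) (auto simp: w_def \<sigma>_nonneg)
      also have "(\<Sum>a\<in>box 1. w a) = R"
        unfolding R_def w_def using finite_box[of 1] by (simp add: sum.If_cases Diff_eq)
      finally show ?thesis .
    qed
    moreover have "(\<Sum>m\<in>B. \<Sum>m'\<in>B. u (m - m')) \<ge> 4 * \<nu> * real (card B) * real (card \<Lambda>)"
    proof -
      have "(\<Sum>m\<in>B. \<Sum>m'\<in>B. u (m - m')) = (\<Sum>p\<in>B \<times> B. if fst p - snd p \<in> \<Lambda> then 1 else 0)"
        unfolding u_def by (simp add: sum.cartesian_product case_prod_beta)
      also have "\<dots> = real (card {p \<in> B \<times> B. fst p - snd p \<in> \<Lambda>})"
        using finB by (simp add: sum.If_cases Int_def)
      finally show ?thesis using card_pairs_ge[OF q(2), of q] unfolding B_def I_def \<Lambda>_def by simp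
    qed
    ultimately have "(\<Sum>n\<in>{1..Y}. (norm (box_exp_sum q I n))\<^sup>2) \<ge> real Y / 2 * (4 * \<nu> * real (card B) * real (card \<Lambda>)) - real Y * (real (card B) * R)"
      unfolding eq using mult_left_mono[of "4 * \<nu> * real (card B) * real (card \<Lambda>)" "\<Sum>m\<in>B. \<Sum>m'\<in>B. u (m - m')" "real Y / 2"]
        mult_left_mono[of "\<Sum>m\<in>B. \<Sum>m'\<in>B. w (m - m')" "real (card B) * R" "real Y"] by linarith
    then show ?thesis by (simp add: algebra_simps)
  qed
  \<comment> \<open>The coordinate i that fails at n has a geometric sum of size at most 1 / (2
    eps_i). As i depends on n, all coordinates are summed.\<close>
  have pointwise: "(norm (box_exp_sum q I n))\<^sup>2 \<le> (\<Sum>i\<in>I. 1 / (4 * (\<epsilon> i)\<^sup>2) * (norm (box_exp_sum q (I - {i}) n))\<^sup>2)" if n: "n \<in> {1..Y}" for n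
  proof -
    obtain i where i: "i \<in> I" "\<not> near (poly (f i) (real (q * n))) (\<epsilon> i)" using nosol[OF n] unfolding I_def by blast
    define s where "s l = (\<Sum>c\<in>{0..<int (side l)}. ee (of_int c * poly (f l) (real (q * n))))" for l
    have "box_exp_sum q I n = (\<Prod>l\<in>I. s l)" unfolding s_def I_def by (rule box_exp_sum_eq) simp
    also have "\<dots> = s i * (\<Prod>l\<in>I - {i}. s l)" using i(1) by (intro prod.remove) (auto simp: I_def)
    also have "(\<Prod>l\<in>I - {i}. s l) = box_exp_sum q (I - {i}) n" unfolding s_def I_def by (rule box_exp_sum_eq[symmetric]) auto
    finally have "(norm (box_exp_sum q I n))\<^sup>2 = (norm (s i))\<^sup>2 * (norm (box_exp_sum q (I - {i}) n))\<^sup>2"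
      by (simp add: norm_mult power_mult_distrib)
    also have "\<dots> \<le> (1 / (2 * \<epsilon> i))\<^sup>2 * (norm (box_exp_sum q (I - {i}) n))\<^sup>2"
      unfolding s_def using norm_sum_ee_int_le[OF i(2)] eps(1)[of i] i(1) unfolding I_def
      by (intro mult_right_mono power_mono) auto
    also have "(1 / (2 * \<epsilon> i))\<^sup>2 = 1 / (4 * (\<epsilon> i)\<^sup>2)" by (simp add: power_divide power_mult_distrib)
    also have "1 / (4 * (\<epsilon> i)\<^sup>2) * (norm (box_exp_sum q (I - {i}) n))\<^sup>2 \<le> (\<Sum>i\<in>I. 1 / (4 * (\<epsilon> i)\<^sup>2) * (norm (box_exp_sum q (I - {i}) n))\<^sup>2)"
      using i(1) by (intro member_le_sum) (auto simp: I_def)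
    finally show ?thesis .
  qed
  have R0: "R \<ge> 0" unfolding R_def by (intro sum_nonneg \<sigma>_nonneg)
  have "real Y * real (card B) * (2 * \<nu> * real (card \<Lambda>) - R) \<le> (\<Sum>n\<in>{1..Y}. \<Sum>i\<in>I. 1 / (4 * (\<epsilon> i)\<^sup>2) * (norm (box_exp_sum q (I - {i}) n))\<^sup>2)"
    using lower by (rule order_trans) (intro sum_mono pointwise)
  also have "\<dots> = (\<Sum>i\<in>I. 1 / (4 * (\<epsilon> i)\<^sup>2) * (\<Sum>n\<in>{1..Y}. (norm (box_exp_sum q (I - {i}) n))\<^sup>2))"
    unfolding sum_distrib_left by (rule sum.swap)
  also have "\<dots> \<le> (\<Sum>i\<in>I. 1 / (4 * (\<epsilon> i)\<^sup>2 * real (side i)) * (real Y * real (card B) * (real (card \<Lambda>) + R)))"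
  proof (rule sum_mono)
    fix i assume i: "i \<in> I"
    have N0: "real (side i) > 0" using side_pos[of i] i unfolding I_def by simp
    \<comment> \<open>Dropping coordinate i divides the number of frequencies by
      \<open>side i\<close>; by the hypothesis on the side lengths this outweighs the factor
      eps_i^-2.\<close>
    have "card B = side i * card (side_box (I - {i}))"
    proof -
      have "card B = (\<Prod>i\<in>I. side i)" unfolding B_def I_def by (rule card_side_box) simp
      also have "\<dots> = side i * (\<Prod>i\<in>I - {i}. side i)" using i by (intro prod.remove) (auto simp: I_def)
      also have "(\<Prod>i\<in>I - {i}. side i) = card (side_box (I - {i}))" unfolding I_def by (rule card_side_box[symmetric]) auto
      finally show ?thesis .
    qed
    then have cB: "real (card (side_box (I - {i}))) = real (card B) / real (side i)" using N0 by simp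
    have "(\<Sum>n\<in>{1..Y}. (norm (box_exp_sum q (I - {i}) n))\<^sup>2) \<le> real Y * real (card (side_box (I - {i}))) * (real (card \<Lambda>) + R)"
      by (rule upper) (auto simp: I_def)
    then have "1 / (4 * (\<epsilon> i)\<^sup>2) * (\<Sum>n\<in>{1..Y}. (norm (box_exp_sum q (I - {i}) n))\<^sup>2)
        \<le> 1 / (4 * (\<epsilon> i)\<^sup>2) * (real Y * real (card (side_box (I - {i}))) * (real (card \<Lambda>) + R))"
      by (intro mult_left_mono) auto
    also have "\<dots> = 1 / (4 * (\<epsilon> i)\<^sup>2 * real (side i)) * (real Y * real (card B) * (real (card \<Lambda>) + R))"
      unfolding cB by simp
    finally show "1 / (4 * (\<epsilon> i)\<^sup>2) * (\<Sum>n\<in>{1..Y}. (norm (box_exp_sum q (I - {i}) n))\<^sup>2)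
        \<le> 1 / (4 * (\<epsilon> i)\<^sup>2 * real (side i)) * (real Y * real (card B) * (real (card \<Lambda>) + R))" .
  qed
  also have "\<dots> = (\<Sum>i\<in>I. 1 / (4 * (\<epsilon> i)\<^sup>2 * real (side i))) * (real Y * real (card B) * (real (card \<Lambda>) + R))"
    by (rule sum_distrib_right[symmetric])
  also have "\<dots> \<le> \<nu> * (real Y * real (card B) * (real (card \<Lambda>) + R))"
    using eps(2) R0 unfolding I_def by (intro mult_right_mono) auto
  finally have "(real Y * real (card B)) * (2 * \<nu> * real (card \<Lambda>) - R) \<le> (real Y * real (card B)) * (\<nu> * (real (card \<Lambda>) + R))"
    by (simp add: mult_ac)
  moreover have "real (card B) > 0" unfolding B_def I_def using side_pos by (simp add: card_side_box) (rule prod_pos, force)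
  ultimately have "2 * \<nu> * real (card \<Lambda>) - R \<le> \<nu> * (real (card \<Lambda>) + R)" using Y0 by simp
  moreover have "\<nu> * R \<le> 1 * R" using \<nu>_bounds R0 by (intro mult_right_mono) auto
  ultimately have "\<nu> * real (card \<Lambda>) \<le> 2 * R" by (simp add: algebra_simps)
  then show ?thesis unfolding R_def \<Lambda>_def by simp
qed

text \<open>
  Otherwise \<open>tuples_bound\<close>, with \<open>s\<close> chosen according to the size of \<open>vol\<close>, would give more
  than \<open>(3 s) ^ k * vol\<close> elements of \<open>box s\<close>.
\<close>

lemma level_set_card_le:
  fixes Q s0 m :: nat and c1 c U t :: real
  assumes cl: "cleared c U q Z t" and t: "t \<ge> 1" "4 * real D \<le> t" and U: "U > 0"
    and c1: "0 < c1" "c1 \<le> 1" "c = c1 / 32" and Qt: "2 * t < (real Q)\<^sup>2" and vol: "vol \<le> t ^ k"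
    and s0: "16 * real k \<le> c1 * real s0" and m: "256 * (real s0)\<^sup>2 \<le> c1\<^sup>2 * real m"
    and H1: "2 * real s0 * real m ^ (2 ^ m) \<le> real Q powr (c1\<^sup>2 / (128 * real s0))"
    and H2: "6 ^ D * 2 * 2 ^ s0 * real m ^ (2 ^ m) * U \<le> real Q powr (c1 / 8)"
    and H3: "(3 * real s0) ^ k < real Q powr (c1 / 8)"
    and X: "4 * real s0 * real Z * (real q)\<^sup>2 * real Q ^ 5 * vol powr (16 / c1) < X"
  shows "real (card (level_set q Z Q)) \<le> real Q powr c1 * real (card (lam q Z 1))"
proof (rule ccontr)
  assume "\<not> ?thesis"
  then have big: "real Q powr c1 * real (card (lam q Z 1)) \<le> real (card (level_set q Z Q))" by simp
  have s01: "s0 \<ge> 1" using s0 k_pos c1 by (cases s0) auto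
  have "0 < c1\<^sup>2 * real m" using m s01 by (elim less_le_trans[rotated]) auto
  then have m1: "m \<ge> 1" by (cases m) auto
  have "(1::real) < (real Q)\<^sup>2" using Qt t by linarith
  then have Q1: "real Q \<ge> 1" by (cases Q) auto
  then have Qn: "Q \<ge> 1" by simp
  have pinc: "real Q powr a \<le> real Q powr b" if "a \<le> b" for a b using that Q1 by (intro powr_mono) auto
  have volQ: "vol \<le> real Q powr (real s0 * (c1 / 8))"
  proof -
    have "t \<le> (real Q)\<^sup>2" using Qt t by linarith
    then have "t ^ k \<le> ((real Q)\<^sup>2) ^ k" using t by (intro power_mono) auto
    also have "\<dots> = real Q powr (real (2 * k))" using Q1 by (simp only: powr_realpow power_mult[symmetric])
    also have "\<dots> \<le> real Q powr (real s0 * (c1 / 8))" using s0 by (intro pinc) (simp add: mult.commute)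
    finally show ?thesis using vol by linarith
  qed
  \<comment> \<open>The least s for which Q^(s c1/8) reaches \<open>vol\<close>. Minimality bounds
    Q^s by Q vol^(8/c1), where the power of \<open>vol\<close> does not depend on k; only s <= s0
    does.\<close>
  define s where "s = (LEAST s. 1 \<le> s \<and> vol \<le> real Q powr (real s * (c1 / 8)))"
  have s: "1 \<le> s" "vol \<le> real Q powr (real s * (c1 / 8))"
    unfolding s_def using LeastI[of "\<lambda>s. 1 \<le> s \<and> vol \<le> real Q powr (real s * (c1 / 8))" s0] s01 volQ by auto
  have ss0: "s \<le> s0" unfolding s_def by (rule Least_le) (use s01 volQ in auto)
  have Qs: "real Q ^ s \<le> real Q * vol powr (8 / c1)"
  proof (cases "s = 1")
    case True
    have "1 \<le> vol powr (8 / c1)" using vol_ge_1 c1 by (intro ge_one_powr_ge_zero) auto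
    then show ?thesis using True Q1 by simp
  next
    case False
    then have "\<not> (1 \<le> s - 1 \<and> vol \<le> real Q powr (real (s - 1) * (c1 / 8)))"
      unfolding s_def using s(1) by (intro not_less_Least) (auto simp: s_def)
    then have "real Q powr (real (s - 1) * (c1 / 8)) \<le> vol" using False s(1) by auto
    then have "(real Q powr (real (s - 1) * (c1 / 8))) powr (8 / c1) \<le> vol powr (8 / c1)"
      using c1 by (intro powr_mono2) auto
    moreover have "(real Q powr (real (s - 1) * (c1 / 8))) powr (8 / c1) = real Q ^ (s - 1)"
    proof -
      have "(real Q powr (real (s - 1) * (c1 / 8))) powr (8 / c1) = real Q powr (real (s - 1) * (c1 / 8) * (8 / c1))" by (rule powr_powr)
      also have "real (s - 1) * (c1 / 8) * (8 / c1) = real (s - 1)" using c1 by simp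
      also have "real Q powr real (s - 1) = real Q ^ (s - 1)" using Q1 by (intro powr_realpow) simp
      finally show ?thesis .
    qed
    ultimately have "real Q ^ (s - 1) \<le> vol powr (8 / c1)" by simp
    then have "real Q * real Q ^ (s - 1) \<le> real Q * vol powr (8 / c1)" by (intro mult_left_mono) auto
    moreover have "real Q * real Q ^ (s - 1) = real Q ^ s" using s(1) by (cases s) auto
    ultimately show ?thesis by simp
  qed
  \<comment> \<open>Chosen so that E^s costs at most Q^(c1/32), up to the factor 2^s0, for every s
    <= s0.\<close>
  define e where "e = c1 / (32 * real s0)"
  have e: "0 < e" "e \<le> 1" unfolding e_def using c1 s01 by (auto simp: pos_divide_le_eq)
  define E where "E = nat \<lceil>real Q powr e\<rceil>"
  have Qe1: "real Q powr e \<ge> 1" using Q1 e by (intro ge_one_powr_ge_zero) auto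
  have E12: "real Q powr e \<le> real E" "real E \<le> 2 * real Q powr e" unfolding E_def using Qe1 by linarith+
  then have "real E \<ge> 1" using Qe1 by linarith
  then have E: "real Q powr e \<le> real E" "real E \<le> 2 * real Q powr e" "E \<ge> 1" using E12 by simp_all
  have EQ: "E \<le> Q"
  proof -
    have "real Q powr e \<le> real Q powr 1" by (rule pinc[OF e(2)])
    then have "real Q powr e \<le> real Q" using Q1 by simp
    then have "\<lceil>real Q powr e\<rceil> \<le> int Q" by (simp add: ceiling_le_iff)
    then show ?thesis unfolding E_def by (simp only: nat_le_iff)
  qed
  define P where "P = real m ^ (2 ^ m)"
  have P1: "P \<ge> 1" unfolding P_def using m1 by (intro one_le_power) simp
  \<comment> \<open>Half of e c1/2: one factor Q^b bounds the power of n in the divisor bound, the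
    other absorbs the constants through \<open>H1\<close>.\<close>
  define b where "b = c1\<^sup>2 / (128 * real s0)"
  define T where "T = P * real Q powr b"
  have T: "real (divisor_count n) \<le> T" if n: "1 \<le> n" "n \<le> Q ^ s * E ^ s" for n
  proof -
    have "Q ^ s * E ^ s \<le> Q ^ s * Q ^ s" using EQ by (intro mult_le_mono power_mono) auto
    then have "n \<le> Q ^ s * Q ^ s" using n(2) by linarith
    also have "\<dots> = Q ^ (2 * s)" by (simp add: mult_2 power_add)
    also have "\<dots> \<le> Q ^ (2 * s0)" using ss0 Qn by (intro power_increasing) auto
    finally have "real n \<le> real Q ^ (2 * s0)" unfolding of_nat_power[symmetric] by (rule of_nat_mono)
    then have "real n powr (1 / m) \<le> (real Q ^ (2 * s0)) powr (1 / m)" by (intro powr_mono2) auto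
    also have "\<dots> = real Q powr (real (2 * s0) * (1 / m))" using Q1 by (simp only: powr_realpow[symmetric] powr_powr)
    also have "\<dots> \<le> real Q powr b"
    proof (rule pinc)
      have "256 * (real s0)\<^sup>2 / (128 * real s0) \<le> c1\<^sup>2 * real m / (128 * real s0)" using m by (rule divide_right_mono) simp
      then have "2 * real s0 \<le> b * real m" unfolding b_def using s01 by (simp add: power2_eq_square)
      then show "real (2 * s0) * (1 / real m) \<le> b" using m1 by (simp add: pos_divide_le_eq)
    qed
    finally have "real n powr (1 / m) \<le> real Q powr b" .
    then have "P * real n powr (1 / m) \<le> T" unfolding T_def using P1 by (intro mult_left_mono) auto
    then show ?thesis using divisor_bound[OF m1 n(1)] unfolding P_def by linarith
  qed
  have Qb: "real Q powr b \<ge> 1" unfolding b_def using Q1 by (intro ge_one_powr_ge_zero) auto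
  have TE: "2 * real s * T \<le> real E powr (c1 / 2)"
  proof -
    have "2 * real s * T \<le> 2 * real s0 * T" using ss0 P1 Qb unfolding T_def by (intro mult_right_mono) auto
    also have "\<dots> = (2 * real s0 * P) * real Q powr b" unfolding T_def by simp
    also have "\<dots> \<le> real Q powr b * real Q powr b" using H1 unfolding P_def b_def by (intro mult_right_mono) auto
    also have "\<dots> = real Q powr (b + b)" by (rule powr_add[symmetric])
    also have "b + b = e * (c1 / 2)" unfolding b_def e_def using s01 by (simp add: power2_eq_square field_simps)
    also have "real Q powr (e * (c1 / 2)) = (real Q powr e) powr (c1 / 2)" by (rule powr_powr[symmetric])
    also have "\<dots> \<le> real E powr (c1 / 2)" using E(1) c1 by (intro powr_mono2) auto
    finally show ?thesis .
  qed
  have XX: "2 * real s * real (Z * Q) * real (q * Q * (q * (Q * (Q ^ s * Q ^ s)))) < X / 2"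
  proof -
    have "(real Q ^ s)\<^sup>2 \<le> (real Q * vol powr (8 / c1))\<^sup>2" using Qs by (intro power_mono) auto
    also have "\<dots> = (real Q)\<^sup>2 * vol powr (16 / c1)"
    proof -
      have "(vol powr (8 / c1))\<^sup>2 = vol powr (8 / c1 + 8 / c1)" unfolding power2_eq_square by (rule powr_add[symmetric])
      also have "8 / c1 + 8 / c1 = 16 / c1" by simp
      finally show ?thesis by (simp only: power_mult_distrib)
    qed
    finally have a: "(real Q ^ s)\<^sup>2 \<le> (real Q)\<^sup>2 * vol powr (16 / c1)" .
    have "4 * real s * (real Z * (real q)\<^sup>2 * real Q ^ 3 * (real Q ^ s)\<^sup>2)
        \<le> 4 * real s0 * (real Z * (real q)\<^sup>2 * real Q ^ 3 * ((real Q)\<^sup>2 * vol powr (16 / c1)))"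
      using a ss0 by (intro mult_mono mult_left_mono) auto
    also have "\<dots> = 4 * real s0 * real Z * (real q)\<^sup>2 * real Q ^ 5 * vol powr (16 / c1)"
      by (simp add: power2_eq_square power3_eq_cube power_numeral_reduce)
    finally have "4 * real s * (real Z * (real q)\<^sup>2 * real Q ^ 3 * (real Q ^ s)\<^sup>2) < X" using X by linarith
    moreover have "2 * real s * real (Z * Q) * real (q * Q * (q * (Q * (Q ^ s * Q ^ s))))
        = 2 * real s * (real Z * (real q)\<^sup>2 * real Q ^ 3 * (real Q ^ s)\<^sup>2)"
      by (simp add: power2_eq_square power3_eq_cube)
    ultimately show ?thesis by linarith
  qed
  have tD: "4 \<le> t / real D" using t D_pos by (simp add: pos_le_divide_eq)
  have c0: "c > 0" using c1 by simp
  have c12: "0 \<le> c1 / 2" using c1 by simp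
  have "(real Q powr c1 / (6 ^ D * real Q powr (c1 / 2)) / (2 * (real (E ^ s) * T * (U * real (Q * Q) powr c)))) ^ s \<le> real (card (box s))"
    by (rule tuples_bound[OF cl t(1) tD U c0 Qn s(1) E(3) c12 T TE big _ XX]) auto
  also have "\<dots> \<le> (3 * real s) ^ k * vol" using s(1) by (intro card_box_le) simp
  also have "\<dots> \<le> (3 * real s0) ^ k * real Q powr (real s * (c1 / 8))"
    using s ss0 vol_ge_1 by (intro mult_mono power_mono) auto
  finally have up: "(real Q powr c1 / (6 ^ D * real Q powr (c1 / 2)) / (2 * (real (E ^ s) * T * (U * real (Q * Q) powr c)))) ^ s
      \<le> (3 * real s0) ^ k * real Q powr (real s * (c1 / 8))" .
  define K1 where "K1 = 6 ^ D * 2 * 2 ^ s0 * P * U"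
  have K1: "K1 > 0" "K1 \<le> real Q powr (c1 / 8)" 
  proof -
    show "K1 > 0" unfolding K1_def using U P1 by (intro mult_pos_pos) auto
    show "K1 \<le> real Q powr (c1 / 8)" using H2 unfolding K1_def P_def .
  qed
  \<comment> \<open>Out of the exponent c1, the factors Q^eta, E^s, T, (Q Q)^c and the constants
    take c1/2, c1/32, c1/32, c1/16 and c1/8, which leaves c1/4. Its s-th power beats the upper
    bound, where the exponent is only s c1/8.\<close>
  have low: "real Q powr (c1 / 4) \<le> real Q powr c1 / (6 ^ D * real Q powr (c1 / 2)) / (2 * (real (E ^ s) * T * (U * real (Q * Q) powr c)))"
  proof -
    have Es: "real (E ^ s) \<le> 2 ^ s0 * real Q powr (c1 / 32)"
    proof -
      have "real (E ^ s) \<le> (2 * real Q powr e) ^ s" unfolding of_nat_power using E(2) by (intro power_mono) auto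
      also have "\<dots> \<le> (2 * real Q powr e) ^ s0" using ss0 Qe1 by (intro power_increasing) auto
      also have "\<dots> = 2 ^ s0 * (real Q powr e) ^ s0" by (rule power_mult_distrib)
      also have "(real Q powr e) ^ s0 = (real Q powr e) powr real s0" using Qe1 by (intro powr_realpow[symmetric]) linarith
      also have "\<dots> = real Q powr (e * real s0)" by (rule powr_powr)
      also have "e * real s0 = c1 / 32" unfolding e_def using s01 by simp
      finally show ?thesis .
    qed
    have Tb: "T \<le> P * real Q powr (c1 / 32)"
    proof -
      have "b \<le> c1 / 32"
      proof -
        have "c1 * c1 \<le> 1 * c1" using c1 by (intro mult_right_mono) auto
        then have "c1\<^sup>2 * 32 \<le> c1 * (128 * 1)" using c1 unfolding power2_eq_square by linarith
        also have "\<dots> \<le> c1 * (128 * real s0)" using c1 s01 by (intro mult_left_mono) auto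
        finally show ?thesis unfolding b_def using s01 by (simp add: field_simps)
      qed
      then show ?thesis unfolding T_def using P1 by (intro mult_left_mono pinc) auto
    qed
    have QQ: "real (Q * Q) powr c = real Q powr (c1 / 16)"
    proof -
      have "real (Q * Q) powr c = real Q powr c * real Q powr c" by (simp add: powr_mult)
      also have "\<dots> = real Q powr (c + c)" by (rule powr_add[symmetric])
      also have "c + c = c1 / 16" using c1 by simp
      finally show ?thesis .
    qed
    have T0: "T > 0" unfolding T_def using P1 Qb by (intro mult_pos_pos) linarith+
    have "real (E ^ s) * T * (U * real (Q * Q) powr c)
       \<le> (2 ^ s0 * real Q powr (c1 / 32)) * (P * real Q powr (c1 / 32)) * (U * real Q powr (c1 / 16))"
      unfolding QQ using Es Tb U T0 P1 by (intro mult_mono) auto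
    then have "6 ^ D * real Q powr (c1 / 2) * (2 * (real (E ^ s) * T * (U * real (Q * Q) powr c)))
       \<le> 6 ^ D * real Q powr (c1 / 2) * (2 * ((2 ^ s0 * real Q powr (c1 / 32)) * (P * real Q powr (c1 / 32)) * (U * real Q powr (c1 / 16))))"
      by (intro mult_left_mono) auto
    also have "\<dots> = K1 * (real Q powr (c1 / 2) * real Q powr (c1 / 32) * real Q powr (c1 / 32) * real Q powr (c1 / 16))"
      unfolding K1_def by simp
    also have "\<dots> = K1 * real Q powr (c1 / 2 + c1 / 32 + c1 / 32 + c1 / 16)" by (simp only: powr_add)
    also have "\<dots> \<le> real Q powr (c1 / 8) * real Q powr (c1 / 2 + c1 / 32 + c1 / 32 + c1 / 16)"
      using K1 by (intro mult_right_mono) auto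
    also have "\<dots> = real Q powr (c1 / 8 + (c1 / 2 + c1 / 32 + c1 / 32 + c1 / 16))" by (rule powr_add[symmetric])
    finally have den: "6 ^ D * real Q powr (c1 / 2) * (2 * (real (E ^ s) * T * (U * real (Q * Q) powr c)))
       \<le> real Q powr (c1 / 8 + (c1 / 2 + c1 / 32 + c1 / 32 + c1 / 16))" .
    have "real Q powr (c1 / 4) * (6 ^ D * real Q powr (c1 / 2) * (2 * (real (E ^ s) * T * (U * real (Q * Q) powr c))))
       \<le> real Q powr (c1 / 4) * real Q powr (c1 / 8 + (c1 / 2 + c1 / 32 + c1 / 32 + c1 / 16))"
      using den by (intro mult_left_mono) auto
    also have "\<dots> = real Q powr (c1 / 4 + (c1 / 8 + (c1 / 2 + c1 / 32 + c1 / 32 + c1 / 16)))" by (rule powr_add[symmetric])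
    also have "c1 / 4 + (c1 / 8 + (c1 / 2 + c1 / 32 + c1 / 32 + c1 / 16)) = c1" by simp
    finally have fin: "real Q powr (c1 / 4) * (6 ^ D * real Q powr (c1 / 2) * (2 * (real (E ^ s) * T * (U * real (Q * Q) powr c)))) \<le> real Q powr c1" .
    have pos: "6 ^ D * real Q powr (c1 / 2) * (2 * (real (E ^ s) * T * (U * real (Q * Q) powr c))) > 0"
      using T0 U Q1 E(3) by (intro mult_pos_pos) auto
    show ?thesis using fin pos by (simp only: divide_divide_eq_left pos_le_divide_eq)
  qed
  have "(real Q powr (c1 / 4)) ^ s \<le> (3 * real s0) ^ k * real Q powr (real s * (c1 / 8))"
    using power_mono[OF low, of s] up by simp
  also have "(real Q powr (c1 / 4)) ^ s = (real Q powr (c1 / 4)) powr real s" using Q1 by (intro powr_realpow[symmetric]) simp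
  also have "\<dots> = real Q powr (c1 / 4 * real s)" by (rule powr_powr)
  also have "c1 / 4 * real s = real s * (c1 / 8) + real s * (c1 / 8)" by simp
  also have "real Q powr (real s * (c1 / 8) + real s * (c1 / 8)) = real Q powr (real s * (c1 / 8)) * real Q powr (real s * (c1 / 8))"
    by (rule powr_add)
  finally have "real Q powr (real s * (c1 / 8)) \<le> (3 * real s0) ^ k"
    by (rule mult_right_le_imp_le) (use Q1 in auto)
  moreover have "real Q powr (1 * (c1 / 8)) \<le> real Q powr (real s * (c1 / 8))"
    using s(1) c1 by (intro pinc mult_right_mono) auto
  ultimately show False using H3 by simp
qed

end

section \<open>Existence of a solution\<close>

lemma powr_eventually_gt:
  assumes "(e::real) > 0"
  shows "\<exists>Q0\<ge>1. \<forall>Q\<ge>Q0. A < Q powr e"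
proof -
  define A' where "A' = max A 0 + 1"
  have A': "A < A'" "A' \<ge> 1" unfolding A'_def by auto
  define Q0 where "Q0 = A' powr (1 / e)"
  have Q0: "Q0 \<ge> 1" unfolding Q0_def using A' assms by (intro ge_one_powr_ge_zero) auto
  have "A < Q powr e" if Q: "Q \<ge> Q0" for Q
  proof -
    have "Q0 powr e = A' powr (1 / e * e)" unfolding Q0_def by (rule powr_powr)
    also have "\<dots> = A'" using assms A' by simp
    finally have "Q0 powr e = A'" .
    moreover have "Q0 powr e \<le> Q powr e" using Q Q0 assms by (intro powr_mono2) auto
    ultimately show ?thesis using A' by linarith
  qed
  then show ?thesis using Q0 by blast
qed

context polynomial_system
begin

text \<open>In level Q the factors h and Q added to the pair have product at most Q^2, and
  \<open>cleared\<close> covers products up to 2 t.\<close>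

lemma level_set_subset_lam:
  assumes cl: "cleared c U q Z t" and Q: "Q \<ge> 1" "(real Q)\<^sup>2 \<le> 2 * t"
  shows "level_set q Z Q \<subseteq> lam q Z 1"
proof
  fix a assume "a \<in> level_set q Z Q"
  then obtain h where h: "a \<in> box 1" "h \<ge> 1" "h \<le> Q" "a \<in> lam (q * h) (Z * Q) 1" unfolding level_set_def by blast
  have "h * Q \<le> Q * Q" using h(3) by (intro mult_le_mono) auto
  then have "real (h * Q) \<le> real (Q * Q)" by (rule of_nat_mono)
  then have "real (h * Q) \<le> 2 * t" using Q(2) by (simp add: power2_eq_square)
  then show "a \<in> lam q Z 1" using cl h Q(1) unfolding cleared_def by blast
qed

text \<open>The constants are assumptions because they must be fixed in terms of k and d before the
  polynomials are given. The three bounds on \<open>Kb\<close> make X large enough for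
  \<open>cleared_if_regular\<close>, for \<open>level_set_card_le\<close>, and for multiples of q to
  exist in the range considered.\<close>

lemma exists_solution:
  fixes C i1 s0 m :: nat and c1 c T0 Kb M :: real
  assumes weyl: "\<forall>(\<alpha>::nat \<Rightarrow> real) N (W::real). W \<ge> 2 \<longrightarrow> N \<ge> 1 \<longrightarrow>
    norm (\<Sum>n\<in>{1..N}. ee (\<Sum>j\<le>d. \<alpha> j * real n ^ j)) \<ge> N / W \<longrightarrow>
    (\<exists>q. 1 \<le> q \<and> real q \<le> W ^ C \<and> (\<forall>j\<in>{1..d}. near (real q * \<alpha> j) (W ^ C / real N ^ j)))"
    and C: "C \<ge> 1" and c1: "c1 = 1 / (2 * real C)" and c: "c = c1 / 32"
    and i1: "1024 / \<nu> \<le> 2 ^ i1"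
    and s0: "16 * real k \<le> c1 * real s0" and m: "256 * (real s0)\<^sup>2 \<le> c1\<^sup>2 * real m"
    and T0: "T0 \<ge> 1" "4 * real D \<le> T0"
    and Ta: "\<And>t. t \<ge> T0 \<Longrightarrow> 4 * real D * (8 * (4 * real K0 * fact K0 * t) powr c + 1) \<le> t"
    and Tb: "(64 * 4 ^ ((i1 + 1) * C))\<^sup>2 \<le> 2 * T0"
    and H1: "\<And>Q::nat. 2 * T0 < (real Q)\<^sup>2 \<Longrightarrow> 2 * real s0 * real m ^ (2 ^ m) \<le> real Q powr (c1\<^sup>2 / (128 * real s0))"
    and H2: "\<And>Q::nat. 2 * T0 < (real Q)\<^sup>2 \<Longrightarrow>
      6 ^ D * 2 * 2 ^ s0 * real m ^ (2 ^ m) * (8 * (2 * real K0 * fact K0) powr c) \<le> real Q powr (c1 / 8)"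
    and H3: "\<And>Q::nat. 2 * T0 < (real Q)\<^sup>2 \<Longrightarrow> (3 * real s0) ^ k < real Q powr (c1 / 8)"
    and eps: "\<And>i. i \<in> {1..k} \<Longrightarrow> \<epsilon> i > 0" "(\<Sum>i\<in>{1..k}. 1 / (4 * (\<epsilon> i)\<^sup>2 * real (side i))) \<le> \<nu>"
    and M: "M = (2 * (729 * T0) ^ k) powr (1 / c)"
    and Kb: "16 * real K0 * fact K0 * (243 * T0) ^ 3 * M\<^sup>2 \<le> Kb"
      "4 * real s0 * (2 * real K0 * (fact K0)\<^sup>2 * M\<^sup>2) * (64 * (32 * 3 ^ k / \<nu>) ^ C) ^ 5 \<le> Kb"
      "64 * real K0 * fact K0 * M \<le> Kb"
    and X: "Kb * vol powr (4 / c + 5 * real C + 16 / c1 + 3) < X"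
  shows "\<exists>n>0. real n < X \<and> (\<forall>i\<in>{1..k}. near (poly (f i) (real n)) (\<epsilon> i))"
proof -
  have c1b: "0 < c1" "c1 \<le> 1" unfolding c1 using C by (auto simp: divide_le_eq)
  have c0: "0 < c" "c \<le> 1/4" unfolding c using c1b by auto
  have v1: "vol \<ge> 1" by (rule vol_ge_1)
  have vinc: "vol powr a \<le> vol powr b" if "a \<le> b" for a b using that v1 by (intro powr_mono) auto
  define Ex where "Ex = 4 / c + 5 * real C + 16 / c1 + 3"
  have Kb0: "Kb \<ge> 0" using Kb(3) T0 unfolding M by (elim order_trans[rotated]) simp
  have Xb: "A * vol powr a < X" if "A \<le> Kb" "a \<le> Ex" for A a
  proof -
    have "A * vol powr a \<le> Kb * vol powr Ex" using that Kb0 by (intro mult_mono vinc) auto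
    then show ?thesis using X unfolding Ex_def by linarith
  qed
  \<comment> \<open>The k-th root balances two demands: t >= r gives vol <= t^k, while t <= 243 T0 r
    keeps t^k below a constant times \<open>vol\<close>, so that q0 Z0 is bounded by a constant
    times a power of \<open>vol\<close> free of k.\<close>
  define r where "r = vol powr (1 / k)"
  have r: "r \<ge> 1" "r ^ k = vol" "r \<le> vol"
  proof -
    show r1: "r \<ge> 1" unfolding r_def using v1 by (intro ge_one_powr_ge_zero) auto
    have "r ^ k = r powr real k" using r1 by (intro powr_realpow[symmetric]) simp
    also have "\<dots> = vol powr (1 / k * k)" unfolding r_def by (rule powr_powr)
    also have "\<dots> = vol" using v1 k_pos by simp
    finally show "r ^ k = vol" .
    have "1 / real k \<le> 1" using k_pos by simp
    then have "vol powr (1 / k) \<le> vol powr 1" by (rule vinc)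
    then show "r \<le> vol" unfolding r_def using v1 by simp
  qed
  define T1 where "T1 = max T0 r"
  have T1: "T0 \<le> T1" "r \<le> T1" "T1 \<le> T0 * r"
  proof -
    show "T0 \<le> T1" "r \<le> T1" unfolding T1_def by auto
    have "T0 * 1 \<le> T0 * r" "1 * r \<le> T0 * r" using T0 r by (intro mult_left_mono mult_right_mono; linarith)+
    then show "T1 \<le> T0 * r" unfolding T1_def by simp
  qed
  have "T1 > 0" using T1 T0 by linarith
  from exists_regular[OF c0(1) this] obtain t q0 Z0 where
    t: "T1 \<le> t" "t \<le> 243 * T1" and reg: "regular c q0 Z0 t" and qZc: "real (q0 * Z0) powr c \<le> 2 * real (card (box t))" by blast
  have tT0: "T0 \<le> t" using t T1 by linarith
  have t1: "t \<ge> 1" using tT0 T0 by linarith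
  have tr: "t \<le> 243 * T0 * r" using t T1 by linarith
  have volt: "vol \<le> t ^ k" using power_mono[of r t k] r t T1 by auto
  have q0: "q0 \<ge> 1" "Z0 \<ge> 1" using reg unfolding regular_def by auto
  define w where "w = real (q0 * Z0)"
  have w1: "w \<ge> 1"
  proof -
    have "1 * 1 \<le> q0 * Z0" using q0 by (intro mult_le_mono) auto
    then have "real (1 * 1) \<le> real (q0 * Z0)" by (rule of_nat_mono)
    then show ?thesis unfolding w_def by simp
  qed
  have M0: "M \<ge> 0" unfolding M by simp
  have wM: "w \<le> M * vol powr (2 / c)"
  proof -
    have "(3 * t) ^ k \<le> (729 * T0 * r) ^ k" using tr t1 by (intro power_mono) auto
    also have "\<dots> = (729 * T0) ^ k * vol" by (simp only: power_mult_distrib[of "729 * T0"] r(2))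
    finally have "(3 * t) ^ k \<le> (729 * T0) ^ k * vol" .
    then have "(3 * t) ^ k * vol \<le> (729 * T0) ^ k * vol * vol" by (rule mult_right_mono) (use v1 in linarith)
    then have "real (card (box t)) \<le> (729 * T0) ^ k * vol * vol" using card_box_le[OF t1] by linarith
    then have "w powr c \<le> (2 * (729 * T0) ^ k) * vol\<^sup>2" using qZc unfolding w_def power2_eq_square by linarith
    then have "(w powr c) powr (1 / c) \<le> ((2 * (729 * T0) ^ k) * vol\<^sup>2) powr (1 / c)" using c0 by (intro powr_mono2) auto
    also have "(w powr c) powr (1 / c) = w powr (c * (1 / c))" by (rule powr_powr)
    also have "\<dots> = w" using w1 c0 by simp
    also have "((2 * (729 * T0) ^ k) * vol\<^sup>2) powr (1 / c) = M * (vol\<^sup>2) powr (1 / c)"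
      unfolding M by (rule powr_mult)
    also have "(vol\<^sup>2) powr (1 / c) = vol powr (2 / c)"
    proof -
      have "vol\<^sup>2 = vol powr 2" using v1 by simp
      then show ?thesis by (simp add: powr_powr)
    qed
    finally show ?thesis .
  qed
  have w2: "w\<^sup>2 \<le> M\<^sup>2 * vol powr (4 / c)"
  proof -
    have "w\<^sup>2 \<le> (M * vol powr (2 / c))\<^sup>2" using wM w1 by (intro power_mono) auto
    also have "\<dots> = M\<^sup>2 * (vol powr (2 / c) * vol powr (2 / c))" by (simp add: power2_eq_square)
    also have "vol powr (2 / c) * vol powr (2 / c) = vol powr (2 / c + 2 / c)" by (rule powr_add[symmetric])
    finally show ?thesis by simp
  qed
  have qw: "(real q0)\<^sup>2 * real Z0 \<le> w\<^sup>2"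
  proof -
    have "(real q0)\<^sup>2 * (real Z0 * 1) \<le> (real q0)\<^sup>2 * (real Z0 * real Z0)" using q0 by (intro mult_left_mono) auto
    then show ?thesis unfolding w_def by (simp add: power2_eq_square mult_ac)
  qed
  have X1: "4 * t\<^sup>2 * (real q0)\<^sup>2 * real Z0 * (4 * real K0 * fact K0 * t) < X"
  proof -
    have t3: "t ^ 3 \<le> (243 * T0) ^ 3 * vol powr 3"
    proof -
      have "243 * T0 * r \<le> 243 * T0 * vol" using r T0 by (intro mult_left_mono) auto
      then have "t ^ 3 \<le> (243 * T0 * vol) ^ 3" using tr t1 by (intro power_mono) auto
      also have "\<dots> = (243 * T0) ^ 3 * vol ^ 3" by (rule power_mult_distrib)
      also have "vol ^ 3 = vol powr 3" using v1 by (simp add: powr_numeral)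
      finally show ?thesis .
    qed
    have qM: "(real q0)\<^sup>2 * real Z0 \<le> M\<^sup>2 * vol powr (4 / c)" using qw w2 by linarith
    have "4 * t\<^sup>2 * (real q0)\<^sup>2 * real Z0 * (4 * real K0 * fact K0 * t) = 16 * real K0 * fact K0 * (t ^ 3 * ((real q0)\<^sup>2 * real Z0))"
      by (simp add: power2_eq_square power3_eq_cube mult_ac)
    also have "\<dots> \<le> 16 * real K0 * fact K0 * (((243 * T0) ^ 3 * vol powr 3) * (M\<^sup>2 * vol powr (4 / c)))"
      using T0 by (intro mult_left_mono mult_mono[OF t3 qM]) auto
    also have "\<dots> = (16 * real K0 * fact K0 * (243 * T0) ^ 3 * M\<^sup>2) * vol powr (3 + 4 / c)"
      by (simp add: powr_add mult_ac)
    also have "\<dots> < X" using Kb(1) c1b by (intro Xb) (auto simp: Ex_def)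
    finally show ?thesis .
  qed
  define q where "q = q0 * fact K0"
  define Z where "Z = 2 * Z0 * K0"
  define U where "U = 8 * (2 * real K0 * fact K0) powr c"
  have cl: "cleared c U q Z t" unfolding q_def Z_def U_def by (rule cleared_if_regular[OF reg c0 t1 Ta[OF tT0] X1])
  have qZ: "q \<ge> 1" "Z \<ge> 1" using cl unfolding cleared_def by auto
  have U0: "U > 0" unfolding U_def using K0_pos by simp
  define L where "L = real (card (lam q Z 1))"
  have L1: "L \<ge> 1" unfolding L_def using card_lam_pos[of 1 q Z] by simp
  \<comment> \<open>Bounds the levels that occur, at most 64 * 4^(J C), through 4^J <= 32 * 3^k vol
    / nu.\<close>
  define QM where "QM = 64 * (32 * 3 ^ k / \<nu>) ^ C * vol ^ C"
  have QM0: "QM \<ge> 0" unfolding QM_def using \<nu>_bounds v1 by simp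
  have lev: "real (card (level_set q Z Q)) \<le> real Q powr c1 * L" if Q: "2 * t < (real Q)\<^sup>2" "real Q \<le> QM" for Q
    unfolding L_def
  proof (rule level_set_card_le[OF cl t1 _ U0 c1b c Q(1) volt s0 m])
    have QT: "2 * T0 < (real Q)\<^sup>2" using Q(1) tT0 by linarith
    show "4 * real D \<le> t" using T0 tT0 by linarith
    show "2 * real s0 * real m ^ 2 ^ m \<le> real Q powr (c1\<^sup>2 / (128 * real s0))" by (rule H1[OF QT])
    show "6 ^ D * 2 * 2 ^ s0 * real m ^ 2 ^ m * U \<le> real Q powr (c1 / 8)" unfolding U_def by (rule H2[OF QT])
    show "(3 * real s0) ^ k < real Q powr (c1 / 8)" by (rule H3[OF QT])
    have Q5: "real Q ^ 5 \<le> (64 * (32 * 3 ^ k / \<nu>) ^ C) ^ 5 * vol powr (5 * real C)"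
    proof -
      have "real Q ^ 5 \<le> QM ^ 5" using Q(2) by (intro power_mono) auto
      also have "\<dots> = (64 * (32 * 3 ^ k / \<nu>) ^ C) ^ 5 * (vol ^ C) ^ 5" unfolding QM_def by (rule power_mult_distrib)
      also have "(vol ^ C) ^ 5 = vol powr (real (C * 5))" using v1 by (simp only: power_mult[symmetric] powr_realpow)
      finally show ?thesis by (simp add: mult.commute)
    qed
    have Zq: "real Z * (real q)\<^sup>2 \<le> 2 * real K0 * (fact K0)\<^sup>2 * (M\<^sup>2 * vol powr (4 / c))"
    proof -
      have "real Z * (real q)\<^sup>2 = 2 * real K0 * (fact K0)\<^sup>2 * ((real q0)\<^sup>2 * real Z0)"
        unfolding Z_def q_def by (simp add: power2_eq_square mult_ac)
      also have "\<dots> \<le> 2 * real K0 * (fact K0)\<^sup>2 * (M\<^sup>2 * vol powr (4 / c))"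
        using qw w2 by (intro mult_left_mono) auto
      finally show ?thesis .
    qed
    have "4 * real s0 * real Z * (real q)\<^sup>2 * real Q ^ 5 * vol powr (16 / c1)
        = 4 * real s0 * (real Z * (real q)\<^sup>2) * real Q ^ 5 * vol powr (16 / c1)" by simp
    also have "\<dots> \<le> 4 * real s0 * (2 * real K0 * (fact K0)\<^sup>2 * (M\<^sup>2 * vol powr (4 / c))) * ((64 * (32 * 3 ^ k / \<nu>) ^ C) ^ 5 * vol powr (5 * real C)) * vol powr (16 / c1)"
      by (intro mult_right_mono mult_mono[OF mult_left_mono[OF Zq] Q5]) auto
    also have "\<dots> = (4 * real s0 * (2 * real K0 * (fact K0)\<^sup>2 * M\<^sup>2) * (64 * (32 * 3 ^ k / \<nu>) ^ C) ^ 5) * (vol powr (4 / c) * vol powr (5 * real C) * vol powr (16 / c1))"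
      by (simp only: mult_ac)
    also have "vol powr (4 / c) * vol powr (5 * real C) * vol powr (16 / c1) = vol powr (4 / c + 5 * real C + 16 / c1)"
      by (simp only: powr_add)
    also have "(4 * real s0 * (2 * real K0 * (fact K0)\<^sup>2 * M\<^sup>2) * (64 * (32 * 3 ^ k / \<nu>) ^ C) ^ 5) * vol powr (4 / c + 5 * real C + 16 / c1) < X"
      using Kb(2) by (intro Xb) (auto simp: Ex_def)
    finally show "4 * real s0 * real Z * (real q)\<^sup>2 * real Q ^ 5 * vol powr (16 / c1) < X" .
  qed
  \<comment> \<open>The largest length for which \<open>near_phase\<close> applies; rounding loses
    at most a factor 2, whence the 64 in \<open>level_set_if_large\<close>.\<close>
  define Y where "Y = nat \<lfloor>X / (32 * real q * real Z)\<rfloor>"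
  have qZ0: "32 * real q * real Z > 0" using qZ by simp
  have "32 * real q * real Z < X"
  proof -
    have "32 * real q * real Z = 64 * real K0 * fact K0 * w" unfolding q_def Z_def w_def by simp
    also have "\<dots> \<le> 64 * real K0 * fact K0 * (M * vol powr (2 / c))" using wM by (intro mult_left_mono) auto
    also have "\<dots> = (64 * real K0 * fact K0 * M) * vol powr (2 / c)" by simp
    also have "\<dots> < X"
    proof (rule Xb[OF Kb(3)])
      have "2 / c \<le> 4 / c" using c0 by (simp add: divide_right_mono)
      then show "2 / c \<le> Ex" unfolding Ex_def using c1b by (simp add: add_increasing2)
    qed
    finally show ?thesis .
  qed
  then have fl: "X / (32 * real q * real Z) \<ge> 1" using qZ0 by simp
  have Y: "Y \<ge> 1" "real Y \<le> X / (32 * real q * real Z)" "real Y \<ge> X / (64 * real q * real Z)"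
  proof -
    define z where "z = X / (32 * real q * real Z)"
    have z: "z \<ge> 1" "Y = nat \<lfloor>z\<rfloor>" "X / (64 * real q * real Z) = z / 2" using fl unfolding z_def Y_def by simp_all
    have "real_of_int \<lfloor>z\<rfloor> \<ge> 1" using z(1) by simp
    then have "real Y = real_of_int \<lfloor>z\<rfloor>" "real_of_int \<lfloor>z\<rfloor> \<ge> z / 2" unfolding z(2) by (simp, linarith)
    moreover have "real_of_int \<lfloor>z\<rfloor> \<le> z" by simp
    ultimately have "real Y \<ge> 1" "real Y \<le> z" "real Y \<ge> z / 2" using \<open>real_of_int \<lfloor>z\<rfloor> \<ge> 1\<close> by linarith+
    then show "Y \<ge> 1" "real Y \<le> X / (32 * real q * real Z)" "real Y \<ge> X / (64 * real q * real Z)"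
      unfolding z(3) unfolding z_def[symmetric] by simp_all
  qed
  have qY: "real (q * Y) \<le> X / (32 * real Z)" "real (q * Y) \<ge> X / (64 * real Z)"
  proof -
    have "real q * real Y \<le> real q * (X / (32 * real q * real Z))" "real q * (X / (64 * real q * real Z)) \<le> real q * real Y"
      using Y by (intro mult_left_mono; simp)+
    then show "real (q * Y) \<le> X / (32 * real Z)" "real (q * Y) \<ge> X / (64 * real Z)" using qZ by simp_all
  qed
  have qYX: "real (q * Y) < X"
  proof -
    have "X / (32 * real Z) \<le> X / 32" using qZ X_pos' by (intro divide_left_mono) auto
    then show ?thesis using qY(1) X_pos' by linarith
  qed
  show ?thesis
  proof (rule ccontr)
    assume no: "\<not> ?thesis"
    have nosol: "\<exists>i\<in>{1..k}. \<not> near (poly (f i) (real (q * n))) (\<epsilon> i)" if n: "n \<in> {1..Y}" for n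
    proof -
      have "q * n > 0" using n qZ by simp
      moreover have "real (q * n) < X"
      proof -
        have "real (q * n) \<le> real (q * Y)" using n by (intro of_nat_mono mult_le_mono) auto
        then show ?thesis using qYX by linarith
      qed
      ultimately show ?thesis using no by blast
    qed
    define A where "A = box 1 - lam q Z 1"
    have low: "\<nu> / 2 * L \<le> (\<Sum>a\<in>A. \<sigma> q Y a)"
      unfolding A_def L_def by (rule fourier_lower_bound[OF qZ Y(1) qY(1) eps nosol])
    define B where "B = real (card (box 1))"
    have B: "B \<ge> 1" "B \<le> 3 ^ k * vol"
    proof -
      have "lam q Z 1 \<subseteq> box 1" using lam_box by blast
      then have "card (lam q Z 1) \<le> card (box 1)" by (rule card_mono[OF finite_box])
      then show "B \<ge> 1" unfolding B_def using L1 unfolding L_def by linarith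
      show "B \<le> 3 ^ k * vol" unfolding B_def using card_box_le[of 1] by simp
    qed
    obtain J0 where J0: "8 * B / \<nu> < 4 ^ J0" using real_arch_pow[of 4 "8 * B / \<nu>"] by auto
    \<comment> \<open>With this J the frequencies whose sums are below 4^-J contribute at most nu /
      8, even if all of \<open>box 1\<close> is counted. Minimality bounds 4^J from above.\<close>
    obtain J where J: "\<forall>i<J. \<not> 8 * B / \<nu> \<le> 4 ^ i" "8 * B / \<nu> \<le> 4 ^ J"
      using ex_least_nat_le[of "\<lambda>J. 8 * B / \<nu> \<le> 4 ^ J", OF less_imp_le[OF J0]] by blast
    note J1 = J(2)
    have "8 * 1 / 1 \<le> 8 * B / \<nu>" using B \<nu>_bounds by (intro frac_le) auto
    then have "J \<noteq> 0" using J1 by (cases J) auto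
    then have "\<not> 8 * B / \<nu> \<le> 4 ^ (J - 1)" using J(1) by simp
    moreover have "(4::real) ^ J = 4 * 4 ^ (J - 1)" using \<open>J \<noteq> 0\<close> by (cases J) auto
    ultimately have J2: "4 ^ J \<le> 32 * B / \<nu>" by simp
    \<comment> \<open>The level that Weyl's inequality assigns to sums of size at least 4^-(i+1).
      Since c1 = 1/(2 C), its c1-th power is at most 64 * 2^(i+1), the growth that
      \<open>level_sum_bound\<close> allows.\<close>
    define Qi :: "nat \<Rightarrow> nat" where "Qi i = 64 * 4 ^ ((i + 1) * C)" for i :: nat
    have Qi1: "Qi i \<ge> 1" for i unfolding Qi_def by (simp add: Suc_le_eq)
    have Qi_real: "real (Qi i) = 64 * (4 ^ (i + 1)) ^ C" for i unfolding Qi_def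
      by (simp only: power_mult of_nat_mult of_nat_power of_nat_numeral)
    have Qi_pow: "real (Qi i) powr c1 \<le> 64 * 2 ^ (i + 1)" for i
    proof -
      have "real (Qi i) powr c1 = 64 powr c1 * (4 ^ ((i + 1) * C)) powr c1" unfolding Qi_def by (simp add: powr_mult)
      also have "(64::real) powr c1 \<le> 64 powr 1" using c1b by (intro powr_mono) auto
      also have "(4 ^ ((i + 1) * C)) powr c1 = (2::real) ^ (i + 1)"
      proof -
        have "(4::real) ^ ((i + 1) * C) = 2 ^ (2 * ((i + 1) * C))" using power_mult[of "2::real" 2 "(i + 1) * C"] by simp
        also have "\<dots> = 2 powr (real (2 * ((i + 1) * C)))" by (simp only: powr_realpow zero_less_numeral)
        finally have "((4::real) ^ ((i + 1) * C)) powr c1 = 2 powr (real (2 * ((i + 1) * C)) * c1)" by (simp only: powr_powr)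
        also have "real (2 * ((i + 1) * C)) * c1 = real (i + 1)" unfolding c1 using C by (simp add: divide_simps algebra_simps)
        also have "2 powr real (i + 1) = (2::real) ^ (i + 1)" by (simp only: powr_realpow zero_less_numeral)
        finally show ?thesis .
      qed
      finally show ?thesis by simp
    qed
    have inlev: "a \<in> level_set q Z (Qi i)" if a: "a \<in> box 1" "(1/4) ^ (i + 1) \<le> \<sigma> q Y a" for a i
    proof (rule level_set_if_large[OF weyl qZ Y(1) qY(2) _ _ a(1)])
      have "(4::real) ^ 1 \<le> 4 ^ (i + 1)" by (intro power_increasing) auto
      then show "(2::real) \<le> 4 ^ (i + 1)" unfolding power_one_right by linarith
      show "64 * (4 ^ (i + 1)) ^ C \<le> real (Qi i)" unfolding Qi_real ..
      show "1 / 4 ^ (i + 1) \<le> \<sigma> q Y a" using a(2) by (simp only: power_one_over)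
    qed
    have empty: "a \<in> lam q Z 1" if a: "a \<in> box 1" "(1/4) ^ (i + 1) \<le> \<sigma> q Y a" "(real (Qi i))\<^sup>2 \<le> 2 * t" for a i
      using level_set_subset_lam[OF cl Qi1 a(3)] inlev[OF a(1,2)] by blast
    have "(\<Sum>a\<in>A. \<sigma> q Y a) \<le> 2 * (64 * L) * (1/2) ^ i1 + real (card A) * (1/4) ^ J"
    proof (rule level_sum_bound)
      show "finite A" unfolding A_def using finite_box by simp
      show "0 \<le> 64 * L" using L1 by simp
      \<comment> \<open>By \<open>Tb\<close> the level for i1 is small enough for
        \<open>cleared\<close>, so a frequency with a larger sum would already be a
        relation.\<close>
      show "\<sigma> q Y a \<le> (1/4) ^ (i1 + 1)" if a: "a \<in> A" for a
      proof (rule ccontr)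
        assume "\<not> \<sigma> q Y a \<le> (1/4) ^ (i1 + 1)"
        moreover have "(real (Qi i1))\<^sup>2 \<le> 2 * t" using Tb tT0 unfolding Qi_def by simp
        ultimately have "a \<in> lam q Z 1" using a by (intro empty[of a i1]) (auto simp: A_def)
        then show False using a unfolding A_def by simp
      qed
      show "real (card {a\<in>A. (1/4) ^ (i + 1) \<le> \<sigma> q Y a}) \<le> 64 * L * 2 ^ (i + 1)" if i: "i1 < i" "i < J" for i
      proof (cases "(real (Qi i))\<^sup>2 \<le> 2 * t")
        case True
        then have "{a\<in>A. (1/4) ^ (i + 1) \<le> \<sigma> q Y a} = {}" using empty[of _ i] unfolding A_def by blast
        then have "real (card {a\<in>A. (1/4) ^ (i + 1) \<le> \<sigma> q Y a}) = 0" by (simp only: card.empty of_nat_0)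
        then show ?thesis using L1 by simp
      next
        case False
        have "card {a\<in>A. (1/4) ^ (i + 1) \<le> \<sigma> q Y a} \<le> card (level_set q Z (Qi i))"
        proof (rule card_mono)
          show "finite (level_set q Z (Qi i))" unfolding level_set_def
            by (rule finite_subset[OF _ finite_box[of 1]]) blast
          show "{a\<in>A. (1/4) ^ (i + 1) \<le> \<sigma> q Y a} \<subseteq> level_set q Z (Qi i)" using inlev unfolding A_def by blast
        qed
        then have "real (card {a\<in>A. (1/4) ^ (i + 1) \<le> \<sigma> q Y a}) \<le> real (card (level_set q Z (Qi i)))" by (rule of_nat_mono)
        also have "\<dots> \<le> real (Qi i) powr c1 * L"
        proof (rule lev)
          show "2 * t < (real (Qi i))\<^sup>2" using False by simp
          have "(4::real) ^ (i + 1) \<le> 4 ^ J" using i by (intro power_increasing) auto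
          also have "\<dots> \<le> 32 * (3 ^ k * vol) / \<nu>" using J2 B \<nu>_bounds by (elim order_trans) (intro divide_right_mono, auto)
          finally have "(4 ^ (i + 1)) ^ C \<le> (32 * (3 ^ k * vol) / \<nu>) ^ C" by (intro power_mono) auto
          also have "32 * (3 ^ k * vol) / \<nu> = (32 * 3 ^ k / \<nu>) * vol" by simp
          also have "((32 * 3 ^ k / \<nu>) * vol) ^ C = (32 * 3 ^ k / \<nu>) ^ C * vol ^ C" by (rule power_mult_distrib)
          finally show "real (Qi i) \<le> QM" unfolding Qi_real QM_def by simp
        qed
        also have "\<dots> \<le> (64 * 2 ^ (i + 1)) * L" using Qi_pow L1 by (intro mult_right_mono) auto
        finally show ?thesis by (simp only: mult_ac)
      qed
    qed
    \<comment> \<open>i1 was chosen to make 128 / 2^i1 at most nu / 8.\<close>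
    moreover have "2 * (64 * L) * (1/2) ^ i1 \<le> \<nu> / 8 * L"
    proof -
      have "1024 \<le> \<nu> * 2 ^ i1" using i1 \<nu>_bounds by (simp add: pos_divide_le_eq mult.commute)
      then have "(1/2) ^ i1 \<le> \<nu> / 1024" by (simp add: power_one_over pos_divide_le_eq)
      then have "128 * L * (1/2) ^ i1 \<le> 128 * L * (\<nu> / 1024)" using L1 by (intro mult_left_mono) auto
      then show ?thesis by (simp add: mult_ac)
    qed
    moreover have "real (card A) * (1/4) ^ J \<le> \<nu> / 8 * L"
    proof -
      have "real (card A) \<le> B" unfolding B_def A_def using finite_box by (intro of_nat_mono card_mono) auto
      then have "real (card A) * (1/4) ^ J \<le> B * (1/4) ^ J" by (intro mult_right_mono) auto
      also have "8 * B \<le> 4 ^ J * \<nu>" using J1 \<nu>_bounds by (simp add: pos_divide_le_eq)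
      then have "B * (1/4) ^ J \<le> \<nu> / 8" by (simp add: power_one_over pos_divide_le_eq mult_ac)
      also have "\<nu> / 8 * 1 \<le> \<nu> / 8 * L" using L1 \<nu>_bounds by (intro mult_left_mono) auto
      finally show ?thesis by simp
    qed
    ultimately have "\<nu> / 2 * L \<le> \<nu> / 8 * L + \<nu> / 8 * L" using low by linarith
    moreover have "\<nu> * L > 0" using L1 \<nu>_bounds by (intro mult_pos_pos) auto
    ultimately show False by (simp add: field_simps)
  qed
qed

end

section \<open>Choice of the constants\<close>

lemma dist_nearest_int_le_if_near: "near t \<epsilon> \<Longrightarrow> dist_nearest_int t \<le> \<epsilon>"
  unfolding near_def dist_nearest_int_def
  by (metis Ints_of_int dist_real_def infdist_le order_trans)

theorem theorem1p1:
  fixes d :: nat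
  assumes "d > 0"
  shows "\<exists>C_d::real. C_d > 2 \<and>
    (\<forall>k::nat. k > 0 \<longrightarrow>
      (\<exists>C_dk::real. C_dk > 2 \<and>
        (\<forall>(f :: nat \<Rightarrow> real poly) (\<epsilon> :: nat \<Rightarrow> real) (x :: real).
          (\<forall>i\<in>{1..k}. degree (f i) \<le> d \<and> poly (f i) 0 = 0) \<longrightarrow>
          (\<forall>i\<in>{1..k}. \<epsilon> i \<in> {0<..1/100}) \<longrightarrow>
          inverse (\<Prod>i\<in>{1..k}. \<epsilon> i) \<le> x powr (1 / C_d) \<longrightarrow>
          x > C_dk \<longrightarrow>
          (\<exists>n::nat. n > 0 \<and> real n < x \<and>
            (\<forall>i\<in>{1..k}. dist_nearest_int (poly (f i) (real n)) \<le> \<epsilon> i)))))"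
proof -
  obtain C0 where C0: "\<And>(\<alpha>::nat \<Rightarrow> real) N (W::real). W \<ge> 2 \<Longrightarrow> N \<ge> 1 \<Longrightarrow>
    norm (\<Sum>n\<in>{1..N}. ee (\<Sum>j\<le>d. \<alpha> j * real n ^ j)) \<ge> N / W \<Longrightarrow>
    (\<exists>q. 1 \<le> q \<and> real q \<le> W ^ C0 \<and> (\<forall>j\<in>{1..d}. near (real q * \<alpha> j) (W ^ C0 / real N ^ j)))"
    using weyl_large_sum[of d] by blast
  \<comment> \<open>The successor ensures C >= 1, so that \<open>c1\<close> is positive; the
    exponent may be raised because W >= 1.\<close>
  define C where "C = Suc C0"
  have C1: "C \<ge> 1" unfolding C_def by simp
  have weylC: "\<forall>(\<alpha>::nat \<Rightarrow> real) N (W::real). W \<ge> 2 \<longrightarrow> N \<ge> 1 \<longrightarrow>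
    norm (\<Sum>n\<in>{1..N}. ee (\<Sum>j\<le>d. \<alpha> j * real n ^ j)) \<ge> N / W \<longrightarrow>
    (\<exists>q. 1 \<le> q \<and> real q \<le> W ^ C \<and> (\<forall>j\<in>{1..d}. near (real q * \<alpha> j) (W ^ C / real N ^ j)))"
  proof (intro allI impI)
    fix \<alpha> :: "nat \<Rightarrow> real" and N :: nat and W :: real
    assume W: "W \<ge> 2" and h: "N \<ge> 1" "norm (\<Sum>n\<in>{1..N}. ee (\<Sum>j\<le>d. \<alpha> j * real n ^ j)) \<ge> N / W"
    have le: "W ^ C0 \<le> W ^ C" unfolding C_def using W by (intro power_increasing) auto
    obtain q where q: "1 \<le> q" "real q \<le> W ^ C0" "\<forall>j\<in>{1..d}. near (real q * \<alpha> j) (W ^ C0 / real N ^ j)"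
      using C0[OF W h] by (elim exE conjE)
    have "near (real q * \<alpha> j) (W ^ C / real N ^ j)" if "j \<in> {1..d}" for j
    proof (rule near_mono[OF bspec[OF q(3) that]])
      show "W ^ C0 / real N ^ j \<le> W ^ C / real N ^ j" using le by (intro divide_right_mono) auto
    qed
    moreover have "real q \<le> W ^ C" using q(2) le by linarith
    ultimately show "\<exists>q. 1 \<le> q \<and> real q \<le> W ^ C \<and> (\<forall>j\<in>{1..d}. near (real q * \<alpha> j) (W ^ C / real N ^ j))"
      using q(1) by blast
  qed
  define c1 where "c1 = 1 / (2 * real C)"
  define c where "c = c1 / 32"
  have c1b: "0 < c1" "c1 \<le> 1" unfolding c1_def using C1 by (auto simp: divide_le_eq)
  have c0: "0 < c" "c < 1" unfolding c_def using c1b by auto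
  \<comment> \<open>The power of \<open>vol\<close> that x has to exceed in
    \<open>exists_solution\<close>; it depends on d only.\<close>
  define Ex where "Ex = 4 / c + 5 * real C + 16 / c1 + 3"
  have Ex: "Ex \<ge> 3" unfolding Ex_def using c0 c1b by simp
  show ?thesis
  \<comment> \<open>As \<open>vol\<close> is at most a constant times Delta^-2, vol^Ex is at most a
    constant times x^(2 Ex / (4 Ex)) = x^(1/2), and the remaining square root of x beats the
    constants.\<close>
  proof (rule exI[of _ "4 * Ex"], intro conjI allI impI)
    show "2 < 4 * Ex" using Ex by linarith
    fix k :: nat assume k: "k > 0"
    \<comment> \<open>\<open>DD\<close>, \<open>N\<nu>\<close> and \<open>KK\<close> are the values
      of \<open>D\<close>, \<open>\<nu>\<close> and \<open>K0\<close> in the locale. They depend on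
      k and d alone and are written out because the threshold for x is fixed before the
      polynomials.\<close>
    define DD where "DD = k + d"
    define N\<nu> :: real where "N\<nu> = 1 / (4 * 2 ^ k * 10 ^ DD)"
    define KK :: nat where "KK = (324 * DD)\<^sup>2"
    have N\<nu>: "N\<nu> > 0" "N\<nu> \<le> 1"
    proof -
      have "(1::real) \<le> 2 ^ k" "(1::real) \<le> 10 ^ DD" by (rule one_le_power, simp)+
      then have "1 * 1 \<le> (2::real) ^ k * 10 ^ DD" by (intro mult_mono) auto
      then show "N\<nu> > 0" "N\<nu> \<le> 1" unfolding N\<nu>_def by auto
    qed
    obtain i1 where i1: "1024 / N\<nu> < 2 ^ i1" using real_arch_pow[of 2 "1024 / N\<nu>"] by auto
    \<comment> \<open>Makes Q^(2 k) <= Q^(s0 c1/8), so that s0 summands suffice whenever vol <= t^k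
      and t <= Q^2.\<close>
    define s0 where "s0 = nat \<lceil>16 * real k / c1\<rceil>"
    have s0: "16 * real k \<le> c1 * real s0" "s0 \<ge> 1"
    proof -
      have "16 * real k / c1 \<le> real s0" unfolding s0_def by (rule real_nat_ceiling_ge)
      then show a: "16 * real k \<le> c1 * real s0" using c1b by (simp add: pos_divide_le_eq mult.commute)
      show "s0 \<ge> 1" using a k by (cases s0) auto
    qed
    \<comment> \<open>Makes the divisor bound for n <= Q^(2 s0) at most a constant times Q^(c1^2 /
      (128 s0)).\<close>
    define m where "m = nat \<lceil>256 * (real s0)\<^sup>2 / c1\<^sup>2\<rceil>"
    have m: "256 * (real s0)\<^sup>2 \<le> c1\<^sup>2 * real m"
    proof -
      have "256 * (real s0)\<^sup>2 / c1\<^sup>2 \<le> real m" unfolding m_def by (rule real_nat_ceiling_ge)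
      then show ?thesis using c1b by (simp add: pos_divide_le_eq mult.commute)
    qed
    obtain Q1 where Q1: "Q1 \<ge> 1" "\<And>Q. Q \<ge> Q1 \<Longrightarrow> 2 * real s0 * real m ^ (2 ^ m) < Q powr (c1\<^sup>2 / (128 * real s0))"
      using powr_eventually_gt[of "c1\<^sup>2 / (128 * real s0)" "2 * real s0 * real m ^ (2 ^ m)"] c1b s0 by auto
    obtain Q2 where Q2: "Q2 \<ge> 1" "\<And>Q. Q \<ge> Q2 \<Longrightarrow>
        6 ^ DD * 2 * 2 ^ s0 * real m ^ (2 ^ m) * (8 * (2 * real KK * fact KK) powr c) < Q powr (c1 / 8)"
      using powr_eventually_gt[of "c1 / 8" "6 ^ DD * 2 * 2 ^ s0 * real m ^ (2 ^ m) * (8 * (2 * real KK * fact KK) powr c)"] c1b by auto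
    obtain Q3 where Q3: "Q3 \<ge> 1" "\<And>Q. Q \<ge> Q3 \<Longrightarrow> (3 * real s0) ^ k < Q powr (c1 / 8)"
      using powr_eventually_gt[of "c1 / 8" "(3 * real s0) ^ k"] c1b by auto
    define B0 where "B0 = (4 * real KK * fact KK) powr c"
    obtain Q4 where Q4: "Q4 \<ge> 1" "\<And>Q. Q \<ge> Q4 \<Longrightarrow> 4 * real DD * (8 * B0 + 1) < Q powr (1 - c)"
      using powr_eventually_gt[of "1 - c" "4 * real DD * (8 * B0 + 1)"] c0 by auto
    define U :: real where "U = (64 * 4 ^ ((i1 + 1) * C))\<^sup>2"
    \<comment> \<open>A sum of nonnegative terms dominates each of the thresholds; Q^2 > 2 T0 then
      forces Q above \<open>Q1\<close>, \<open>Q2\<close> and \<open>Q3\<close>.\<close>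
    define T0 where "T0 = Q1\<^sup>2 + Q2\<^sup>2 + Q3\<^sup>2 + Q4 + 4 * real DD + U"
    have sq: "Q1\<^sup>2 \<ge> 0" "Q2\<^sup>2 \<ge> 0" "Q3\<^sup>2 \<ge> 0" "U \<ge> 0" "real DD \<ge> 0" unfolding U_def by auto
    have T0': "T0 \<ge> 1" "U \<le> T0" "4 * real DD \<le> T0" "Q4 \<le> T0" "Q1\<^sup>2 \<le> T0" "Q2\<^sup>2 \<le> T0" "Q3\<^sup>2 \<le> T0"
      unfolding T0_def using sq Q4(1) by - linarith+
    then have T0: "T0 \<ge> 1" "4 * real DD \<le> T0" "Q4 \<le> T0" "U \<le> 2 * T0" by - linarith+
    have Qge: "Q1 \<le> real Q" "Q2 \<le> real Q" "Q3 \<le> real Q" if Q: "2 * T0 < (real Q)\<^sup>2" for Q :: nat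
    proof -
      have "Q1\<^sup>2 \<le> (real Q)\<^sup>2" "Q2\<^sup>2 \<le> (real Q)\<^sup>2" "Q3\<^sup>2 \<le> (real Q)\<^sup>2"
        using Q T0' by - linarith+
      then show "Q1 \<le> real Q" "Q2 \<le> real Q" "Q3 \<le> real Q" using power2_le_imp_le of_nat_0_le_iff by blast+
    qed
    have Ta: "4 * real DD * (8 * (4 * real KK * fact KK * t) powr c + 1) \<le> t" if t: "t \<ge> T0" for t
    proof -
      have t1: "t \<ge> 1" "t \<ge> Q4" using t T0 by - linarith+
      have tc: "t powr c \<ge> 1" using t1 c0 by (intro ge_one_powr_ge_zero) auto
      have "(4 * real KK * fact KK * t) powr c = B0 * t powr c" unfolding B0_def by (rule powr_mult)
      then have "4 * real DD * (8 * (4 * real KK * fact KK * t) powr c + 1) \<le> 4 * real DD * (8 * (B0 * t powr c) + t powr c)"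
        using tc by (intro mult_left_mono) auto
      also have "\<dots> = (4 * real DD * (8 * B0 + 1)) * t powr c" by (simp add: algebra_simps)
      also have "\<dots> \<le> t powr (1 - c) * t powr c" using Q4(2)[OF t1(2)] by (intro mult_right_mono) auto
      also have "\<dots> = t powr (1 - c + c)" by (rule powr_add[symmetric])
      also have "\<dots> = t" using t1 by simp
      finally show ?thesis .
    qed
    define M where "M = (2 * (729 * T0) ^ k) powr (1 / c)"
    define Kb1 where "Kb1 = 16 * real KK * fact KK * (243 * T0) ^ 3 * M\<^sup>2"
    define Kb2 where "Kb2 = 4 * real s0 * (2 * real KK * (fact KK)\<^sup>2 * M\<^sup>2) * (64 * (32 * 3 ^ k / N\<nu>) ^ C) ^ 5"
    define Kb3 where "Kb3 = 64 * real KK * fact KK * M"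
    define Kb where "Kb = Kb1 + Kb2 + Kb3"
    have Kbn: "Kb1 \<ge> 0" "Kb2 \<ge> 0" "Kb3 \<ge> 0"
      unfolding Kb1_def Kb2_def Kb3_def M_def using T0 N\<nu> by auto
    \<comment> \<open>With side lengths of at least kappa / eps_i^2, each of the k terms in the
      hypothesis on the side lengths is at most 1 / kappa, and together they stay below nu.\<close>
    define \<kappa> where "\<kappa> = real k / N\<nu>"
    have \<kappa>: "\<kappa> \<ge> 1"
    proof -
      have "1 / 1 \<le> real k / N\<nu>" using k N\<nu> by (intro frac_le) auto
      then show ?thesis unfolding \<kappa>_def by simp
    qed
    \<comment> \<open>The constant in the bound of \<open>Kb * P.vol powr Ex\<close> by a multiple
      of Delta^(-2 Ex); x > G^2 makes it smaller than the square root of x.\<close>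
    define G where "G = Kb * ((8 * \<kappa>) ^ k) powr Ex"
    have G0: "G \<ge> 0" unfolding G_def Kb_def using Kbn by simp
    show "\<exists>C_dk>2. \<forall>(f :: nat \<Rightarrow> real poly) (\<epsilon> :: nat \<Rightarrow> real) (x :: real).
          (\<forall>i\<in>{1..k}. degree (f i) \<le> d \<and> poly (f i) 0 = 0) \<longrightarrow>
          (\<forall>i\<in>{1..k}. \<epsilon> i \<in> {0<..1/100}) \<longrightarrow>
          inverse (\<Prod>i\<in>{1..k}. \<epsilon> i) \<le> x powr (1 / (4 * Ex)) \<longrightarrow>
          x > C_dk \<longrightarrow>
          (\<exists>n::nat. n > 0 \<and> real n < x \<and>
            (\<forall>i\<in>{1..k}. dist_nearest_int (poly (f i) (real n)) \<le> \<epsilon> i))"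
    proof (rule exI[of _ "G\<^sup>2 + 3"], intro conjI allI impI)
      have "G\<^sup>2 \<ge> 0" by simp
      then show "2 < G\<^sup>2 + 3" by linarith
      fix f :: "nat \<Rightarrow> real poly" and \<epsilon> :: "nat \<Rightarrow> real" and x :: real
      assume f: "\<forall>i\<in>{1..k}. degree (f i) \<le> d \<and> poly (f i) 0 = 0"
        and eps: "\<forall>i\<in>{1..k}. \<epsilon> i \<in> {0<..1/100}"
        and y: "inverse (\<Prod>i\<in>{1..k}. \<epsilon> i) \<le> x powr (1 / (4 * Ex))" and x: "G\<^sup>2 + 3 < x"
      have x0: "x > 0" using x \<open>G\<^sup>2 \<ge> 0\<close> by linarith
      define n0 where "n0 i = nat \<lceil>\<kappa> / (\<epsilon> i)\<^sup>2\<rceil>" for i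
      have eps': "0 < \<epsilon> i" "\<epsilon> i \<le> 1" if "i \<in> {1..k}" for i using eps that by force+
      have n0: "\<kappa> / (\<epsilon> i)\<^sup>2 \<le> real (n0 i)" "real (n0 i) \<le> 2 * (\<kappa> / (\<epsilon> i)\<^sup>2)" "n0 i \<ge> 1" if i: "i \<in> {1..k}" for i
      proof -
        define z where "z = \<kappa> / (\<epsilon> i)\<^sup>2"
        have "(\<epsilon> i)\<^sup>2 \<le> 1" using eps'[OF i] by (simp add: power_le_one)
        then have "1 / 1 \<le> z" unfolding z_def using \<kappa> eps'[OF i] by (intro frac_le) auto
        then have "z \<ge> 1" by simp
        then have "z \<le> real (nat \<lceil>z\<rceil>)" "real (nat \<lceil>z\<rceil>) \<le> 2 * z" by - linarith+
        then have "z \<le> real (n0 i)" "real (n0 i) \<le> 2 * z" "real (n0 i) \<ge> 1" using \<open>z \<ge> 1\<close> unfolding n0_def z_def[symmetric] by - linarith+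
        then show "\<kappa> / (\<epsilon> i)\<^sup>2 \<le> real (n0 i)" "real (n0 i) \<le> 2 * (\<kappa> / (\<epsilon> i)\<^sup>2)" "n0 i \<ge> 1" unfolding z_def by simp_all
      qed
      interpret P: polynomial_system k d f n0 x
        using k assms x0 n0(3) f by unfold_locales auto
      have PD: "P.D = DD" unfolding P.D_def DD_def by simp
      have P\<nu>: "P.\<nu> = N\<nu>" unfolding P.\<nu>_def N\<nu>_def PD ..
      have PK: "P.K0 = KK" unfolding P.K0_def KK_def PD ..
      have epssum: "(\<Sum>i\<in>{1..k}. 1 / (4 * (\<epsilon> i)\<^sup>2 * real (P.side i))) \<le> N\<nu>"
      proof -
        have "(\<Sum>i\<in>{1..k}. 1 / (4 * (\<epsilon> i)\<^sup>2 * real (P.side i))) \<le> (\<Sum>i\<in>{1..k}. 1 / \<kappa>)"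
        proof (rule sum_mono)
          fix i assume i: "i \<in> {1..k}"
          have "\<kappa> \<le> real (n0 i) * (\<epsilon> i)\<^sup>2" using n0(1)[OF i] eps'[OF i] by (simp add: pos_divide_le_eq)
          also have "\<dots> \<le> 4 * (\<epsilon> i)\<^sup>2 * real (P.side i)" unfolding P.side_def by simp
          finally show "1 / (4 * (\<epsilon> i)\<^sup>2 * real (P.side i)) \<le> 1 / \<kappa>" using \<kappa> eps'(1)[OF i] P.side_pos[OF i]
            by (intro divide_left_mono mult_pos_pos) auto
        qed
        also have "\<dots> = N\<nu>" unfolding \<kappa>_def using k by simp
        finally show ?thesis .
      qed
      define yy where "yy = inverse (\<Prod>i\<in>{1..k}. \<epsilon> i)"
      have yy0: "yy > 0" unfolding yy_def by (intro positive_imp_inverse_positive prod_pos eps'(1))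
      have volb: "P.vol \<le> (8 * \<kappa>) ^ k * yy\<^sup>2"
      proof -
        have "P.vol \<le> (\<Prod>i\<in>{1..k}. 8 * \<kappa> * (inverse (\<epsilon> i))\<^sup>2)"
          unfolding P.vol_def
        proof (rule prod_mono)
          fix i assume i: "i \<in> {1..k}"
          show "0 \<le> real (P.side i) \<and> real (P.side i) \<le> 8 * \<kappa> * (inverse (\<epsilon> i))\<^sup>2"
            using n0(2)[OF i] unfolding P.side_def by (simp add: divide_inverse power_inverse)
        qed
        also have "\<dots> = (8 * \<kappa>) ^ k * (\<Prod>i\<in>{1..k}. (inverse (\<epsilon> i))\<^sup>2)" by (simp add: prod.distrib)
        also have "(\<Prod>i\<in>{1..k}. (inverse (\<epsilon> i))\<^sup>2) = yy\<^sup>2"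
          unfolding yy_def by (simp only: prod_power_distrib[symmetric] prod_inversef[symmetric] o_def)
        finally show ?thesis .
      qed
      have "Kb * P.vol powr Ex < x"
      proof -
        have "P.vol powr Ex \<le> ((8 * \<kappa>) ^ k * yy\<^sup>2) powr Ex"
          using volb P.vol_ge_1 Ex by (intro powr_mono2) auto
        also have "\<dots> = ((8 * \<kappa>) ^ k) powr Ex * (yy\<^sup>2) powr Ex" by (rule powr_mult)
        finally have 1: "Kb * P.vol powr Ex \<le> G * (yy\<^sup>2) powr Ex"
          unfolding G_def using Kbn mult_left_mono[of "P.vol powr Ex" "((8 * \<kappa>) ^ k) powr Ex * (yy\<^sup>2) powr Ex" Kb] unfolding Kb_def by (simp add: mult.assoc)
        have "yy\<^sup>2 \<le> (x powr (1 / (4 * Ex)))\<^sup>2" using y yy0 unfolding yy_def by (intro power_mono) auto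
        also have "\<dots> = x powr (1 / (4 * Ex) + 1 / (4 * Ex))" unfolding power2_eq_square by (rule powr_add[symmetric])
        also have "1 / (4 * Ex) + 1 / (4 * Ex) = 1 / (2 * Ex)" using Ex by (simp add: field_simps)
        finally have "(yy\<^sup>2) powr Ex \<le> (x powr (1 / (2 * Ex))) powr Ex" using Ex by (intro powr_mono2) auto
        also have "\<dots> = x powr (1 / (2 * Ex) * Ex)" by (rule powr_powr)
        also have "1 / (2 * Ex) * Ex = 1 / 2" using Ex by simp
        also have "x powr (1 / 2) = sqrt x" using x0 by (simp add: powr_half_sqrt)
        finally have "G * (yy\<^sup>2) powr Ex \<le> G * sqrt x" using G0 by (intro mult_left_mono) auto
        also have "\<dots> < sqrt x * sqrt x"
        proof (rule mult_strict_right_mono)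
          have "G\<^sup>2 < x" using x by linarith
          then show "G < sqrt x" by (rule real_less_rsqrt)
        qed (use x0 in auto)
        also have "\<dots> = x" using x0 by simp
        finally show ?thesis using 1 by linarith
      qed
      then have X: "Kb * P.vol powr (4 / c + 5 * real C + 16 / c1 + 3) < x" unfolding Ex_def .
      have "\<exists>n>0. real n < x \<and> (\<forall>i\<in>{1..k}. near (poly (f i) (real n)) (\<epsilon> i))"
      proof (rule P.exists_solution[OF weylC C1 c1_def c_def _ s0(1) m T0(1) _ _ T0(4)[unfolded U_def] _ _ _ _ _ M_def _ _ _ X], unfold PD P\<nu> PK)
        show "1024 / N\<nu> \<le> 2 ^ i1" using i1 by simp
        show "4 * real DD \<le> T0" by (rule T0(2))
        show "4 * real DD * (8 * (4 * real KK * fact KK * t) powr c + 1) \<le> t" if "T0 \<le> t" for t by (rule Ta[OF that])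
        show "2 * real s0 * real m ^ 2 ^ m \<le> real Q powr (c1\<^sup>2 / (128 * real s0))" if "2 * T0 < (real Q)\<^sup>2" for Q :: nat
          using Q1(2)[OF Qge(1)[OF that]] by simp
        show "6 ^ DD * 2 * 2 ^ s0 * real m ^ 2 ^ m * (8 * (2 * real KK * fact KK) powr c) \<le> real Q powr (c1 / 8)" if "2 * T0 < (real Q)\<^sup>2" for Q :: nat
          using Q2(2)[OF Qge(2)[OF that]] by simp
        show "(3 * real s0) ^ k < real Q powr (c1 / 8)" if "2 * T0 < (real Q)\<^sup>2" for Q :: nat
          by (rule Q3(2)[OF Qge(3)[OF that]])
        show "0 < \<epsilon> i" if "i \<in> {1..k}" for i by (rule eps'(1)[OF that])
        show "(\<Sum>i\<in>{1..k}. 1 / (4 * (\<epsilon> i)\<^sup>2 * real (P.side i))) \<le> N\<nu>" by (rule epssum)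
        show "16 * real KK * fact KK * (243 * T0) ^ 3 * M\<^sup>2 \<le> Kb" using Kbn unfolding Kb_def Kb1_def[symmetric] by linarith
        show "4 * real s0 * (2 * real KK * (fact KK)\<^sup>2 * M\<^sup>2) * (64 * (32 * 3 ^ k / N\<nu>) ^ C) ^ 5 \<le> Kb"
          using Kbn unfolding Kb_def Kb2_def[symmetric] by linarith
        show "64 * real KK * fact KK * M \<le> Kb" using Kbn unfolding Kb_def Kb3_def[symmetric] by linarith
      qed
      then obtain n where n: "n > 0" "real n < x" "\<forall>i\<in>{1..k}. near (poly (f i) (real n)) (\<epsilon> i)" by blast
      then show "\<exists>n::nat. n > 0 \<and> real n < x \<and> (\<forall>i\<in>{1..k}. dist_nearest_int (poly (f i) (real n)) \<le> \<epsilon> i)"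
        using dist_nearest_int_le_if_near by blast
    qed
  qed
qed

end
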